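(* Let $n\ge 2$, $k\ge 1$ be integers and let $\lambda,\mu\in\mathcal P_{\le n-1,k}$. Perform the following procedure on formal integer combinations of Schur symbols $s_\alpha$ in $k$ variables. (1) Start from the Littlewood--Richardson expansion $s_{\lambda^t}s_{\mu^t}=\sum_{\rho}c_{\lambda\mu}^{\rho}\,s_{\rho^t}$ and discard all terms for which the partition $\rho^t$ has length $>k$. (2) For each remaining term $s_{\rho^t}$ with $\rho^t=(\rho^t_1,\dots,\rho^t_k)$ and $\rho^t_1\ge n$, make the replacement $$s_{\rho^t}\;\longrightarrow\; s_{(\rho^t_2,\dots,\rho^t_k,\rho^t_1-n)} .$$ Whenever $(\rho^t_2,\dots,\rho^t_k,\rho^t_1-n)$ is not a partition, use the straightening rules $$s_{(\dots,a,b,\dots)}=-s_{(\dots,b-1,a+1,\dots)},\qquad s_{(\dots,a,a+1,\dots)}=0$$ (applied to adjacent entries) to rewrite it as $0$ or as $\pm s_{\alpha}$ with $\alpha$ a partition. Repeat this until every remaining term is of the form $\pm s_{\nu^t}$ with $\nu^t$ a partition satisfying $\nu^t_1<n$, i.e. $\nu\in\mathcal P_{\le n-1,k}$. (3) Collect terms. Then, for every $\nu\in\mathcal P_{\le n-1,k}$, the resulting total coefficient of $s_{\nu^t}$ equals the fusion coefficient $\mathcal N^{(k)\hat\nu}_{\hat\lambda\hat\mu}$ of the $\widehat{\mathfrak{su}}(n)_k$ WZNW fusion ring.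
   Context: $\mathcal P_{\le n-1,k}$ is the set of partitions $\lambda=(\lambda_1\ge\dots\ge\lambda_{n-1}\ge 0)$ with $\lambda_1\le k$ (Young diagram inside a box of height $n-1$ and width $k$). It is in bijection with the set $P_k^+$ of level-$k$ dominant integral weights $\hat\lambda=\sum_{i=1}^n m_i\hat\omega_i$ of $\widehat{\mathfrak{su}}(n)$ ($m_i\in\mathbb Z_{\ge0}$, $\sum_i m_i=k$, with $\hat\omega_i$ the fundamental affine weights and label $n$ the affine node) via $m_i=\lambda_i-\lambda_{i+1}$ for $1\le i\le n-1$ (with $\lambda_n=0$) and $m_n=k-\lambda_1$. $\lambda^t$ denotes the transposed (conjugate) partition; $\emptyset$ is the empty partition. $c_{\lambda\mu}^\rho$ are the Littlewood--Richardson coefficients (they satisfy $c_{\lambda\mu}^{\rho}=c_{\lambda^t\mu^t}^{\rho^t}$). Partitions of length $\le k$ are padded with zeros to $k$ entries. The fusion coefficients are defined by the Verlinde formula $$\mathcal N_{\hat\lambda\hat\mu}^{(k)\hat\nu}=\sum_{\sigma\in\mathcal P_{\le n-1,k}}\frac{S_{\lambda\sigma}S_{\mu\sigma}\overline{S_{\nu\sigma}}}{S_{\emptyset\sigma}},$$ where $S$ is the (unitary) modular $S$-matrix given by $$S_{\lambda\sigma}=\frac{e^{i\pi n(n-1)/4}}{\sqrt{n(k+n)^{n-1}}}\sum_{w\in W}(-1)^{\ell(w)}e^{-\frac{2\pi i}{k+n}(\sigma+\rho,\,w(\lambda+\rho))}.$$ Here $W\cong \mathbb S_n$ is the Weyl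 group of $\mathfrak{su}(n)$, acting by permuting the coordinates of $\mathbb R^n$, a partition $\lambda$ is identified with the finite weight $(\lambda_1,\dots,\lambda_{n-1},0)-\frac{|\lambda|}{n}(1,\dots,1)\in\mathbb R^n$, $\rho$ in this formula is the Weyl vector $(\frac{n-1}{2},\frac{n-3}{2},\dots,-\frac{n-1}{2})$, and $(\cdot,\cdot)$ is the standard inner product on $\mathbb R^n$. *)

theory Defs
  imports Complex_Main "HOL-Library.Poly_Mapping" "HOL-Combinatorics.Permutations"
begin

section \<open>Partitions\<close>

text \<open>A partition is a weakly decreasing, eventually vanishing sequence of naturals. Indices
  start at 0, so the part usually written with subscript \<open>i\<close> is \<open>\<alpha> (i - 1)\<close>.\<close>

definition is_partition :: "(nat \<Rightarrow> nat) \<Rightarrow> bool" where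
  "is_partition \<alpha> \<longleftrightarrow> antimono \<alpha> \<and> finite {i. \<alpha> i \<noteq> 0}"

definition plength :: "(nat \<Rightarrow> nat) \<Rightarrow> nat" where
  "plength \<alpha> = card {i. \<alpha> i \<noteq> 0}"

definition conjugate :: "(nat \<Rightarrow> nat) \<Rightarrow> (nat \<Rightarrow> nat)" where
  "conjugate \<alpha> = (\<lambda>j. card {i. j < \<alpha> i})"

abbreviation empty_partition :: "nat \<Rightarrow> nat" where
  "empty_partition \<equiv> (\<lambda>_. 0)"

definition box_partitions :: "nat \<Rightarrow> nat \<Rightarrow> (nat \<Rightarrow> nat) set" where
  "box_partitions h w = {\<alpha>. is_partition \<alpha> \<and> plength \<alpha> \<le> h \<and> \<alpha> 0 \<le> w}"


section \<open>Schur polynomials and Littlewood--Richardson coefficients\<close>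

type_synonym int_mpoly = "(nat \<Rightarrow>\<^sub>0 nat) \<Rightarrow>\<^sub>0 int"

definition mvar :: "nat \<Rightarrow> int_mpoly" where
  "mvar i = Poly_Mapping.single (Poly_Mapping.single i 1) 1"

definition alternant :: "nat \<Rightarrow> (nat \<Rightarrow> nat) \<Rightarrow> int_mpoly" where
  "alternant N e = (\<Sum>p | p permutes {..<N}. of_int (sign p) * (\<Prod>i<N. mvar (p i) ^ e i))"

text \<open>The Schur polynomial in the variables \<open>mvar 0, \<dots>, mvar (N - 1)\<close>, as the quotient of
  the alternant with exponents \<open>\<alpha> + \<delta>\<close> by the Vandermonde alternant with exponents
  \<open>\<delta> = (N - 1, \<dots>, 1, 0)\<close>; it is 0 if the partition has more than \<open>N\<close> parts.\<close>

definition schur :: "nat \<Rightarrow> (nat \<Rightarrow> nat) \<Rightarrow> int_mpoly" where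
  "schur N \<alpha> =
     (if plength \<alpha> \<le> N
      then (THE s. s * alternant N (\<lambda>i. N - Suc i) = alternant N (\<lambda>i. \<alpha> i + (N - Suc i)))
      else 0)"

text \<open>The Littlewood--Richardson coefficients are the structure constants of multiplication of
  Schur functions, an identity of Schur functions being one of Schur polynomials for every
  number of variables. The finitely supported family of coefficients is the formal
  combination of partitions \<open>LR \<alpha> \<beta>\<close>.\<close>

definition LR :: "(nat \<Rightarrow> nat) \<Rightarrow> (nat \<Rightarrow> nat) \<Rightarrow> ((nat \<Rightarrow> nat) \<Rightarrow>\<^sub>0 int)" where
  "LR \<alpha> \<beta> =
     (THE c. Poly_Mapping.keys c \<subseteq> Collect is_partition \<and>
             (\<forall>N. schur N \<alpha> * schur N \<beta> = frag_extend (schur N) c))"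


section \<open>The reduction procedure on formal combinations of Schur symbols\<close>

text \<open>A Schur symbol in \<open>k\<close> variables is a list of \<open>k\<close> integers, not necessarily a partition.\<close>

type_synonym symbols = "int list \<Rightarrow>\<^sub>0 int"

definition symbol_of :: "nat \<Rightarrow> (nat \<Rightarrow> nat) \<Rightarrow> int list" where
  "symbol_of k \<alpha> = map (\<lambda>i. int (\<alpha> i)) [0..<k]"

definition partition_symbol :: "int list \<Rightarrow> bool" where
  "partition_symbol as \<longleftrightarrow> sorted_wrt (\<ge>) as \<and> (\<forall>a\<in>set as. 0 \<le> a)"

text \<open>Replace one symbol occurring in a formal combination, with its whole coefficient, by a
  combination permitted by the rule \<open>r\<close>.\<close>

definition rewrite_term ::
    "(int list \<Rightarrow> symbols \<Rightarrow> bool) \<Rightarrow> symbols \<Rightarrow> symbols \<Rightarrow> bool" where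
  "rewrite_term r X Y \<longleftrightarrow>
     (\<exists>as R. as \<in> Poly_Mapping.keys X \<and> r as R \<and>
             Y = X + frag_cmul (Poly_Mapping.lookup X as) (R - frag_of as))"

inductive straightening_rule :: "int list \<Rightarrow> symbols \<Rightarrow> bool" where
  swap: "straightening_rule (xs @ [a, b] @ ys) (- frag_of (xs @ [b - 1, a + 1] @ ys))"
| vanish: "straightening_rule (xs @ [a, a + 1] @ ys) 0"

text \<open>The replacement of a partition symbol whose first entry is at least \<open>n\<close>, the result being
  straightened if necessary. Straightening may take any route through the rules, as long as
  it arrives at 0 or at a signed partition symbol.\<close>

inductive replacement_rule :: "nat \<Rightarrow> int list \<Rightarrow> symbols \<Rightarrow> bool" for n where
  shift:
    "partition_symbol (a # as) \<Longrightarrow> a \<ge> int n \<Longrightarrow> partition_symbol (as @ [a - int n]) \<Longrightarrow>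
     replacement_rule n (a # as) (frag_of (as @ [a - int n]))"
| shift_straighten:
    "partition_symbol (a # as) \<Longrightarrow> a \<ge> int n \<Longrightarrow> \<not> partition_symbol (as @ [a - int n]) \<Longrightarrow>
     (rewrite_term straightening_rule)\<^sup>*\<^sup>* (frag_of (as @ [a - int n])) R \<Longrightarrow>
     R = 0 \<or> (\<exists>bs. partition_symbol bs \<and> (R = frag_of bs \<or> R = - frag_of bs)) \<Longrightarrow>
     replacement_rule n (a # as) R"

definition reduction_step :: "nat \<Rightarrow> symbols \<Rightarrow> symbols \<Rightarrow> bool" where
  "reduction_step n = rewrite_term (replacement_rule n)"

definition initial_combination ::
    "nat \<Rightarrow> (nat \<Rightarrow> nat) \<Rightarrow> (nat \<Rightarrow> nat) \<Rightarrow> symbols" where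
  "initial_combination k \<alpha> \<beta> =
     frag_extend
       (\<lambda>\<gamma>. if plength (conjugate \<gamma>) \<le> k then frag_of (symbol_of k (conjugate \<gamma>)) else 0)
       (LR \<alpha> \<beta>)"

definition fully_reduced :: "nat \<Rightarrow> nat \<Rightarrow> symbols \<Rightarrow> bool" where
  "fully_reduced n k X \<longleftrightarrow>
     (\<forall>as\<in>Poly_Mapping.keys X. \<exists>\<nu>\<in>box_partitions (n - 1) k. as = symbol_of k (conjugate \<nu>))"


section \<open>Modular S-matrix and fusion coefficients\<close>

definition finite_weight :: "nat \<Rightarrow> (nat \<Rightarrow> nat) \<Rightarrow> nat \<Rightarrow> real" where
  "finite_weight n \<alpha> i = real (\<alpha> i) - real (\<Sum>j<n. \<alpha> j) / real n"

definition weyl_vector :: "nat \<Rightarrow> nat \<Rightarrow> real" where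
  "weyl_vector n i = (real n - 1) / 2 - real i"

definition S_matrix :: "nat \<Rightarrow> nat \<Rightarrow> (nat \<Rightarrow> nat) \<Rightarrow> (nat \<Rightarrow> nat) \<Rightarrow> complex" where
  "S_matrix n k \<alpha> \<sigma> =
     exp (\<i> * of_real (pi * real n * (real n - 1) / 4)) /
       of_real (sqrt (real n * real (k + n) ^ (n - 1))) *
     (\<Sum>w | w permutes {..<n}.
        of_int (sign w) *
        exp (- (2 * of_real pi * \<i> / of_nat (k + n)) *
             of_real (\<Sum>i<n. (finite_weight n \<sigma> i + weyl_vector n i) *
                              (finite_weight n \<alpha> (w i) + weyl_vector n (w i)))))"

definition fusion_coeff ::
    "nat \<Rightarrow> nat \<Rightarrow> (nat \<Rightarrow> nat) \<Rightarrow> (nat \<Rightarrow> nat) \<Rightarrow> (nat \<Rightarrow> nat) \<Rightarrow> complex" where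
  "fusion_coeff n k \<alpha> \<beta> \<nu> =
     (\<Sum>\<sigma>\<in>box_partitions (n - 1) k.
        S_matrix n k \<alpha> \<sigma> * S_matrix n k \<beta> \<sigma> * cnj (S_matrix n k \<nu> \<sigma>) /
        S_matrix n k empty_partition \<sigma>)"

end

(*
  Let N = n + k. Up to a prefactor independent of lambda, S_{lambda sigma} is the alternant
  a_{lambda + delta}(x), where the n variables x_i = x_i(sigma) are distinct, have product 1 and
  the same N-th power. So, with u = (-x_i)^N, the power series g(t) = prod_i (1 + x_i t) / (1 - u t^N)
  is the reciprocal of a polynomial of degree k. Extend its coefficients to all integers by
  g(m + N) = u g(m); then the k by k determinant F(c) = det (g(c_i - i + j)) is defined for every
  Schur symbol c.
  Interchanging rows gives the straightening rules, and the linear recurrence of length k together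
  with quasiperiodicity gives F(c_2, ..., c_k, c_1 - n) = F(c). Hence F is constant along the reduction.
  By the dual Jacobi-Trudi identity, F(nu^t) = S_{nu sigma} / S_{0 sigma} for nu in the box.
  The same identity at complex numbers z_1, ..., z_q whose elementary symmetric functions are
  prescribed to be g(0), g(1), ..., g(M) turns the product of Schur polynomials into the product of
  the values of F; partitions with first part > k contribute 0 because of the recurrence.
  So the final combination X satisfies S_{lambda sigma} S_{mu sigma} / S_{0 sigma} =
  sum_kappa X_kappa S_{kappa sigma} for every sigma, and unitarity of S extracts X_nu.
*)
theory Submission
  imports
    "HOL-Computational_Algebra.Fundamental_Theorem_Algebra"
    "Jordan_Normal_Form.Determinant"
    Defs (* last, so that conjugate is not captured by the type class operation of the same name *)
begin

section \<open>The dual Jacobi--Trudi identity\<close>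

text \<open>The obstacle is that the procedure works with k entries and indices modulo n + k, while
  Littlewood-Richardson coefficients are fixed by Schur polynomials in all numbers of variables. The
  bridge is the ring homomorphism that sends the elementary symmetric function e_m to g(m) for m >=
  0; elementary rather than complete functions occur because the symbols are transposed. A single
  product involves finitely many partitions, so finitely many prescribed e_m suffice, and the
  fundamental theorem of algebra supplies the z_i. For unitarity, a sum over the box is 1/(n - 1)!
  times a sum over (n - 1)-tuples modulo n + k, a last coordinate being frozen at 0. It factors into
  geometric sums if the sizes of the two partitions agree modulo n; otherwise n-th roots of unity
  remain in the exponents, and the rotation of the affine diagram shows that the sum is 0. The
  theorem also claims that the reduction stops and never gets stuck. The latter needs a successful
  straightening of every rotated symbol, found by moving its last entry leftwards.\<close>

definition esym :: "nat \<Rightarrow> (nat \<Rightarrow> 'a::comm_ring_1) \<Rightarrow> nat \<Rightarrow> 'a" where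
  "esym q z m = (\<Sum>S | S \<subseteq> {..<q} \<and> card S = m. \<Prod>i\<in>S. z i)"

definition esym_int :: "nat \<Rightarrow> (nat \<Rightarrow> 'a::comm_ring_1) \<Rightarrow> int \<Rightarrow> 'a" where
  "esym_int q z m = (if m < 0 then 0 else esym q z (nat m))"

definition alt :: "nat \<Rightarrow> (nat \<Rightarrow> 'a::comm_ring_1) \<Rightarrow> (nat \<Rightarrow> nat) \<Rightarrow> 'a" where
  "alt q z e = (\<Sum>p | p permutes {..<q}. of_int (sign p) * (\<Prod>i<q. z (p i) ^ e i))"

text \<open>The dual Jacobi-Trudi determinant, with an arbitrary sequence \<open>g\<close> in the
  place of the elementary symmetric functions and with integer entries \<open>c\<close>: it will be
  evaluated at quasiperiodic sequences and at symbols that are not partitions.\<close>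

definition jt :: "nat \<Rightarrow> (int \<Rightarrow> 'a::comm_ring_1) \<Rightarrow> (nat \<Rightarrow> int) \<Rightarrow> 'a" where
  "jt L g c = det (mat L L (\<lambda>(i, j). g (c i - int i + int j)))"

lemma alternant_eq_alt: "alternant N e = alt N mvar e"
  by (simp add: alternant_def alt_def)

lemma finite_card_subsets [simp]: "finite {S. S \<subseteq> {..<q::nat} \<and> card S = m}"
  by (rule finite_subset[of _ "Pow {..<q}"]) auto

lemma esym_eq_0: "m > q \<Longrightarrow> esym q z m = 0"
proof -
  assume "m > q"
  then have "{S. S \<subseteq> {..<q} \<and> card S = m} = {}"
    by (auto dest!: card_mono[OF finite_lessThan])
  then show ?thesis unfolding esym_def by (simp only: sum.empty)
qed

lemma esym_0 [simp]: "esym q z 0 = 1"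
proof -
  have "{S. S \<subseteq> {..<q} \<and> card S = 0} = {{}}"
    by (auto dest: finite_subset)
  then show ?thesis unfolding esym_def by simp
qed

lemma prod_add_eq_sum_esym:
  fixes w v :: "'a::comm_ring_1"
  shows "(\<Prod>i<q. v * z i + w) = (\<Sum>m\<le>q. v ^ m * esym q z m * w ^ (q - m))"
proof -
  have "(\<Prod>i<q. v * z i + w) = (\<Sum>X\<in>Pow {..<q}. (\<Prod>x\<in>X. v * z x) * (\<Prod>x\<in>{..<q}-X. w))"
    by (rule prod_add) simp
  also have "\<dots> = (\<Sum>X\<in>Pow {..<q}. v ^ card X * (\<Prod>x\<in>X. z x) * w ^ (q - card X))"
    by (rule sum.cong[OF refl]) (auto simp: prod.distrib card_Diff_subset finite_subset)
  also have "\<dots> = (\<Sum>m\<in>{..q}. \<Sum>X\<in>{X\<in>Pow {..<q}. card X = m}. v ^ card X * (\<Prod>x\<in>X. z x) * w ^ (q - card X))"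
    by (rule sum.group[symmetric]) (auto intro: order_trans[OF card_mono[of "{..<q}"]])
  also have "\<dots> = (\<Sum>m\<le>q. v ^ m * esym q z m * w ^ (q - m))"
    unfolding esym_def by (intro sum.cong refl) (simp add: sum_distrib_left sum_distrib_right)
  finally show ?thesis .
qed

section \<open>Alternants as determinants, and expansion along unit rows\<close>

lemma alt_eq_det:
  "alt q z e = det (mat q q (\<lambda>(i, j). z j ^ e i))"
proof -
  have "det (mat q q (\<lambda>(i, j). z j ^ e i)) =
      (\<Sum>p | p permutes {0..<q}. of_int (sign p) * (\<Prod>i = 0..<q. mat q q (\<lambda>(i, j). z j ^ e i) $$ (i, p i)))"
    by (rule det_def') simp
  also have "\<dots> = (\<Sum>p | p permutes {..<q}. of_int (sign p) * (\<Prod>i<q. z (p i) ^ e i))"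
  proof (rule sum.cong)
    show "{p. p permutes {0..<q}} = {p. p permutes {..<q}}" by (simp add: atLeast0LessThan)
    fix p assume "p \<in> {p. p permutes {..<q}}"
    then have "\<And>i. i < q \<Longrightarrow> p i < q" using permutes_in_image by fastforce
    then show "of_int (sign p) * (\<Prod>i = 0..<q. mat q q (\<lambda>(i, j). z j ^ e i) $$ (i, p i)) =
        of_int (sign p) * (\<Prod>i<q. z (p i) ^ e i)"
      by (intro arg_cong[of _ _ "\<lambda>x. _ * x"] prod.cong) (auto simp: atLeast0LessThan)
  qed
  finally show ?thesis by (simp add: alt_def)
qed

text \<open>Unit row \<open>q + r\<close> has its 1 in column \<open>q + r - c r\<close>, and these
  columns increase strictly with \<open>r\<close>. Expanding along the last unit row deletes the
  rightmost of them and leaves the other unit rows intact, so induction applies. The cardinality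
  counts the deleted columns to the left of the surviving column number \<open>j\<close>.\<close>

lemma det_unit_rows:
  fixes A :: "nat \<Rightarrow> nat \<Rightarrow> 'a::comm_ring_1"
  assumes "antimono c" and "\<And>r. c r \<le> q"
  shows "det (mat (q + L) (q + L) (\<lambda>(i, j). if i < q then A i j else if j + c (i - q) = i then 1 else 0)) =
    (-1) ^ (\<Sum>r<L. c r) * det (mat q q (\<lambda>(i, j). A i (j + card {r. r < L \<and> q - 1 - j < c r})))"
proof (induction L arbitrary: A)
  case 0
  show ?case by (simp, rule arg_cong[of _ _ det], rule cong_mat) auto
next
  case (Suc L)
  define M where "M = mat (q + Suc L) (q + Suc L)
    (\<lambda>(i, j). if i < q then A i j else if j + c (i - q) = i then 1 else 0)"
  define b where "b = q + L - c L"
  have cL: "c L \<le> q" by (rule assms(2))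
  have b: "b < q + Suc L" "b + c L = q + L" using cL unfolding b_def by auto
  define A' where "A' = (\<lambda>i j. A i (if j < b then j else Suc j))"
  have M: "M \<in> carrier_mat (q + Suc L) (q + Suc L)" unfolding M_def by simp
  have del: "mat_delete M (q + L) b =
    mat (q + L) (q + L) (\<lambda>(i, j). if i < q then A' i j else if j + c (i - q) = i then 1 else 0)"
    (is "_ = ?R")
  proof (rule eq_matI)
    fix i j assume "i < dim_row ?R" "j < dim_col ?R"
    then have ij: "i < q + L" "j < q + L" by auto
    have "i < q \<or> c L \<le> c (i - q)"
      using ij antimonoD[OF assms(1), of "i - q" L] by linarith
    then show "mat_delete M (q + L) b $$ (i, j) = ?R $$ (i, j)"
      using ij b by (auto simp: mat_delete_def M_def A'_def)
  qed (auto simp: mat_delete_def M_def)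
  have "det M = (\<Sum>j<q + Suc L. M $$ (q + L, j) * cofactor M (q + L) j)"
    by (rule laplace_expansion_row[OF M]) simp
  also have "\<dots> = (\<Sum>j<q + Suc L. if j = b then cofactor M (q + L) b else 0)"
    by (rule sum.cong[OF refl]) (use b in \<open>auto simp: M_def\<close>)
  also have "\<dots> = cofactor M (q + L) b" using b by simp
  also have "\<dots> = (-1) ^ (q + L + b) * det (mat_delete M (q + L) b)"
    by (simp add: cofactor_def)
  also have "(-1 :: 'a) ^ (q + L + b) = (-1) ^ c L"
  proof -
    have "q + L + b = 2 * b + c L" using b by simp
    then show ?thesis by (simp only: power_add power_mult) simp
  qed
  also have "det (mat_delete M (q + L) b) = (-1) ^ (\<Sum>r<L. c r) *
      det (mat q q (\<lambda>(i, j). A' i (j + card {r. r < L \<and> q - 1 - j < c r})))"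
    unfolding del by (rule Suc.IH)
  also have "mat q q (\<lambda>(i, j). A' i (j + card {r. r < L \<and> q - 1 - j < c r})) =
      mat q q (\<lambda>(i, j). A i (j + card {r. r < Suc L \<and> q - 1 - j < c r}))"
  proof (rule cong_mat)
    fix i j assume ij: "i < q" "j < q"
    have fin: "finite {r. r < L \<and> q - 1 - j < c r}" by simp
    have le: "card {r. r < L \<and> q - 1 - j < c r} \<le> L"
      using card_mono[of "{..<L}" "{r. r < L \<and> q - 1 - j < c r}"] by auto
    show "(case (i, j) of (i, j) \<Rightarrow> A' i (j + card {r. r < L \<and> q - 1 - j < c r})) =
      (case (i, j) of (i, j) \<Rightarrow> A i (j + card {r. r < Suc L \<and> q - 1 - j < c r}))"
    proof (cases "q - 1 - j < c L")
      case True
      then have "{r. r < L \<and> q - 1 - j < c r} = {..<L}"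
        using less_le_trans[OF True antimonoD[OF assms(1)]] by auto
      moreover from True have "{r. r < Suc L \<and> q - 1 - j < c r} = {..<Suc L}"
        using less_le_trans[OF True antimonoD[OF assms(1)]] by auto
      moreover have "b \<le> j + L" using True ij b by linarith
      ultimately show ?thesis by (simp add: A'_def)
    next
      case False
      then have "{r. r < Suc L \<and> q - 1 - j < c r} = {r. r < L \<and> q - 1 - j < c r}"
        by (auto simp: less_Suc_eq)
      moreover have "j + card {r. r < L \<and> q - 1 - j < c r} < b" using False ij b le by linarith
      ultimately show ?thesis by (simp add: A'_def)
    qed
  qed auto
  finally show ?case unfolding M_def by (simp add: power_add mult_ac)
qed

text \<open>The sum is \<open>z i ^ (j - q)\<close> times Q(z i), where Q(t) is the product of all t
  - z l, and \<open>z i\<close> is one of the roots of Q.\<close>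

lemma sum_esym_eq_0:
  fixes z :: "nat \<Rightarrow> 'a::comm_ring_1"
  assumes "i < q" "q \<le> j"
  shows "(\<Sum>m\<le>j. (-1) ^ m * esym q z m * z i ^ (j - m)) = 0"
proof -
  have "(\<Sum>m\<le>j. (-1) ^ m * esym q z m * z i ^ (j - m)) =
      (\<Sum>m\<le>q. (-1) ^ m * esym q z m * z i ^ (j - m))"
    by (rule sum.mono_neutral_right) (use assms in \<open>auto simp: esym_eq_0\<close>)
  also have "\<dots> = (\<Sum>m\<le>q. (-1) ^ m * esym q z m * z i ^ (q - m) * z i ^ (j - q))"
  proof (rule sum.cong[OF refl])
    fix m assume "m \<in> {..q}"
    then have "j - m = (q - m) + (j - q)" using assms by auto
    then show "(-1) ^ m * esym q z m * z i ^ (j - m) = (-1) ^ m * esym q z m * z i ^ (q - m) * z i ^ (j - q)"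
      by (simp only: power_add mult.assoc)
  qed
  also have "\<dots> = (\<Prod>l<q. (-1) * z l + z i) * z i ^ (j - q)"
    unfolding prod_add_eq_sum_esym by (simp add: sum_distrib_right)
  also have "(\<Prod>l<q. (-1) * z l + z i) = 0"
    by (rule prod_zero) (use assms in auto)
  finally show ?thesis by simp
qed

text \<open>Along a permutation \<open>p\<close>, the numbers \<open>i\<close> and
  \<open>p i\<close> have the same sum, so together they contribute an even exponent and only the
  signs of the \<open>a i\<close> survive.\<close>

lemma det_sign_scale:
  fixes f :: "nat \<Rightarrow> nat \<Rightarrow> 'a::comm_ring_1"
  shows "det (mat L L (\<lambda>(i, j). (-1) ^ (a i + i + j) * f i j)) =
    (-1) ^ (\<Sum>i<L. a i) * det (mat L L (\<lambda>(i, j). f i j))"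
proof -
  have "det (mat L L (\<lambda>(i, j). (-1) ^ (a i + i + j) * f i j)) =
    (\<Sum>p | p permutes {0..<L}. of_int (sign p) *
      (\<Prod>i = 0..<L. mat L L (\<lambda>(i, j). (-1) ^ (a i + i + j) * f i j) $$ (i, p i)))"
    by (rule det_def') simp
  also have "\<dots> = (\<Sum>p | p permutes {0..<L}. (-1) ^ (\<Sum>i<L. a i) *
      (of_int (sign p) * (\<Prod>i = 0..<L. mat L L (\<lambda>(i, j). f i j) $$ (i, p i))))"
  proof (rule sum.cong[OF refl])
    fix p assume "p \<in> {p. p permutes {0..<L}}"
    then have p: "p permutes {0..<L}" by simp
    have pL: "p i < L" if "i < L" for i using permutes_in_image[OF p] that by auto
    have "(\<Prod>i = 0..<L. mat L L (\<lambda>(i, j). (-1) ^ (a i + i + j) * f i j) $$ (i, p i)) =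
        (\<Prod>i = 0..<L. (-1) ^ (a i + i + p i) * f i (p i))"
      using pL by (intro prod.cong) auto
    also have "\<dots> = (\<Prod>i = 0..<L. (-1) ^ (a i + i + p i)) * (\<Prod>i = 0..<L. f i (p i))"
      by (rule prod.distrib)
    also have "(\<Prod>i = 0..<L. (-1::'a) ^ (a i + i + p i)) = (-1) ^ (\<Sum>i = 0..<L. a i + i + p i)"
      by (simp add: power_sum)
    also have "(\<Sum>i = 0..<L. a i + i + p i) = (\<Sum>i = 0..<L. a i) + 2 * (\<Sum>i = 0..<L. i)"
      using sum.permute[OF p, of id] by (simp add: sum.distrib comp_def)
    also have "(-1::'a) ^ \<dots> = (-1) ^ (\<Sum>i<L. a i)"
      by (simp add: power_add power_mult atLeast0LessThan)
    also have "(\<Prod>i = 0..<L. f i (p i)) = (\<Prod>i = 0..<L. mat L L (\<lambda>(i, j). f i j) $$ (i, p i))"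
      using pL by (intro prod.cong) auto
    finally show "of_int (sign p) *
        (\<Prod>i = 0..<L. mat L L (\<lambda>(i, j). (-1) ^ (a i + i + j) * f i j) $$ (i, p i)) =
      (-1) ^ (\<Sum>i<L. a i) * (of_int (sign p) * (\<Prod>i = 0..<L. mat L L (\<lambda>(i, j). f i j) $$ (i, p i)))"
      by (simp add: mult_ac)
  qed
  also have "\<dots> = (-1) ^ (\<Sum>i<L. a i) * det (mat L L (\<lambda>(i, j). f i j))"
    by (subst det_def'[where n = L]) (simp_all add: sum_distrib_left)
  finally show ?thesis .
qed

text \<open>Stack \<open>q\<close> Vandermonde rows on \<open>L\<close> unit rows. Expanding along the unit rows deletes the columns at
  \<open>q + r - c r\<close>, whose complement consists of the exponents of the conjugate partition; passing
  to the column basis \<open>1, \<dots>, t ^ (q - 1), Q, t Q, \<dots>\<close> with \<open>Q = \<Prod>(t - z i)\<close> makes the matrix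
  block triangular, because \<open>Q\<close> vanishes at every \<open>z i\<close>.\<close>

lemma det_powers_eq_jt:
  fixes z :: "nat \<Rightarrow> 'a::idom"
  assumes "antimono c" and "\<And>r. c r \<le> q"
  shows "det (mat q q (\<lambda>(i, j). z i ^ (j + card {r. r < L \<and> q - 1 - j < c r}))) =
    jt L (esym_int q z) (\<lambda>r. int (c r)) * det (mat q q (\<lambda>(i, j). z i ^ j))"
proof -
  define M where "M = mat (q + L) (q + L)
    (\<lambda>(i, j). if i < q then z i ^ j else if j + c (i - q) = i then 1 else 0)"
  \<comment> \<open>Column \<open>j >= q\<close> lists the coefficients of t^(j - q) Q(t); those in
    degrees below j - q are 0 because \<open>esym\<close> vanishes beyond \<open>q\<close>.\<close>
  define T where "T = mat (q + L) (q + L)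
    (\<lambda>(i, j). if j < q then (if i = j then 1 else 0)
       else if i \<le> j then (-1) ^ (j - i) * esym q z (j - i) else 0)"
  define A1 where "A1 = mat q q (\<lambda>(i, j). z i ^ j)"
  define A3 where "A3 = mat L q (\<lambda>(i, j). if j + c i = q + i then 1 else 0 :: 'a)"
  define A4 where "A4 = mat L L (\<lambda>(i, j). (-1) ^ (c i + i + j) * esym_int q z (int (c i) - int i + int j))"
  have M: "M \<in> carrier_mat (q + L) (q + L)" and T: "T \<in> carrier_mat (q + L) (q + L)"
    by (auto simp: M_def T_def)
  have "det T = prod_list (diag_mat T)"
    by (rule det_upper_triangular[OF _ T]) (auto simp: upper_triangular_def T_def)
  also have "\<dots> = 1"
    unfolding prod_list_diag_prod by (rule prod.neutral) (auto simp: T_def)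
  finally have detT: "det T = 1" .
  have "M * T = four_block_mat A1 (0\<^sub>m q L) A3 A4" (is "_ = ?B")
  proof (rule eq_matI)
    fix i j assume "i < dim_row ?B" "j < dim_col ?B"
    then have ij: "i < q + L" "j < q + L" by (auto simp: A1_def A4_def)
    have MT: "(M * T) $$ (i, j) = (\<Sum>m = 0..<q + L. M $$ (i, m) * T $$ (m, j))"
      using ij M T by (simp add: scalar_prod_def)
    consider "i < q" "j < q" | "i < q" "j \<ge> q" | "i \<ge> q" by linarith
    then show "(M * T) $$ (i, j) = ?B $$ (i, j)"
    proof cases
      case 1
      have "(\<Sum>m = 0..<q + L. M $$ (i, m) * T $$ (m, j)) = (\<Sum>m = 0..<q + L. if m = j then z i ^ j else 0)"
        by (rule sum.cong[OF refl]) (use 1 ij in \<open>auto simp: M_def T_def\<close>)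
      then show ?thesis using MT 1 ij by (simp add: A1_def)
    next
      case 2
      have "(\<Sum>m = 0..<q + L. M $$ (i, m) * T $$ (m, j)) =
          (\<Sum>m\<le>j. z i ^ m * ((-1) ^ (j - m) * esym q z (j - m)))"
        by (rule sum.mono_neutral_cong_right) (use 2 ij in \<open>auto simp: M_def T_def\<close>)
      also have "\<dots> = (\<Sum>m\<le>j. (-1) ^ m * esym q z m * z i ^ (j - m))"
        by (rule sum.reindex_bij_witness[of _ "\<lambda>m. j - m" "\<lambda>m. j - m"]) (auto simp: mult_ac)
      also have "\<dots> = 0" by (rule sum_esym_eq_0) (use 2 in auto)
      finally show ?thesis using MT 2 ij by (simp add: A1_def A4_def)
    next
      case 3
      \<comment> \<open>A unit row merely selects row \<open>b\<close> of \<open>T\<close>, whose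
        entries in the columns \<open>j >= q\<close> are signed elementary symmetric functions of
        index j - b.\<close>
      define b where "b = i - c (i - q)"
      have cq: "c (i - q) \<le> q" by (rule assms(2))
      have b: "b + c (i - q) = i" using cq 3 unfolding b_def by linarith
      have bl: "b < q + L" using b ij by linarith
      have "(\<Sum>m = 0..<q + L. M $$ (i, m) * T $$ (m, j)) = (\<Sum>m = 0..<q + L. if m = b then T $$ (b, j) else 0)"
        by (rule sum.cong[OF refl]) (use 3 ij b in \<open>auto simp: M_def\<close>)
      then have *: "(M * T) $$ (i, j) = T $$ (b, j)" using MT bl by simp
      show ?thesis
      proof (cases "j < q")
        case True
        then show ?thesis using * bl ij 3 b by (auto simp: T_def A1_def A3_def A4_def)
      next
        case False
        have B: "?B $$ (i, j) = (-1) ^ (c (i - q) + (i - q) + (j - q)) *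
            esym_int q z (int (c (i - q)) - int (i - q) + int (j - q))"
          using ij 3 False by (auto simp: A1_def A4_def)
        have e: "int (c (i - q)) - int (i - q) + int (j - q) = int j - int b"
          using 3 False b by (simp add: of_nat_diff)
        show ?thesis
        proof (cases "b \<le> j")
          case True
          have "c (i - q) + (i - q) + (j - q) = (j - b) + 2 * (i - q)"
            using True False 3 b by linarith
          then have "(-1::'a) ^ (c (i - q) + (i - q) + (j - q)) = (-1) ^ (j - b)"
            by (simp only: power_add power_mult) simp
          then show ?thesis unfolding * B e using True False bl ij
            by (simp add: T_def esym_int_def nat_diff_distrib)
        next
          case nb: False
          then show ?thesis unfolding * B e using False bl ij by (simp add: T_def esym_int_def)
        qed
      qed
    qed
  qed (auto simp: M_def T_def A1_def A4_def)
  then have "det M * det T = det (four_block_mat A1 (0\<^sub>m q L) A3 A4)"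
    using det_mult[OF M T] by simp
  also have "\<dots> = det A1 * det A4"
    by (rule det_four_block_mat_upper_right_zero) (auto simp: A1_def A3_def A4_def)
  also have "det A4 = (-1) ^ (\<Sum>i<L. c i) * jt L (esym_int q z) (\<lambda>r. int (c r))"
    unfolding A4_def jt_def by (rule det_sign_scale)
  finally have 1: "det M = det A1 * ((-1) ^ (\<Sum>i<L. c i) * jt L (esym_int q z) (\<lambda>r. int (c r)))"
    using detT by simp
  have "det M = (-1) ^ (\<Sum>r<L. c r) *
      det (mat q q (\<lambda>(i, j). z i ^ (j + card {r. r < L \<and> q - 1 - j < c r})))"
    unfolding M_def by (rule det_unit_rows[OF assms])
  with 1 have "(-1) ^ (\<Sum>r<L. c r) *
      det (mat q q (\<lambda>(i, j). z i ^ (j + card {r. r < L \<and> q - 1 - j < c r}))) =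
    (-1) ^ (\<Sum>r<L. c r) * (jt L (esym_int q z) (\<lambda>r. int (c r)) * det A1)"
    by (simp add: mult_ac)
  then show ?thesis by (simp add: A1_def)
qed

text \<open>Partition exponents decrease, whereas those in \<open>det_powers_eq_jt\<close> increase
  with the column. The reversal costs a factor that is the same for all \<open>e\<close>, so it can
  be carried through an equation between two alternants.\<close>

lemma alt_reverse:
  "\<exists>s. \<forall>e. alt q (z::nat \<Rightarrow> 'a::comm_ring_1) e = s * det (mat q q (\<lambda>(i, j). z i ^ e (q - 1 - j)))"
proof -
  define p where "p = (\<lambda>i. if i < q then q - 1 - i else i)"
  have "bij_betw p {0..<q} {0..<q}"
    by (rule bij_betwI[where g = p]) (auto simp: p_def)
  then have p: "p permutes {0..<q}"
    by (rule bij_imp_permutes) (auto simp: p_def)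
  have "alt q z e = of_int (sign p) * det (mat q q (\<lambda>(i, j). z i ^ e (q - 1 - j)))" for e
  proof -
    define B where "B = mat q q (\<lambda>(i, j). z j ^ e (q - 1 - i))"
    have B: "B \<in> carrier_mat q q" by (simp add: B_def)
    have "alt q z e = det (mat q q (\<lambda>(i, j). B $$ (p i, j)))"
      unfolding alt_eq_det by (rule arg_cong[of _ _ det], rule cong_mat) (auto simp: B_def p_def)
    also have "\<dots> = of_int (sign p) * det B" by (rule det_permute_rows[OF B p])
    also have "det B = det (transpose_mat B)" by (rule det_transpose[OF B, symmetric])
    also have "transpose_mat B = mat q q (\<lambda>(i, j). z i ^ e (q - 1 - j))"
      by (rule eq_matI) (auto simp: B_def)
    finally show ?thesis .
  qed
  then show ?thesis by blast
qed

theorem dual_jacobi_trudi: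
  fixes z :: "nat \<Rightarrow> 'a::idom"
  assumes "antimono c" and "\<And>r. c r \<le> q"
    and e: "\<And>i. i < q \<Longrightarrow> e i = card {r. r < L \<and> i < c r} + (q - Suc i)"
  shows "alt q z e = jt L (esym_int q z) (\<lambda>r. int (c r)) * alt q z (\<lambda>i. q - Suc i)"
proof -
  obtain s where s: "\<And>e. alt q z e = s * det (mat q q (\<lambda>(i, j). z i ^ e (q - 1 - j)))"
    using alt_reverse by blast
  have 1: "mat q q (\<lambda>(i, j). z i ^ e (q - 1 - j)) =
      mat q q (\<lambda>(i, j). z i ^ (j + card {r. r < L \<and> q - 1 - j < c r}))"
    by (rule cong_mat) (auto simp: e add.commute)
  have 2: "mat q q (\<lambda>(i, j). z i ^ (q - Suc (q - 1 - j))) = mat q q (\<lambda>(i, j). z i ^ j)"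
    by (rule cong_mat) auto
  show ?thesis
    unfolding s[of e] s[of "\<lambda>i. q - Suc i"] 1 2 det_powers_eq_jt[OF assms(1,2)] by (simp add: mult_ac)
qed

section \<open>Partitions and Schur polynomials\<close>

lemma downset_eq_lessThan:
  fixes D :: "nat set"
  assumes "finite D" and "\<And>i j. i \<in> D \<Longrightarrow> j \<le> i \<Longrightarrow> j \<in> D"
  shows "D = {..<card D}"
proof -
  define m where "m = (LEAST m. m \<notin> D)"
  have "\<exists>m. m \<notin> D" using assms(1) by (meson ex_new_if_finite infinite_UNIV_nat)
  then have m: "m \<notin> D" unfolding m_def by (rule LeastI_ex)
  have "i \<in> D" if "i < m" for i using not_less_Least[of i "\<lambda>m. m \<notin> D"] that unfolding m_def by blast
  moreover have "i < m" if "i \<in> D" for i using assms(2)[OF that, of m] m by (cases "i < m") auto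
  ultimately have "D = {..<m}" by auto
  then show ?thesis by simp
qed

lemma partition_antimono: "is_partition \<alpha> \<Longrightarrow> i \<le> j \<Longrightarrow> \<alpha> j \<le> \<alpha> i"
  by (simp add: is_partition_def antimonoD)

text \<open>The rows longer than \<open>j\<close> form an initial segment, so comparing
  \<open>i\<close> with their number decides whether row \<open>i\<close> is one of them. This
  symmetric form yields the other facts about conjugates without further counting.\<close>

lemma less_conjugate_iff:
  assumes "is_partition \<alpha>"
  shows "i < conjugate \<alpha> j \<longleftrightarrow> j < \<alpha> i"
proof -
  have "{i. j < \<alpha> i} = {..<card {i. j < \<alpha> i}}"
  proof (rule downset_eq_lessThan)
    have "{i. j < \<alpha> i} \<subseteq> {i. \<alpha> i \<noteq> 0}" by auto
    then show "finite {i. j < \<alpha> i}" using assms finite_subset by (auto simp: is_partition_def)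
    fix i i' assume "i \<in> {i. j < \<alpha> i}" "i' \<le> i"
    then show "i' \<in> {i. j < \<alpha> i}" using partition_antimono[OF assms, of i' i] by simp
  qed
  then show ?thesis unfolding conjugate_def by (metis lessThan_iff mem_Collect_eq)
qed

lemma plength_eq_conjugate_0: "plength \<alpha> = conjugate \<alpha> 0"
  by (simp add: plength_def conjugate_def)

lemma less_plength_iff: "is_partition \<alpha> \<Longrightarrow> i < plength \<alpha> \<longleftrightarrow> 0 < \<alpha> i"
  by (simp add: plength_eq_conjugate_0 less_conjugate_iff)

lemma is_partition_conjugate:
  assumes "is_partition \<alpha>"
  shows "is_partition (conjugate \<alpha>)"
proof -
  have "antimono (conjugate \<alpha>)"
  proof (rule antimonoI)
    fix j j' :: nat assume "j \<le> j'"
    then have "\<And>i. i < conjugate \<alpha> j' \<Longrightarrow> i < conjugate \<alpha> j"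
      by (simp add: less_conjugate_iff[OF assms])
    then show "conjugate \<alpha> j' \<le> conjugate \<alpha> j" by (meson less_irrefl not_le)
  qed
  moreover have "{i. conjugate \<alpha> i \<noteq> 0} \<subseteq> {..<\<alpha> 0}"
    using less_conjugate_iff[OF assms, of 0] by auto
  ultimately show ?thesis unfolding is_partition_def using finite_subset by blast
qed

lemma conjugate_conjugate: "is_partition \<alpha> \<Longrightarrow> conjugate (conjugate \<alpha>) = \<alpha>"
proof (rule ext)
  fix i assume "is_partition \<alpha>"
  then have "\<And>j. j < conjugate (conjugate \<alpha>) i \<longleftrightarrow> j < \<alpha> i"
    by (simp add: less_conjugate_iff is_partition_conjugate)
  then show "conjugate (conjugate \<alpha>) i = \<alpha> i" by (metis less_irrefl nat_neq_iff)
qed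

lemma plength_conjugate: "is_partition \<alpha> \<Longrightarrow> plength (conjugate \<alpha>) = \<alpha> 0"
  by (simp add: plength_eq_conjugate_0 conjugate_conjugate)

lemma partition_le_0: "is_partition \<alpha> \<Longrightarrow> \<alpha> i \<le> \<alpha> 0"
  by (rule partition_antimono) simp_all

section \<open>Coefficients of alternants with strictly decreasing exponents\<close>

definition decreasing :: "nat \<Rightarrow> (nat \<Rightarrow> nat) \<Rightarrow> bool" where
  "decreasing N e \<longleftrightarrow> (\<forall>i j. i < j \<longrightarrow> j < N \<longrightarrow> e j < e i)"

text \<open>Strict decrease of both sequences forces \<open>p\<close> to be strictly increasing, and
  the identity is the only increasing permutation.\<close>

lemma decreasing_permute_eq_id:
  assumes p: "p permutes {..<N}" and e: "decreasing N e" "decreasing N e'"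
    and eq: "\<And>i. i < N \<Longrightarrow> e i = e' (p i)"
  shows "p = id"
proof -
  have pN: "p i < N \<longleftrightarrow> i < N" for i using permutes_in_image[OF p, of i] by simp
  have mono: "p i < p j" if "i < j" "j < N" for i j
  proof (rule ccontr)
    assume "\<not> p i < p j"
    then have "p i = p j \<or> p j < p i \<and> p i < N" using pN[of i] that by linarith
    then have "e' (p i) \<le> e' (p j)" using e(2) unfolding decreasing_def by (auto intro: less_imp_le)
    moreover have "e j < e i" using e(1) that unfolding decreasing_def by simp
    ultimately show False using eq[of i] eq[of j] that by simp
  qed
  have "p i = i" if "i < N" for i
    using that
  proof (induction i rule: less_induct)
    case (less i)
    obtain j where j: "p j = i" using permutes_surj[OF p] by (metis surjD)
    have "j < N" using pN[of j] j less.prems by simp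
    have "\<not> j < i" using less.IH[of j] j \<open>j < N\<close> by auto
    have "\<not> p i < i"
    proof
      assume a: "p i < i"
      then have "p (p i) = p i" using less by auto
      then have "p i = i" using permutes_inj[OF p] by (auto dest: injD)
      then show False using a by simp
    qed
    moreover have "p i \<le> i" using mono[of i j] \<open>\<not> j < i\<close> \<open>j < N\<close> j by (cases "i = j") auto
    ultimately show ?case by simp
  qed
  then show ?thesis using p by (auto simp: permutes_def fun_eq_iff)
qed

lemma mvar_power: "mvar i ^ n = Poly_Mapping.single (Poly_Mapping.single i n) 1"
  by (induction n) (simp_all add: mvar_def mult_single single_add[symmetric])

lemma prod_mvar_power:
  "finite A \<Longrightarrow> (\<Prod>i\<in>A. mvar (p i) ^ e i) = Poly_Mapping.single (\<Sum>i\<in>A. Poly_Mapping.single (p i) (e i)) 1"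
  by (induction A rule: finite_induct) (simp_all add: mvar_power mult_single)

lemma frag_cmul_eq_of_int_mult: "frag_cmul a x = of_int a * (x :: int_mpoly)"
proof -
  have nat: "frag_cmul (int n) x = of_nat n * x" for n
    by (induction n) (simp_all add: frag_cmul_distrib algebra_simps)
  show ?thesis
  proof (cases a)
    case (nonneg n)
    then show ?thesis using nat[of n] by simp
  next
    case (neg n)
    have "frag_cmul a x = - frag_cmul (int (Suc n)) x" unfolding neg by (simp only: minus_frag_cmul)
    then show ?thesis unfolding nat neg by (simp add: algebra_simps)
  qed
qed

lemma lookup_of_int_mult: "Poly_Mapping.lookup (of_int a * (x :: int_mpoly)) m = a * Poly_Mapping.lookup x m"
  by (simp flip: frag_cmul_eq_of_int_mult)

text \<open>Only the term of the identity permutation has a decreasing exponent vector. This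
  separates different alternants, and thereby gives both the nonvanishing of the Vandermonde
  alternant and the uniqueness of Schur expansions.\<close>

lemma lookup_alternant:
  assumes "decreasing N e" "decreasing N e'"
  shows "Poly_Mapping.lookup (alternant N e) (\<Sum>i<N. Poly_Mapping.single i (e' i)) =
    (if \<forall>i<N. e i = e' i then 1 else 0)"
proof -
  have "(\<Sum>i<N. Poly_Mapping.single (p i) (e i)) = (\<Sum>i<N. Poly_Mapping.single i (e' i)) \<longleftrightarrow>
      p = id \<and> (\<forall>i<N. e i = e' i)" if p: "p permutes {..<N}" for p
  proof
    assume eq: "(\<Sum>i<N. Poly_Mapping.single (p i) (e i)) = (\<Sum>i<N. Poly_Mapping.single i (e' i))"
    have "e i = e' (p i)" if i: "i < N" for i
    proof -
      have "Poly_Mapping.lookup (\<Sum>j<N. Poly_Mapping.single (p j) (e j)) (p i) =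
          (\<Sum>j<N. if j = i then e i else 0)"
        unfolding lookup_sum
        by (rule sum.cong[OF refl]) (use permutes_inj[OF p] in \<open>auto simp: lookup_single when_def dest: injD\<close>)
      moreover have "Poly_Mapping.lookup (\<Sum>j<N. Poly_Mapping.single j (e' j)) (p i) =
          (\<Sum>j<N. if j = p i then e' (p i) else 0)"
        unfolding lookup_sum by (rule sum.cong[OF refl]) (auto simp: lookup_single when_def)
      ultimately show ?thesis using i permutes_in_image[OF p, of i] unfolding eq by simp
    qed
    moreover from this have "p = id" using decreasing_permute_eq_id[OF p assms] by blast
    ultimately show "p = id \<and> (\<forall>i<N. e i = e' i)" by simp
  next
    assume "p = id \<and> (\<forall>i<N. e i = e' i)"
    then show "(\<Sum>i<N. Poly_Mapping.single (p i) (e i)) = (\<Sum>i<N. Poly_Mapping.single i (e' i))"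
      by (intro sum.cong) simp_all
  qed
  note eq_iff = this
  have "Poly_Mapping.lookup (of_int (sign p) * (\<Prod>i<N. mvar (p i) ^ e i)) (\<Sum>i<N. Poly_Mapping.single i (e' i)) =
      (if p = id then if \<forall>i<N. e i = e' i then 1 else 0 else 0)" if p: "p permutes {..<N}" for p
    unfolding lookup_of_int_mult prod_mvar_power[OF finite_lessThan] lookup_single eq_iff[OF p] when_def
    by (cases "p = id") (simp_all add: sign_id)
  then have "Poly_Mapping.lookup (alternant N e) (\<Sum>i<N. Poly_Mapping.single i (e' i)) =
    (\<Sum>p | p permutes {..<N}. if p = id then if \<forall>i<N. e i = e' i then 1 else 0 else 0)"
    unfolding alternant_def lookup_sum by (intro sum.cong) auto
  also have "\<dots> = (if \<forall>i<N. e i = e' i then 1 else 0)"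
    by (subst sum.delta) (auto simp: finite_permutations permutes_id)
  finally show ?thesis .
qed

lemma decreasing_partition: "is_partition \<alpha> \<Longrightarrow> decreasing N (\<lambda>i. \<alpha> i + (N - Suc i))"
  unfolding decreasing_def
proof (intro allI impI)
  fix i j assume "is_partition \<alpha>" "i < j" "j < N"
  moreover from this have "\<alpha> j \<le> \<alpha> i" by (simp add: partition_antimono)
  ultimately show "\<alpha> j + (N - Suc j) < \<alpha> i + (N - Suc i)" by linarith
qed

lemma alternant_delta_nonzero: "alternant N (\<lambda>i. N - Suc i) \<noteq> 0"
proof
  assume "alternant N (\<lambda>i. N - Suc i) = 0"
  moreover have "decreasing N (\<lambda>i. N - Suc i)" by (auto simp: decreasing_def)
  ultimately show False using lookup_alternant[of N "\<lambda>i. N - Suc i" "\<lambda>i. N - Suc i"] by simp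
qed

section \<open>Schur polynomials as determinants of elementary symmetric polynomials\<close>

lemma dual_jacobi_trudi_partition:
  fixes z :: "nat \<Rightarrow> 'a::idom"
  assumes "is_partition \<alpha>" "plength \<alpha> \<le> q" "\<alpha> 0 \<le> L"
  shows "jt L (esym_int q z) (\<lambda>r. int (conjugate \<alpha> r)) * alt q z (\<lambda>i. q - Suc i) =
    alt q z (\<lambda>i. \<alpha> i + (q - Suc i))"
proof (rule dual_jacobi_trudi[symmetric])
  show "antimono (conjugate \<alpha>)" using is_partition_conjugate[OF assms(1)] by (simp add: is_partition_def)
  show "conjugate \<alpha> r \<le> q" for r
    using partition_le_0[OF is_partition_conjugate[OF assms(1)], of r] assms(2)
    by (simp add: plength_eq_conjugate_0)
  fix i
  have "{r. r < L \<and> i < conjugate \<alpha> r} = {..<\<alpha> i}"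
    using partition_le_0[OF assms(1), of i] assms(3) by (auto simp: less_conjugate_iff[OF assms(1)])
  then show "\<alpha> i + (q - Suc i) = card {r. r < L \<and> i < conjugate \<alpha> r} + (q - Suc i)" by simp
qed

lemma schur_eqI:
  assumes "plength \<alpha> \<le> N"
    and "s * alternant N (\<lambda>i. N - Suc i) = alternant N (\<lambda>i. \<alpha> i + (N - Suc i))"
  shows "schur N \<alpha> = s"
proof -
  have "(THE s. s * alternant N (\<lambda>i. N - Suc i) = alternant N (\<lambda>i. \<alpha> i + (N - Suc i))) = s"
  proof (rule the_equality)
    fix t assume "t * alternant N (\<lambda>i. N - Suc i) = alternant N (\<lambda>i. \<alpha> i + (N - Suc i))"
    then have "t * alternant N (\<lambda>i. N - Suc i) = s * alternant N (\<lambda>i. N - Suc i)"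
      using assms(2) by simp
    then show "t = s" using alternant_delta_nonzero by simp
  qed (rule assms(2))
  then show ?thesis using assms(1) by (simp add: schur_def)
qed

lemma jt_zero_row:
  assumes "i < L" "\<And>j. j < L \<Longrightarrow> g (c i - int i + int j) = 0"
  shows "jt L g c = 0"
proof -
  have "jt L g c = (\<Sum>j<L. mat L L (\<lambda>(i, j). g (c i - int i + int j)) $$ (i, j) *
      cofactor (mat L L (\<lambda>(i, j). g (c i - int i + int j))) i j)"
    unfolding jt_def by (rule laplace_expansion_row) (use assms in auto)
  also have "\<dots> = 0" by (rule sum.neutral) (use assms in auto)
  finally show ?thesis .
qed

text \<open>The formula is uniform in \<open>N\<close>, as the definition of \<open>LR\<close>
  demands: with too few variables the first row consists of elementary symmetric polynomials of
  index above \<open>N\<close>, so both sides are 0. The freedom in \<open>L\<close> allows order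
  \<open>k\<close> for every partition with at most \<open>k\<close> columns.\<close>

lemma schur_eq_jt:
  assumes "is_partition \<alpha>" "\<alpha> 0 \<le> L"
  shows "schur N \<alpha> = jt L (esym_int N mvar) (\<lambda>r. int (conjugate \<alpha> r))"
proof (cases "plength \<alpha> \<le> N")
  case True
  then show ?thesis
    using dual_jacobi_trudi_partition[OF assms(1) True assms(2), of mvar]
    by (intro schur_eqI) (simp_all add: alternant_eq_alt)
next
  case False
  then have "0 < \<alpha> 0" using less_plength_iff[OF assms(1), of 0] by auto
  have "jt L (esym_int N mvar) (\<lambda>r. int (conjugate \<alpha> r)) = 0"
    by (rule jt_zero_row[of 0])
      (use \<open>0 < \<alpha> 0\<close> assms False in \<open>auto simp: esym_int_def esym_eq_0 plength_eq_conjugate_0 nat_add_distrib\<close>)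
  then show ?thesis using False by (simp add: schur_def)
qed

lemma schur_mult_alternant:
  assumes "is_partition \<alpha>"
  shows "schur N \<alpha> * alternant N (\<lambda>i. N - Suc i) =
    (if plength \<alpha> \<le> N then alternant N (\<lambda>i. \<alpha> i + (N - Suc i)) else 0)"
  using dual_jacobi_trudi_partition[OF assms _ order_refl, of N mvar]
  by (auto simp: schur_eq_jt[OF assms order_refl, symmetric] alternant_eq_alt)
    (simp add: schur_def)

subsection \<open>Pieri's rule\<close>

text \<open>Since \<open>esym q z m\<close> is symmetric, it may be written in the variables
  \<open>z (p i)\<close> inside the term of \<open>p\<close>; its summand for \<open>S\<close> then
  raises exactly the exponents at positions in \<open>S\<close>.\<close>

lemma esym_mult_alt:
  fixes z :: "nat \<Rightarrow> 'a::comm_ring_1"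
  shows "esym q z m * alt q z e = (\<Sum>S | S \<subseteq> {..<q} \<and> card S = m. alt q z (\<lambda>i. e i + of_bool (i \<in> S)))"
proof -
  let ?SS = "{S. S \<subseteq> {..<q} \<and> card S = m}"
  have "esym q z m * (\<Prod>i<q. z (p i) ^ e i) = (\<Sum>S\<in>?SS. \<Prod>i<q. z (p i) ^ (e i + of_bool (i \<in> S)))"
    if p: "p permutes {..<q}" for p
  proof -
    have inj: "inj p" by (rule permutes_inj[OF p])
    have "esym q z m = (\<Sum>S\<in>?SS. \<Prod>i\<in>S. z (p i))"
      unfolding esym_def
    proof (rule sum.reindex_bij_witness[of _ "\<lambda>S. p ` S" "\<lambda>S. Hilbert_Choice.inv p ` S"])
      fix S assume S: "S \<in> ?SS"
      show "Hilbert_Choice.inv p ` p ` S = S" using inj by (simp add: image_inv_f_f)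
      show "p ` Hilbert_Choice.inv p ` S = S" using permutes_surj[OF p] by (simp add: image_f_inv_f)
      show "p ` S \<in> ?SS" using S permutes_in_image[OF p] inj
        by (auto simp: card_image inj_on_subset)
      have ip: "Hilbert_Choice.inv p permutes {..<q}" by (rule permutes_inv[OF p])
      show "Hilbert_Choice.inv p ` S \<in> ?SS" using S permutes_in_image[OF ip] permutes_inj[OF ip]
        by (auto simp: card_image inj_on_subset)
      show "(\<Prod>i\<in>Hilbert_Choice.inv p ` S. z (p i)) = (\<Prod>i\<in>S. z i)"
        by (subst prod.reindex)
          (use inj_on_subset[OF permutes_inj[OF ip] subset_UNIV] permutes_inverses(1)[OF p] in auto)
    qed
    then have "esym q z m * (\<Prod>i<q. z (p i) ^ e i) =
        (\<Sum>S\<in>?SS. (\<Prod>i\<in>S. z (p i)) * (\<Prod>i<q. z (p i) ^ e i))"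
      by (simp add: sum_distrib_right)
    also have "\<dots> = (\<Sum>S\<in>?SS. \<Prod>i<q. z (p i) ^ (e i + of_bool (i \<in> S)))"
    proof (rule sum.cong[OF refl])
      fix S assume "S \<in> ?SS"
      then have "(\<Prod>i\<in>S. z (p i)) = (\<Prod>i<q. z (p i) ^ of_bool (i \<in> S))"
        by (intro prod.mono_neutral_cong_left) auto
      then show "(\<Prod>i\<in>S. z (p i)) * (\<Prod>i<q. z (p i) ^ e i) = (\<Prod>i<q. z (p i) ^ (e i + of_bool (i \<in> S)))"
        by (simp add: prod.distrib[symmetric] power_add mult.commute)
    qed
    finally show ?thesis .
  qed
  then have "esym q z m * alt q z e = (\<Sum>p | p permutes {..<q}. \<Sum>S\<in>?SS.
      of_int (sign p) * (\<Prod>i<q. z (p i) ^ (e i + of_bool (i \<in> S))))"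
    unfolding alt_def sum_distrib_left
    by (intro sum.cong refl) (simp add: mult.left_commute sum_distrib_left[symmetric])
  also have "\<dots> = (\<Sum>S\<in>?SS. alt q z (\<lambda>i. e i + of_bool (i \<in> S)))"
    unfolding alt_def by (rule sum.swap)
  finally show ?thesis .
qed

lemma alt_eq_0:
  assumes "i < q" "j < q" "i \<noteq> j" "e i = e j"
  shows "alt q z e = 0"
  unfolding alt_eq_det
  by (rule det_identical_rows[of _ q i j]) (use assms in \<open>auto intro!: eq_vecI\<close>)

text \<open>If the result is again a partition, the added boxes form a vertical strip, one box in
  each row of \<open>S\<close>.\<close>

definition strip :: "(nat \<Rightarrow> nat) \<Rightarrow> nat set \<Rightarrow> nat \<Rightarrow> nat" where
  "strip \<rho> S i = \<rho> i + of_bool (i \<in> S)"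

lemma is_partition_stripI:
  assumes "is_partition \<rho>" "finite S" "\<And>i. Suc i \<in> S \<Longrightarrow> i \<notin> S \<Longrightarrow> \<rho> i \<noteq> \<rho> (Suc i)"
  shows "is_partition (strip \<rho> S)"
proof -
  have "antimono (strip \<rho> S)"
  proof (rule decseq_SucI)
    fix i
    have "\<rho> (Suc i) \<le> \<rho> i" by (rule partition_antimono[OF assms(1)]) simp
    then show "strip \<rho> S (Suc i) \<le> strip \<rho> S i"
      using assms(3)[of i] by (cases "i \<in> S"; cases "Suc i \<in> S") (auto simp: strip_def)
  qed
  moreover have "{i. strip \<rho> S i \<noteq> 0} \<subseteq> {i. \<rho> i \<noteq> 0} \<union> S" by (auto simp: strip_def)
  ultimately show ?thesis
    using assms(1,2) unfolding is_partition_def by (meson finite_UnI finite_subset)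
qed

text \<open>By \<open>strip_bound\<close> the bound \<open>plength \<rho> + m\<close> excludes no
  vertical strip; it makes the family finite without reference to the number of variables.\<close>

definition strips :: "(nat \<Rightarrow> nat) \<Rightarrow> nat \<Rightarrow> nat set set" where
  "strips \<rho> m = {S. S \<subseteq> {..<plength \<rho> + m} \<and> card S = m \<and> is_partition (strip \<rho> S)}"

lemma finite_strips: "finite (strips \<rho> m)"
  unfolding strips_def by (rule finite_subset[of _ "Pow {..<plength \<rho> + m}"]) auto

text \<open>A box added to an empty row forces boxes in all the empty rows above it, and there are
  only \<open>card S\<close> boxes to add.\<close>

lemma strip_bound:
  assumes "is_partition \<rho>" "is_partition (strip \<rho> S)" "finite S"
  shows "S \<subseteq> {..<plength \<rho> + card S}"
proof
  fix s assume s: "s \<in> S"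
  show "s \<in> {..<plength \<rho> + card S}"
  proof (cases "s < plength \<rho>")
    case False
    have "{plength \<rho>..s} \<subseteq> S"
    proof
      fix t assume t: "t \<in> {plength \<rho>..s}"
      then have "\<rho> t = 0" using less_plength_iff[OF assms(1), of t] by auto
      moreover have "strip \<rho> S s \<le> strip \<rho> S t"
        by (rule partition_antimono[OF assms(2)]) (use t in simp)
      ultimately show "t \<in> S" using s by (cases "t \<in> S") (auto simp: strip_def)
    qed
    then have "card {plength \<rho>..s} \<le> card S" by (rule card_mono[OF assms(3)])
    then show ?thesis using False by auto
  qed auto
qed

text \<open>In the expansion by \<open>esym_mult_alt\<close>, a set that does not yield a partition
  produces two equal exponents, hence 0. The same index set serves every \<open>N\<close>, because
  strips that make the partition too long carry a zero Schur polynomial.\<close>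

theorem schur_pieri:
  assumes "is_partition \<rho>"
  shows "esym N mvar m * schur N \<rho> = (\<Sum>S\<in>strips \<rho> m. schur N (strip \<rho> S))"
proof (cases "plength \<rho> \<le> N")
  case False
  have "schur N (strip \<rho> S) = 0" if "S \<in> strips \<rho> m" for S
  proof -
    have "is_partition (strip \<rho> S)" using that by (simp add: strips_def)
    moreover have "0 < strip \<rho> S N" using False less_plength_iff[OF assms, of N] by (simp add: strip_def)
    ultimately have "N < plength (strip \<rho> S)" by (simp add: less_plength_iff)
    then show ?thesis by (simp add: schur_def)
  qed
  then show ?thesis using False by (simp add: schur_def)
next
  case True
  let ?d = "alternant N (\<lambda>i. N - Suc i)"
  let ?P = "{S. S \<subseteq> {..<N} \<and> card S = m \<and> is_partition (strip \<rho> S)}"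
  have "esym N mvar m * schur N \<rho> * ?d = esym N mvar m * alternant N (\<lambda>i. \<rho> i + (N - Suc i))"
    using True by (simp add: mult.assoc schur_mult_alternant[OF assms])
  also have "\<dots> = (\<Sum>S | S \<subseteq> {..<N} \<and> card S = m. alternant N (\<lambda>i. strip \<rho> S i + (N - Suc i)))"
    unfolding alternant_eq_alt esym_mult_alt strip_def by (simp add: add_ac)
  also have "\<dots> = (\<Sum>S\<in>?P. alternant N (\<lambda>i. strip \<rho> S i + (N - Suc i)))"
  proof (rule sum.mono_neutral_right)
    show "\<forall>S\<in>{S. S \<subseteq> {..<N} \<and> card S = m} - ?P. alternant N (\<lambda>i. strip \<rho> S i + (N - Suc i)) = 0"
    proof
      fix S assume "S \<in> {S. S \<subseteq> {..<N} \<and> card S = m} - ?P"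
      then have S: "S \<subseteq> {..<N}" "\<not> is_partition (strip \<rho> S)" by auto
      \<comment> \<open>Two equal rows of which only the lower one gets a box: the staircase adds
        one more to the upper exponent, so the two exponents coincide.\<close>
      then obtain i where i: "Suc i \<in> S" "i \<notin> S" "\<rho> i = \<rho> (Suc i)"
        using is_partition_stripI[OF assms, of S] finite_subset[OF S(1)] by auto
      then have "Suc i < N" using S by auto
      then show "alternant N (\<lambda>i. strip \<rho> S i + (N - Suc i)) = 0"
        unfolding alternant_eq_alt
        by (intro alt_eq_0[of i _ "Suc i"]) (use i in \<open>auto simp: strip_def\<close>)
    qed
  qed auto
  also have "\<dots> = (\<Sum>S\<in>?P. schur N (strip \<rho> S) * ?d)"
  proof (rule sum.cong[OF refl])
    fix S assume "S \<in> ?P"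
    then have S: "S \<subseteq> {..<N}" "is_partition (strip \<rho> S)" by auto
    have "\<not> N < plength (strip \<rho> S)"
      using less_plength_iff[OF S(2), of N] less_plength_iff[OF assms, of N] True S(1)
      by (auto simp: strip_def)
    then show "alternant N (\<lambda>i. strip \<rho> S i + (N - Suc i)) = schur N (strip \<rho> S) * ?d"
      by (simp add: schur_mult_alternant[OF S(2)])
  qed
  also have "\<dots> = (\<Sum>S\<in>strips \<rho> m. schur N (strip \<rho> S) * ?d)"
  proof (rule sum.mono_neutral_left)
    show "?P \<subseteq> strips \<rho> m"
      using strip_bound[OF assms] finite_subset unfolding strips_def by blast
    show "\<forall>S\<in>strips \<rho> m - ?P. schur N (strip \<rho> S) * ?d = 0"
    proof
      fix S assume S: "S \<in> strips \<rho> m - ?P"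
      then have p: "is_partition (strip \<rho> S)" by (auto simp: strips_def)
      from S have "\<not> S \<subseteq> {..<N}" by (auto simp: strips_def)
      then obtain s where s: "s \<in> S" "s \<ge> N" by (meson lessThan_iff not_le subsetI)
      then have "s < plength (strip \<rho> S)" by (simp add: less_plength_iff[OF p] strip_def)
      then show "schur N (strip \<rho> S) * ?d = 0" using s by (simp add: schur_def)
    qed
  qed (rule finite_strips)
  finally have "esym N mvar m * schur N \<rho> * ?d = (\<Sum>S\<in>strips \<rho> m. schur N (strip \<rho> S)) * ?d"
    by (simp add: sum_distrib_right)
  then show ?thesis using alternant_delta_nonzero by simp
qed

section \<open>Littlewood--Richardson coefficients\<close>

text \<open>One coefficient family has to serve all numbers of variables, so this is expandability
  as a symmetric function.\<close>

definition schur_expandable :: "(nat \<Rightarrow> int_mpoly) \<Rightarrow> bool" where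
  "schur_expandable f \<longleftrightarrow>
     (\<exists>c. Poly_Mapping.keys c \<subseteq> Collect is_partition \<and> (\<forall>N. f N = frag_extend (schur N) c))"

lemma schur_expandable_0: "schur_expandable (\<lambda>_. 0)"
  unfolding schur_expandable_def by (rule exI[of _ 0]) simp

lemma schur_expandable_schur: "is_partition \<rho> \<Longrightarrow> schur_expandable (\<lambda>N. schur N \<rho>)"
  unfolding schur_expandable_def by (rule exI[of _ "frag_of \<rho>"]) simp

lemma schur_expandable_add:
  assumes "schur_expandable f" "schur_expandable g"
  shows "schur_expandable (\<lambda>N. f N + g N)"
proof -
  obtain c d where "Poly_Mapping.keys c \<subseteq> Collect is_partition" "\<And>N. f N = frag_extend (schur N) c"
    "Poly_Mapping.keys d \<subseteq> Collect is_partition" "\<And>N. g N = frag_extend (schur N) d"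
    using assms unfolding schur_expandable_def by auto
  then show ?thesis unfolding schur_expandable_def
    by (intro exI[of _ "c + d"]) (use keys_add[of c d] in \<open>auto simp: frag_extend_add\<close>)
qed

lemma schur_expandable_of_int:
  assumes "schur_expandable f"
  shows "schur_expandable (\<lambda>N. of_int a * f N)"
proof -
  obtain c where "Poly_Mapping.keys c \<subseteq> Collect is_partition" "\<And>N. f N = frag_extend (schur N) c"
    using assms unfolding schur_expandable_def by auto
  then show ?thesis unfolding schur_expandable_def
    by (intro exI[of _ "frag_cmul a c"])
      (use keys_cmul[of a c] in \<open>auto simp: frag_extend_cmul frag_cmul_eq_of_int_mult\<close>)
qed

lemma schur_expandable_sum:
  assumes "\<And>i. i \<in> I \<Longrightarrow> schur_expandable (f i)"
  shows "schur_expandable (\<lambda>N. \<Sum>i\<in>I. f i N)"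
  using assms
  by (induction I rule: infinite_finite_induct) (auto intro: schur_expandable_0 schur_expandable_add)

lemma schur_expandable_esym:
  assumes "schur_expandable f"
  shows "schur_expandable (\<lambda>N. esym_int N mvar m * f N)"
proof (cases "m < 0")
  case True
  then show ?thesis by (simp add: esym_int_def schur_expandable_0)
next
  case False
  obtain c where c: "Poly_Mapping.keys c \<subseteq> Collect is_partition" "\<And>N. f N = frag_extend (schur N) c"
    using assms unfolding schur_expandable_def by auto
  have "esym_int N mvar m * f N = (\<Sum>\<rho>\<in>Poly_Mapping.keys c.
      of_int (Poly_Mapping.lookup c \<rho>) * (\<Sum>S\<in>strips \<rho> (nat m). schur N (strip \<rho> S)))" for N
  proof -
    have "esym_int N mvar m * f N = (\<Sum>\<rho>\<in>Poly_Mapping.keys c. esym_int N mvar m *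
        frag_cmul (Poly_Mapping.lookup c \<rho>) (schur N \<rho>))"
      unfolding c(2) frag_extend_def by (rule sum_distrib_left)
    also have "\<dots> = (\<Sum>\<rho>\<in>Poly_Mapping.keys c.
      of_int (Poly_Mapping.lookup c \<rho>) * (\<Sum>S\<in>strips \<rho> (nat m). schur N (strip \<rho> S)))"
    proof (rule sum.cong[OF refl])
      fix \<rho> assume "\<rho> \<in> Poly_Mapping.keys c"
      then have "is_partition \<rho>" using c(1) by auto
      then show "esym_int N mvar m * frag_cmul (Poly_Mapping.lookup c \<rho>) (schur N \<rho>) =
          of_int (Poly_Mapping.lookup c \<rho>) * (\<Sum>S\<in>strips \<rho> (nat m). schur N (strip \<rho> S))"
        using False
        by (simp only: schur_pieri[symmetric] frag_cmul_eq_of_int_mult esym_int_def if_False mult.left_commute)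
    qed
    finally show ?thesis .
  qed
  moreover have "schur_expandable (\<lambda>N. \<Sum>\<rho>\<in>Poly_Mapping.keys c.
      of_int (Poly_Mapping.lookup c \<rho>) * (\<Sum>S\<in>strips \<rho> (nat m). schur N (strip \<rho> S)))"
    by (intro schur_expandable_sum schur_expandable_of_int schur_expandable_schur) (auto simp: strips_def)
  ultimately show ?thesis by simp
qed

lemma schur_expandable_prod_esym:
  assumes "schur_expandable f"
  shows "schur_expandable (\<lambda>N. (\<Prod>i\<in>I. esym_int N mvar (d i)) * f N)"
proof (induction I rule: infinite_finite_induct)
  case (insert i I)
  then show ?case using schur_expandable_esym[OF insert.IH, of "d i"] by (simp add: mult.assoc)
qed (use assms in auto)

lemma jt_eq_sum:
  "jt L g c = (\<Sum>p | p permutes {0..<L}. of_int (sign p) * (\<Prod>i = 0..<L. g (c i - int i + int (p i))))"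
proof -
  have "jt L g c = (\<Sum>p | p permutes {0..<L}. of_int (sign p) *
      (\<Prod>i = 0..<L. mat L L (\<lambda>(i, j). g (c i - int i + int j)) $$ (i, p i)))"
    unfolding jt_def by (rule det_def') simp
  also have "\<dots> = (\<Sum>p | p permutes {0..<L}. of_int (sign p) * (\<Prod>i = 0..<L. g (c i - int i + int (p i))))"
  proof (rule sum.cong[OF refl])
    fix p assume "p \<in> {p. p permutes {0..<L}}"
    then have "p i < L" if "i < L" for i using permutes_in_image[of p "{0..<L}" i] that by simp
    then have "(\<Prod>i = 0..<L. mat L L (\<lambda>(i, j). g (c i - int i + int j)) $$ (i, p i)) =
        (\<Prod>i = 0..<L. g (c i - int i + int (p i)))"
      by (intro prod.cong) auto
    then show "of_int (sign p) * (\<Prod>i = 0..<L. mat L L (\<lambda>(i, j). g (c i - int i + int j)) $$ (i, p i)) =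
      of_int (sign p) * (\<Prod>i = 0..<L. g (c i - int i + int (p i)))" by simp
  qed
  finally show ?thesis .
qed

text \<open>The determinant for the first factor is a signed sum of products of elementary symmetric
  polynomials, and by Pieri's rule multiplication by each of these preserves expandability.\<close>

lemma schur_expandable_mult:
  assumes "is_partition \<alpha>" "is_partition \<beta>"
  shows "schur_expandable (\<lambda>N. schur N \<alpha> * schur N \<beta>)"
proof -
  have "schur N \<alpha> * schur N \<beta> = (\<Sum>p | p permutes {0..<\<alpha> 0}. of_int (sign p) *
      ((\<Prod>i = 0..<\<alpha> 0. esym_int N mvar (int (conjugate \<alpha> i) - int i + int (p i))) * schur N \<beta>))" for N
    unfolding schur_eq_jt[OF assms(1) order_refl] jt_eq_sum sum_distrib_right by (simp only: mult.assoc)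
  moreover have "schur_expandable (\<lambda>N. \<Sum>p | p permutes {0..<\<alpha> 0}. of_int (sign p) *
      ((\<Prod>i = 0..<\<alpha> 0. esym_int N mvar (int (conjugate \<alpha> i) - int i + int (p i))) * schur N \<beta>))"
    by (intro schur_expandable_sum schur_expandable_of_int schur_expandable_prod_esym
        schur_expandable_schur assms)
  ultimately show ?thesis by simp
qed

text \<open>With \<open>N\<close> at least every length that occurs, multiplication by the
  Vandermonde alternant turns the relation into one between alternants, and each coefficient is read
  off at the monomial of its decreasing exponents.\<close>

lemma schur_linearly_independent:
  assumes "Poly_Mapping.keys d \<subseteq> Collect is_partition" and "\<And>N. frag_extend (schur N) d = 0"
  shows "d = 0"
proof (rule poly_mapping_eqI)
  fix \<rho>
  show "Poly_Mapping.lookup d \<rho> = Poly_Mapping.lookup 0 \<rho>"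
  proof (cases "\<rho> \<in> Poly_Mapping.keys d")
    case True
    define N where "N = (\<Sum>\<kappa>\<in>Poly_Mapping.keys d. plength \<kappa>)"
    have N: "plength \<kappa> \<le> N" if "\<kappa> \<in> Poly_Mapping.keys d" for \<kappa>
      unfolding N_def by (rule member_le_sum) (use that in auto)
    have part: "is_partition \<kappa>" if "\<kappa> \<in> Poly_Mapping.keys d" for \<kappa> using assms(1) that by auto
    let ?m = "\<Sum>i<N. Poly_Mapping.single i (\<rho> i + (N - Suc i))"
    have "0 = frag_extend (schur N) d * alternant N (\<lambda>i. N - Suc i)"
      using assms(2) by simp
    also have "\<dots> = (\<Sum>\<kappa>\<in>Poly_Mapping.keys d. of_int (Poly_Mapping.lookup d \<kappa>) *
        alternant N (\<lambda>i. \<kappa> i + (N - Suc i)))"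
      unfolding frag_extend_def sum_distrib_right
      by (rule sum.cong[OF refl])
        (simp add: frag_cmul_eq_of_int_mult mult.assoc schur_mult_alternant part N)
    finally have eq: "0 = (\<Sum>\<kappa>\<in>Poly_Mapping.keys d. of_int (Poly_Mapping.lookup d \<kappa>) *
        alternant N (\<lambda>i. \<kappa> i + (N - Suc i)))" .
    have "0 = (\<Sum>\<kappa>\<in>Poly_Mapping.keys d. Poly_Mapping.lookup d \<kappa> *
        Poly_Mapping.lookup (alternant N (\<lambda>i. \<kappa> i + (N - Suc i))) ?m)"
      using arg_cong[OF eq, of "\<lambda>p. Poly_Mapping.lookup p ?m"]
      by (simp only: lookup_zero lookup_sum lookup_of_int_mult)
    also have "\<dots> = (\<Sum>\<kappa>\<in>Poly_Mapping.keys d. if \<kappa> = \<rho> then Poly_Mapping.lookup d \<rho> else 0)"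
    proof (rule sum.cong[OF refl])
      fix \<kappa> assume k: "\<kappa> \<in> Poly_Mapping.keys d"
      have "\<kappa> = \<rho>" if "\<forall>i<N. \<kappa> i = \<rho> i"
      proof
        fix i show "\<kappa> i = \<rho> i"
          using that less_plength_iff[OF part[OF k], of i] less_plength_iff[OF part[OF True], of i]
            N[OF k] N[OF True] by (cases "i < N") auto
      qed
      then have "(\<forall>i<N. \<kappa> i + (N - Suc i) = \<rho> i + (N - Suc i)) \<longleftrightarrow> \<kappa> = \<rho>"
        by (metis add_right_cancel)
      then show "Poly_Mapping.lookup d \<kappa> * Poly_Mapping.lookup (alternant N (\<lambda>i. \<kappa> i + (N - Suc i))) ?m =
          (if \<kappa> = \<rho> then Poly_Mapping.lookup d \<rho> else 0)"
        by (subst lookup_alternant[OF decreasing_partition[OF part[OF k]] decreasing_partition[OF part[OF True]]]) simp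
    qed
    also have "\<dots> = Poly_Mapping.lookup d \<rho>" using True by simp
    finally show ?thesis by simp
  qed (simp add: in_keys_iff)
qed

theorem LR_spec:
  assumes "is_partition \<alpha>" "is_partition \<beta>"
  shows "Poly_Mapping.keys (LR \<alpha> \<beta>) \<subseteq> Collect is_partition"
    and "schur N \<alpha> * schur N \<beta> = frag_extend (schur N) (LR \<alpha> \<beta>)"
proof -
  let ?P = "\<lambda>c. Poly_Mapping.keys c \<subseteq> Collect is_partition \<and>
    (\<forall>N. schur N \<alpha> * schur N \<beta> = frag_extend (schur N) c)"
  obtain c where c: "?P c"
    using schur_expandable_mult[OF assms] unfolding schur_expandable_def by auto
  have "?P (LR \<alpha> \<beta>)"
    unfolding LR_def
  proof (rule theI[of ?P, OF c])
    fix c' assume c': "?P c'"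
    have "c' - c = 0"
    proof (rule schur_linearly_independent)
      show "Poly_Mapping.keys (c' - c) \<subseteq> Collect is_partition"
        using c c' keys_diff[of c' c] by blast
      show "frag_extend (schur N) (c' - c) = 0" for N
        using c c' by (metis diff_self frag_extend_diff)
    qed
    then show "c' = c" by simp
  qed
  then show "Poly_Mapping.keys (LR \<alpha> \<beta>) \<subseteq> Collect is_partition"
    "schur N \<alpha> * schur N \<beta> = frag_extend (schur N) (LR \<alpha> \<beta>)" by auto
qed

subsection \<open>Evaluation at complex numbers\<close>

text \<open>Polynomials, combinations of partitions and combinations of symbols are all finitely
  supported integer families, so one functional serves for evaluating polynomials and for extending
  the determinant \<open>F\<close>.\<close>

definition lin :: "('b \<Rightarrow> complex) \<Rightarrow> ('b \<Rightarrow>\<^sub>0 int) \<Rightarrow> complex" where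
  "lin F X = (\<Sum>a\<in>Poly_Mapping.keys X. of_int (Poly_Mapping.lookup X a) * F a)"

lemma lin_eq_sum:
  assumes "finite A" "Poly_Mapping.keys X \<subseteq> A"
  shows "lin F X = (\<Sum>a\<in>A. of_int (Poly_Mapping.lookup X a) * F a)"
  unfolding lin_def by (rule sum.mono_neutral_left) (use assms in \<open>auto simp: in_keys_iff\<close>)

lemma lin_0 [simp]: "lin F 0 = 0"
  by (simp add: lin_def)

lemma lin_frag_of [simp]: "lin F (frag_of a) = F a"
  by (simp add: lin_def)

lemma lin_add: "lin F (X + Y) = lin F X + lin F Y"
proof -
  let ?A = "Poly_Mapping.keys X \<union> Poly_Mapping.keys Y"
  have "lin F X = (\<Sum>a\<in>?A. of_int (Poly_Mapping.lookup X a) * F a)"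
    "lin F Y = (\<Sum>a\<in>?A. of_int (Poly_Mapping.lookup Y a) * F a)"
    "lin F (X + Y) = (\<Sum>a\<in>?A. of_int (Poly_Mapping.lookup (X + Y) a) * F a)"
    using keys_add[of X Y] by (auto intro!: lin_eq_sum)
  then show ?thesis by (simp add: lookup_add algebra_simps sum.distrib)
qed

lemma lin_cmul: "lin F (frag_cmul c X) = of_int c * lin F X"
proof -
  have "lin F (frag_cmul c X) = (\<Sum>a\<in>Poly_Mapping.keys X. of_int (Poly_Mapping.lookup (frag_cmul c X) a) * F a)"
    by (rule lin_eq_sum) (auto simp: keys_cmul)
  then show ?thesis by (simp add: lin_def sum_distrib_left mult.assoc)
qed

lemma lin_minus: "lin F (- X) = - lin F X"
  using lin_cmul[of F "-1" X] by simp

lemma lin_diff: "lin F (X - Y) = lin F X - lin F Y"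
  using lin_add[of F X "- Y"] by (simp add: lin_minus)

lemma lin_sum: "lin F (\<Sum>i\<in>I. X i) = (\<Sum>i\<in>I. lin F (X i))"
  by (induction I rule: infinite_finite_induct) (simp_all add: lin_add)

lemma lin_frag_extend: "lin F (frag_extend h c) = lin (\<lambda>\<rho>. lin F (h \<rho>)) c"
  unfolding frag_extend_def lin_sum lin_cmul by (simp add: lin_def)

definition monomial_value :: "(nat \<Rightarrow> complex) \<Rightarrow> (nat \<Rightarrow>\<^sub>0 nat) \<Rightarrow> complex" where
  "monomial_value z m = (\<Prod>i\<in>Poly_Mapping.keys m. z i ^ Poly_Mapping.lookup m i)"

lemma monomial_value_add: "monomial_value z (a + b) = monomial_value z a * monomial_value z b"
proof -
  let ?A = "Poly_Mapping.keys a \<union> Poly_Mapping.keys b"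
  have *: "monomial_value z m = (\<Prod>i\<in>?A. z i ^ Poly_Mapping.lookup m i)" if "Poly_Mapping.keys m \<subseteq> ?A" for m
    unfolding monomial_value_def by (rule prod.mono_neutral_left) (use that in \<open>auto simp: in_keys_iff\<close>)
  show ?thesis
    unfolding *[OF keys_add] *[OF Un_upper1] *[OF Un_upper2]
    by (simp add: lookup_add power_add prod.distrib)
qed

abbreviation mpoly_value :: "(nat \<Rightarrow> complex) \<Rightarrow> int_mpoly \<Rightarrow> complex" where
  "mpoly_value z \<equiv> lin (monomial_value z)"

lemma mpoly_value_frag_of_mult: "mpoly_value z (frag_of a * q) = monomial_value z a * mpoly_value z q"
proof -
  have "Poly_Mapping.keys q \<subseteq> UNIV" by simp
  then show ?thesis
    by (induction q rule: frag_induction)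
      (simp_all add: mult_single monomial_value_add lin_diff algebra_simps)
qed

lemma mpoly_value_mult: "mpoly_value z (p * q) = mpoly_value z p * mpoly_value z q"
proof -
  have "Poly_Mapping.keys p \<subseteq> UNIV" by simp
  then show ?thesis
    by (induction p rule: frag_induction)
      (simp_all add: mpoly_value_frag_of_mult lin_diff left_diff_distrib)
qed

lemma mpoly_value_1: "mpoly_value z 1 = 1"
  unfolding single_one[symmetric] lin_frag_of by (simp add: monomial_value_def)

interpretation mpoly_value: comm_ring_hom "mpoly_value z" for z
  by unfold_locales (simp_all add: lin_add mpoly_value_mult mpoly_value_1)

lemma mpoly_value_mvar: "mpoly_value z (mvar i) = z i"
  by (simp add: mvar_def monomial_value_def)

lemma mpoly_value_esym_int: "mpoly_value z (esym_int N mvar m) = esym_int N z m"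
  by (simp add: esym_int_def esym_def mpoly_value.hom_sum mpoly_value.hom_prod mpoly_value_mvar)

lemma mpoly_value_schur:
  assumes "is_partition \<alpha>" "\<alpha> 0 \<le> L"
  shows "mpoly_value z (schur N \<alpha>) = jt L (esym_int N z) (\<lambda>r. int (conjugate \<alpha> r))"
  unfolding schur_eq_jt[OF assms] jt_eq_sum
  by (simp add: mpoly_value.hom_sum mpoly_value.hom_prod mpoly_value.hom_mult mpoly_value_esym_int)

theorem LR_mpoly_value:
  assumes "is_partition \<alpha>" "is_partition \<beta>"
  shows "mpoly_value z (schur N \<alpha>) * mpoly_value z (schur N \<beta>) =
    lin (\<lambda>\<rho>. mpoly_value z (schur N \<rho>)) (LR \<alpha> \<beta>)"
  using LR_spec(2)[OF assms, of N] by (metis lin_frag_extend mpoly_value_mult)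

section \<open>Determinants of quasiperiodic sequences\<close>

lemma jt_cong:
  assumes "\<And>i j. i < L \<Longrightarrow> j < L \<Longrightarrow> g (c i - int i + int j) = g' (c' i - int i + int j)"
  shows "jt L g c = jt L g' c'"
  unfolding jt_def by (rule arg_cong[of _ _ det], rule cong_mat) (use assms in auto)

text \<open>A row depends only on \<open>c i - i\<close>, and replacing neighbours a, b by b - 1, a
  + 1 interchanges the two values of that difference, hence the two rows.\<close>

lemma jt_swap:
  assumes "Suc p < L"
  shows "jt L g (c(p := c (Suc p) - 1, Suc p := c p + 1)) = - jt L g c"
proof -
  define A where "A = mat L L (\<lambda>(i, j). g (c i - int i + int j))"
  have A: "A \<in> carrier_mat L L" by (simp add: A_def)
  have tp: "transpose p (Suc p) permutes {0..<L}"
    by (rule permutes_swap_id) (use assms in auto)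
  have "jt L g (c(p := c (Suc p) - 1, Suc p := c p + 1)) = det (mat L L (\<lambda>(i, j). A $$ (transpose p (Suc p) i, j)))"
    unfolding jt_def
    by (rule arg_cong[of _ _ det], rule cong_mat) (use assms in \<open>auto simp: A_def transpose_def algebra_simps\<close>)
  also have "\<dots> = of_int (sign (transpose p (Suc p))) * det A"
    by (rule det_permute_rows[OF A tp])
  finally show ?thesis by (simp add: sign_swap_id A_def jt_def)
qed

lemma det_companion:
  fixes d :: "nat \<Rightarrow> 'a::comm_ring_1"
  shows "det (mat (Suc k) (Suc k) (\<lambda>(i, j). if j = k then d i else if i = Suc j then 1 else 0)) = (-1) ^ k * d 0"
proof -
  define C where "C = mat (Suc k) (Suc k) (\<lambda>(i, j). if j = k then d i else if i = Suc j then 1 else 0)"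
  have C: "C \<in> carrier_mat (Suc k) (Suc k)" by (simp add: C_def)
  have "det C = (\<Sum>j<Suc k. C $$ (0, j) * cofactor C 0 j)"
    by (rule laplace_expansion_row[OF C]) simp
  also have "\<dots> = (\<Sum>j<Suc k. if j = k then d 0 * cofactor C 0 k else 0)"
    by (rule sum.cong[OF refl]) (auto simp: C_def)
  also have "\<dots> = d 0 * cofactor C 0 k" by simp
  also have "cofactor C 0 k = (-1) ^ k * det (mat_delete C 0 k)" by (simp add: cofactor_def)
  also have "mat_delete C 0 k = 1\<^sub>m k"
    by (rule eq_matI) (auto simp: mat_delete_def C_def)
  finally show ?thesis by (simp add: C_def mult.commute)
qed

text \<open>For nonnegative indices, \<open>g\<close> lists the power series coefficients of the
  reciprocal of the polynomial with coefficients \<open>Y\<close>. The condition \<open>Y_k\<close>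
  makes the determinant of the companion matrix compensate the factor \<open>inverse u\<close> of
  the rotation, and \<open>g_neg\<close> covers the negative indices met in a determinant of order
  \<open>k\<close> with nonnegative entries.\<close>

locale quasiperiodic =
  fixes g :: "int \<Rightarrow> complex" and Y :: "nat \<Rightarrow> complex" and k n :: nat and u :: complex
  assumes recurrence: "(\<Sum>j\<le>k. Y j * g (m - int j)) = 0"
    and quasiperiod: "g (m + int (n + k)) = u * g m"
    and u: "u \<noteq> 0" and Y_0: "Y 0 = 1" and Y_k: "Y k = - u"
    and g_0: "g 0 = 1" and g_neg: "- int k < m \<Longrightarrow> m < 0 \<Longrightarrow> g m = 0"
    and k: "k \<ge> 1"
begin

lemma recurrence_top: "(\<Sum>l<k. - Y (k - l) * g (m + int l)) = g (m + int k)"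
proof -
  have "(\<Sum>j\<le>k. Y j * g (m + int k - int j)) = g (m + int k) + (\<Sum>j = 1..k. Y j * g (m + int k - int j))"
    unfolding atMost_atLeast0 by (simp add: sum.atLeast_Suc_atMost Y_0)
  moreover have "(\<Sum>j = 1..k. Y j * g (m + int k - int j)) = (\<Sum>l<k. Y (k - l) * g (m + int l))"
    by (rule sum.reindex_bij_witness[of _ "\<lambda>l. k - l" "\<lambda>j. k - j"]) (auto simp: of_nat_diff add_diff_eq)
  ultimately show ?thesis using recurrence[of "m + int k"] by (simp add: sum_negf add_eq_0_iff2)
qed

text \<open>Replacing \<open>c\<close> by \<open>c'\<close> shifts all indices by one, which is multiplication by the companion matrix of
  the recurrence, and then moves the first row to the bottom, which costs a factor \<open>inverse u\<close>.\<close>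

lemma jt_rotate:
  assumes c': "\<And>i. Suc i < k \<Longrightarrow> c' i = c (Suc i)" "c' (k - 1) = c 0 - int n"
  shows "jt k g c' = jt k g c"
proof -
  obtain k' where k': "k = Suc k'" using k by (cases k) auto
  define A where "A = mat k k (\<lambda>(i, j). g (c i - int i + int j))"
  define B where "B = mat k k (\<lambda>(i, j). g (c i - int i + int j + 1))"
  define C where "C = (\<lambda>d :: nat \<Rightarrow> complex. mat k k (\<lambda>(i, j). if j = k' then d i else if i = Suc j then 1 else 0))"
  \<comment> \<open>The cyclic shift of rows with weight \<open>inverse u\<close> at the
    wrap-around, written as a transposed companion matrix so that \<open>det_companion\<close>
    computes this determinant too.\<close>
  define P where "P = transpose_mat (C (\<lambda>l. if l = 0 then inverse u else 0))"
  have A: "A \<in> carrier_mat k k" and B: "B \<in> carrier_mat k k" and C: "\<And>d. C d \<in> carrier_mat k k"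
    and P: "P \<in> carrier_mat k k"
    by (simp_all add: A_def B_def C_def P_def)
  have "A * C (\<lambda>l. - Y (k - l)) = B"
  proof (rule eq_matI)
    fix i j assume "i < dim_row B" "j < dim_col B"
    then have ij: "i < k" "j < k" by (auto simp: B_def)
    have *: "(A * C (\<lambda>l. - Y (k - l))) $$ (i, j) = (\<Sum>l<k. A $$ (i, l) * C (\<lambda>l. - Y (k - l)) $$ (l, j))"
      using ij A C[of "\<lambda>l. - Y (k - l)"] by (simp add: scalar_prod_def atLeast0LessThan)
    show "(A * C (\<lambda>l. - Y (k - l))) $$ (i, j) = B $$ (i, j)"
    proof (cases "j = k'")
      case True
      have "(\<Sum>l<k. A $$ (i, l) * C (\<lambda>l. - Y (k - l)) $$ (l, j)) = (\<Sum>l<k. - Y (k - l) * g (c i - int i + int l))"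
        by (rule sum.cong[OF refl]) (use ij True in \<open>auto simp: A_def C_def\<close>)
      also have "\<dots> = g (c i - int i + int k)" by (rule recurrence_top)
      also have "\<dots> = B $$ (i, j)" using ij True by (simp add: B_def k' algebra_simps)
      finally show ?thesis using * by simp
    next
      case False
      have "(\<Sum>l<k. A $$ (i, l) * C (\<lambda>l. - Y (k - l)) $$ (l, j)) =
          (\<Sum>l<k. if l = Suc j then g (c i - int i + int (Suc j)) else 0)"
        by (rule sum.cong[OF refl]) (use ij False in \<open>auto simp: A_def C_def\<close>)
      also have "\<dots> = B $$ (i, j)" using ij False by (simp add: B_def k' algebra_simps)
      finally show ?thesis using * by simp
    qed
  qed (auto simp: A_def B_def C_def)
  moreover have "P * B = mat k k (\<lambda>(i, j). g (c' i - int i + int j))" (is "_ = ?R")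
  proof (rule eq_matI)
    fix i j assume "i < dim_row ?R" "j < dim_col ?R"
    then have ij: "i < k" "j < k" by auto
    have *: "(P * B) $$ (i, j) = (\<Sum>l<k. P $$ (i, l) * B $$ (l, j))"
      using ij P B by (simp add: scalar_prod_def atLeast0LessThan)
    show "(P * B) $$ (i, j) = ?R $$ (i, j)"
    proof (cases "i = k'")
      case True
      have "(\<Sum>l<k. P $$ (i, l) * B $$ (l, j)) = (\<Sum>l<k. if l = 0 then inverse u * g (c 0 + int j + 1) else 0)"
        by (rule sum.cong[OF refl]) (use ij True in \<open>auto simp: P_def B_def C_def\<close>)
      also have "\<dots> = inverse u * g (c 0 + int j + 1)" using k by simp
      \<comment> \<open>The new last entry \<open>c 0 - int n\<close> stands in row
        \<open>k - 1\<close>, so its index lies exactly one period \<open>n + k\<close> below the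
        old first row shifted by one.\<close>
      also have "\<dots> = inverse u * (u * g (c 0 + int j + 1 - int (n + k)))"
        using quasiperiod[of "c 0 + int j + 1 - int (n + k)"] by simp
      also have "c 0 + int j + 1 - int (n + k) = c' i - int i + int j" using True c'(2) by (simp add: k')
      also have "inverse u * (u * g (c' i - int i + int j)) = g (c' i - int i + int j)" using u by simp
      finally show ?thesis using * ij by simp
    next
      case False
      have "(\<Sum>l<k. P $$ (i, l) * B $$ (l, j)) = (\<Sum>l<k. if l = Suc i then g (c (Suc i) - int i + int j) else 0)"
        by (rule sum.cong[OF refl]) (use ij False in \<open>auto simp: P_def B_def C_def algebra_simps\<close>)
      also have "\<dots> = g (c' i - int i + int j)" using False ij c'(1)[of i] by (simp add: k')
      finally show ?thesis using * ij by simp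
    qed
  qed (auto simp: B_def P_def C_def)
  ultimately have "jt k g c' = det (P * (A * C (\<lambda>l. - Y (k - l))))" by (simp add: jt_def)
  also have "\<dots> = det P * (det A * det (C (\<lambda>l. - Y (k - l))))"
    by (subst det_mult[OF P]) (simp_all add: det_mult[OF A C] mult_carrier_mat[OF A C])
  also have "det P = (-1) ^ k' * inverse u"
    unfolding P_def det_transpose[OF C] unfolding C_def k' by (simp add: det_companion)
  also have "det (C (\<lambda>l. - Y (k - l))) = (-1) ^ k' * u"
    unfolding C_def k' by (subst det_companion) (simp add: Y_k flip: k')
  also have "(-1) ^ k' * inverse u * (det A * ((-1) ^ k' * u)) = det A"
    using u by (simp add: power_mult_distrib[symmetric] field_simps)
  finally show ?thesis by (simp add: A_def jt_def)
qed

text \<open>Elementary symmetric functions vanish at all negative indices, whereas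
  \<open>g (- int k)\<close> is \<open>inverse u\<close>. The truncation changes nothing in
  determinants of order \<open>k\<close> with nonnegative entries, but it matters in the larger ones
  that arise from partitions with more than \<open>k\<close> columns.\<close>

definition gp :: "int \<Rightarrow> complex" where
  "gp m = (if m < 0 then 0 else g m)"

lemma gp_eq_g: "- int k < m \<Longrightarrow> gp m = g m"
  by (simp add: gp_def g_neg)

text \<open>The recurrence is a linear relation between the last k + 1 columns. Because every entry
  of \<open>c\<close> is at least 1, the last index in a row is at least 1 and the k indices before
  it stay above \<open>- int k\<close>, where \<open>gp\<close> and \<open>g\<close> agree.\<close>

lemma jt_gp_eq_0:
  assumes "k < r" and "\<And>i. i < r \<Longrightarrow> 1 \<le> c i"
  shows "jt r gp c = 0"
proof -
  define A where "A = mat r r (\<lambda>(i, j). gp (c i - int i + int j))"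
  define v where "v = vec r (\<lambda>l. if r - 1 - l \<le> k then Y (r - 1 - l) else 0)"
  have A: "A \<in> carrier_mat r r" by (simp add: A_def)
  have "A *\<^sub>v v = 0\<^sub>v r"
  proof (rule eq_vecI)
    fix i assume "i < dim_vec (0\<^sub>v r :: complex vec)"
    then have i: "i < r" by simp
    let ?m = "c i - int i + int (r - 1)"
    have m: "?m \<ge> 1" using assms(2)[OF i] i by simp
    have "(A *\<^sub>v v) $ i = (\<Sum>l<r. gp (c i - int i + int l) * (if r - 1 - l \<le> k then Y (r - 1 - l) else 0))"
      using i by (auto simp: A_def v_def scalar_prod_def atLeast0LessThan intro!: sum.cong)
    also have "\<dots> = (\<Sum>j<r. gp (?m - int j) * (if j \<le> k then Y j else 0))"
      by (rule sum.reindex_bij_witness[of _ "\<lambda>l. r - 1 - l" "\<lambda>j. r - 1 - j"])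
        (use assms(1) in \<open>auto simp: of_nat_diff algebra_simps\<close>)
    also have "\<dots> = (\<Sum>j\<le>k. Y j * g (?m - int j))"
      by (rule sum.mono_neutral_cong_right) (use assms(1) m in \<open>auto simp: gp_eq_g\<close>)
    also have "\<dots> = 0" by (rule recurrence)
    finally show "(A *\<^sub>v v) $ i = 0\<^sub>v r $ i" using i by simp
  qed (simp add: A_def)
  moreover have "v \<in> carrier_vec r" by (simp add: v_def)
  moreover have "v \<noteq> 0\<^sub>v r"
  proof
    assume "v = 0\<^sub>v r"
    then have "v $ (r - 1) = 0" using assms(1) by simp
    then show False using assms(1) Y_0 by (simp add: v_def)
  qed
  ultimately have "det A = 0" using det_0_iff_vec_prod_zero[OF A] by blast
  then show ?thesis by (simp add: A_def jt_def)
qed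

definition F :: "int list \<Rightarrow> complex" where
  "F as = jt k g (\<lambda>i. as ! i)"

end

section \<open>Complex numbers with prescribed elementary symmetric functions\<close>

lemma coeff_prod_linear: "coeff (\<Prod>i<q. [:1, z i:]) m = esym q (z :: nat \<Rightarrow> 'a::comm_ring_1) m"
proof -
  have const: "esym q (\<lambda>i. [:z i:]) l = [:esym q z l:]" for l
  proof -
    have "(\<Prod>i\<in>S. [:z i:]) = [:\<Prod>i\<in>S. z i:]" for S :: "nat set"
      by (induction S rule: infinite_finite_induct) simp_all
    moreover have "(\<Sum>S\<in>\<A>. [:f S:]) = [:\<Sum>S\<in>\<A>. f S:]" for \<A> :: "nat set set" and f :: "nat set \<Rightarrow> 'a"
      by (induction \<A> rule: infinite_finite_induct) simp_all
    ultimately show ?thesis by (simp add: esym_def)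
  qed
  have "(\<Prod>i<q. [:1, z i:]) = (\<Prod>i<q. monom 1 1 * [:z i:] + 1)"
    by (rule prod.cong[OF refl]) (simp add: monom_altdef one_pCons)
  also have "\<dots> = (\<Sum>l\<le>q. monom (esym q z l) l)"
    unfolding prod_add_eq_sum_esym const
    by (rule sum.cong[OF refl]) (simp add: monom_power smult_monom mult.commute)
  finally have "coeff (\<Prod>i<q. [:1, z i:]) m = (\<Sum>l\<le>q. if l = m then esym q z l else 0)"
    by (simp add: coeff_sum)
  then show ?thesis by (auto simp: esym_eq_0)
qed

lemma complex_poly_factors:
  fixes p :: "complex poly"
  assumes "coeff p 0 = 1"
  shows "\<exists>(q::nat) z. p = (\<Prod>i<q. [:1, z i:])"
  using assms
proof (induction "degree p" arbitrary: p rule: less_induct)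
  case less
  show ?case
  proof (cases "degree p = 0")
    case True
    then obtain a where "p = [:a:]" by (rule degree_eq_zeroE)
    then have "p = 1" using less.prems by (simp add: one_pCons)
    then show ?thesis by (intro exI[of _ 0]) simp
  next
    case False
    then obtain r where r: "poly p r = 0"
      using fundamental_theorem_of_algebra[of p] constant_degree[of p] by auto
    have "r \<noteq> 0" using r less.prems by (auto simp: poly_0_coeff_0)
    from r obtain p1 where p1: "p = [:- r, 1:] * p1" by (auto simp: poly_eq_0_iff_dvd elim: dvdE)
    define p' where "p' = Polynomial.smult (- r) p1"
    have "[:- r, 1:] = Polynomial.smult (- r) [:1, - inverse r:]" using \<open>r \<noteq> 0\<close> by simp
    then have p': "p = [:1, - inverse r:] * p'"
      unfolding p1 p'_def by (simp only: mult_smult_left mult_smult_right)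
    have "p' \<noteq> 0" using p' False by auto
    then have "degree p = Suc (degree p')"
      unfolding p' by (subst degree_mult_eq) (use \<open>r \<noteq> 0\<close> in auto)
    moreover have "coeff p' 0 = 1" using less.prems unfolding p' by (simp add: mult_pCons_left)
    ultimately obtain q :: nat and z where "p' = (\<Prod>i<q. [:1, z i:])" using less.hyps[of p'] by auto
    then have "p = (\<Prod>i<Suc q. [:1, (z(q := - inverse r)) i:])"
      unfolding p' by (simp add: mult.commute)
    then show ?thesis by blast
  qed
qed

context quasiperiodic begin

text \<open>The truncation of the generating function at degree \<open>M\<close> has constant term
  1, so it splits into factors 1 + z i t, whose product has the elementary symmetric functions as
  coefficients.\<close>

lemma exists_esym_eq: "\<exists>q z. \<forall>m\<le>M. esym q z m = g (int m)"
proof -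
  define p where "p = (\<Sum>m\<le>M. monom (g (int m)) m)"
  have c: "coeff p m = g (int m)" if "m \<le> M" for m
    using that by (simp add: p_def coeff_sum)
  then have "coeff p 0 = 1" by (simp add: g_0)
  then obtain q :: nat and z where p: "p = (\<Prod>i<q. [:1, z i:])" using complex_poly_factors by blast
  have "esym q z m = g (int m)" if "m \<le> M" for m
    using c[OF that] unfolding p coeff_prod_linear .
  then show ?thesis by blast
qed

section \<open>Schur polynomials evaluated at these numbers\<close>

lemma F_symbol_of: "F (symbol_of k \<alpha>) = jt k gp (\<lambda>i. int (\<alpha> i))"
  unfolding F_def by (rule jt_cong) (auto simp: symbol_of_def gp_eq_g)

text \<open>With at most \<open>k\<close> columns, the determinant of order \<open>k\<close> is
  \<open>F\<close>. With more, the determinant of order \<open>\<gamma> 0\<close> exceeds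
  \<open>k\<close> and all its entries are at least 1, so \<open>jt_gp_eq_0\<close> applies. The
  bound on \<open>M\<close> covers the largest index in either determinant.\<close>

lemma mpoly_value_schur_eq_F:
  assumes z: "\<forall>m\<le>M. esym q z m = g (int m)"
    and \<gamma>: "is_partition \<gamma>" "conjugate \<gamma> 0 + k + \<gamma> 0 \<le> M"
  shows "mpoly_value z (schur q \<gamma>) =
    (if plength (conjugate \<gamma>) \<le> k then F (symbol_of k (conjugate \<gamma>)) else 0)"
proof -
  have le: "conjugate \<gamma> i \<le> conjugate \<gamma> 0" for i
    by (rule partition_le_0[OF is_partition_conjugate[OF \<gamma>(1)]])
  have e: "esym_int q z m = gp m" if "m \<le> int M" for m
    using z[rule_format, of "nat m"] that by (simp add: esym_int_def gp_def)
  have jt: "jt L (esym_int q z) (\<lambda>r. int (conjugate \<gamma> r)) = jt L gp (\<lambda>r. int (conjugate \<gamma> r))"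
    if "L \<le> k + \<gamma> 0" for L
  proof (rule jt_cong, rule e)
    fix i j assume "i < L" "j < L"
    then show "int (conjugate \<gamma> i) - int i + int j \<le> int M" using le[of i] \<gamma>(2) that by linarith
  qed
  show ?thesis
  proof (cases "\<gamma> 0 \<le> k")
    case True
    then show ?thesis
      using mpoly_value_schur[OF \<gamma>(1) True, of z q] jt[of k] by (simp add: plength_conjugate[OF \<gamma>(1)] F_symbol_of)
  next
    case False
    have "jt (\<gamma> 0) gp (\<lambda>r. int (conjugate \<gamma> r)) = 0"
      by (rule jt_gp_eq_0) (use False less_conjugate_iff[OF \<gamma>(1), of 0] in \<open>auto simp: Suc_le_eq\<close>)
    then show ?thesis
      using False mpoly_value_schur[OF \<gamma>(1) order_refl, of z q] jt[of "\<gamma> 0"]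
      by (simp add: plength_conjugate[OF \<gamma>(1)])
  qed
qed

theorem lin_initial_combination:
  assumes "is_partition \<alpha>" "is_partition \<beta>" "\<alpha> 0 \<le> k" "\<beta> 0 \<le> k"
  shows "lin F (initial_combination k \<alpha> \<beta>) = F (symbol_of k (conjugate \<alpha>)) * F (symbol_of k (conjugate \<beta>))"
proof -
  define K where "K = insert \<alpha> (insert \<beta> (Poly_Mapping.keys (LR \<alpha> \<beta>)))"
  \<comment> \<open>One choice of \<open>z\<close> must be correct for both factors and for every
    term of the product at once, so a common bound is taken.\<close>
  define M where "M = (\<Sum>\<gamma>\<in>K. conjugate \<gamma> 0 + k + \<gamma> 0)"
  have M: "conjugate \<gamma> 0 + k + \<gamma> 0 \<le> M" if "\<gamma> \<in> K" for \<gamma>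
    unfolding M_def by (rule member_le_sum) (use that in \<open>auto simp: K_def\<close>)
  have part: "is_partition \<gamma>" if "\<gamma> \<in> K" for \<gamma>
    using that assms LR_spec(1)[OF assms(1,2)] by (auto simp: K_def)
  obtain q z where z: "\<forall>m\<le>M. esym q z m = g (int m)" using exists_esym_eq by blast
  let ?G = "\<lambda>\<gamma>. if plength (conjugate \<gamma>) \<le> k then F (symbol_of k (conjugate \<gamma>)) else 0"
  have G: "mpoly_value z (schur q \<gamma>) = ?G \<gamma>" if "\<gamma> \<in> K" for \<gamma>
    by (rule mpoly_value_schur_eq_F[OF z part[OF that] M[OF that]])
  have "lin F (initial_combination k \<alpha> \<beta>) = lin ?G (LR \<alpha> \<beta>)"
    unfolding initial_combination_def lin_frag_extend
    by (rule arg_cong[of _ _ "\<lambda>h. lin h _"]) auto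
  also have "\<dots> = lin (\<lambda>\<gamma>. mpoly_value z (schur q \<gamma>)) (LR \<alpha> \<beta>)"
    unfolding lin_def[of _ "LR \<alpha> \<beta>"] by (rule sum.cong[OF refl]) (use G in \<open>simp add: K_def\<close>)
  also have "\<dots> = mpoly_value z (schur q \<alpha>) * mpoly_value z (schur q \<beta>)"
    by (rule LR_mpoly_value[OF assms(1,2), symmetric])
  also have "\<dots> = ?G \<alpha> * ?G \<beta>" using G[of \<alpha>] G[of \<beta>] by (simp add: K_def)
  finally show ?thesis using assms by (simp add: plength_conjugate)
qed

end

section \<open>The reduction procedure\<close>

lemma lin_rewrite_term:
  assumes "rewrite_term r X Y" and "\<And>as R. as \<in> Poly_Mapping.keys X \<Longrightarrow> r as R \<Longrightarrow> lin G R = G as"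
  shows "lin G Y = lin G X"
proof -
  obtain as R where "as \<in> Poly_Mapping.keys X" "r as R"
    and Y: "Y = X + frag_cmul (Poly_Mapping.lookup X as) (R - frag_of as)"
    using assms(1) unfolding rewrite_term_def by auto
  then have "lin G R = G as" by (intro assms(2))
  then show ?thesis unfolding Y by (simp add: lin_add lin_cmul lin_diff)
qed

lemma keys_rewrite_term:
  assumes "Y = X + frag_cmul (Poly_Mapping.lookup X as) (R - frag_of as)"
  shows "Poly_Mapping.keys Y \<subseteq> (Poly_Mapping.keys X - {as}) \<union> Poly_Mapping.keys R"
proof
  fix bs assume "bs \<in> Poly_Mapping.keys Y"
  then have "Poly_Mapping.lookup Y bs \<noteq> 0" by (simp add: in_keys_iff)
  then show "bs \<in> (Poly_Mapping.keys X - {as}) \<union> Poly_Mapping.keys R"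
    unfolding assms by (auto simp: lookup_add lookup_minus in_keys_iff split: if_splits)
qed

lemma rewrite_term_keys_subset:
  assumes "rewrite_term r X Y" "Poly_Mapping.keys X \<subseteq> A"
    and "\<And>as R. as \<in> A \<Longrightarrow> r as R \<Longrightarrow> Poly_Mapping.keys R \<subseteq> A"
  shows "Poly_Mapping.keys Y \<subseteq> A"
proof -
  obtain as R where as: "as \<in> Poly_Mapping.keys X" "r as R"
    and Y: "Y = X + frag_cmul (Poly_Mapping.lookup X as) (R - frag_of as)"
    using assms(1) unfolding rewrite_term_def by auto
  then have "Poly_Mapping.keys R \<subseteq> A" using assms(2,3) by blast
  then show ?thesis using keys_rewrite_term[OF Y] assms(2) by blast
qed

text \<open>Both quantities survive straightening. The length is what evaluating \<open>F\<close> on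
  intermediate symbols requires; the sum shows that a complete replacement lowers it by exactly
  \<open>n\<close>.\<close>

definition symbols_of_sum :: "nat \<Rightarrow> int \<Rightarrow> int list set" where
  "symbols_of_sum k s = {as. length as = k \<and> sum_list as = s}"

lemma straightening_rule_keys:
  assumes "straightening_rule as R" "as \<in> symbols_of_sum k s"
  shows "Poly_Mapping.keys R \<subseteq> symbols_of_sum k s"
  using assms by (cases rule: straightening_rule.cases) (auto simp: symbols_of_sum_def)

lemma straightening_keys:
  assumes "(rewrite_term straightening_rule)\<^sup>*\<^sup>* (frag_of as) R"
  shows "Poly_Mapping.keys R \<subseteq> symbols_of_sum (length as) (sum_list as)"
  using assms
proof (induction rule: rtranclp_induct)
  case base
  show ?case by (simp add: symbols_of_sum_def)
next
  case (step X Y)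
  show ?case by (rule rewrite_term_keys_subset[OF step.hyps(2) step.IH]) (rule straightening_rule_keys)
qed

lemma replacement_rule_result:
  assumes "replacement_rule n as R"
  shows "partition_symbol as"
    and "R = 0 \<or> (\<exists>bs. partition_symbol bs \<and> length bs = length as \<and>
      sum_list bs = sum_list as - int n \<and> (R = frag_of bs \<or> R = - frag_of bs))"
proof -
  show "partition_symbol as" using assms by (cases rule: replacement_rule.cases) auto
  show "R = 0 \<or> (\<exists>bs. partition_symbol bs \<and> length bs = length as \<and>
      sum_list bs = sum_list as - int n \<and> (R = frag_of bs \<or> R = - frag_of bs))"
    using assms
  proof (cases rule: replacement_rule.cases)
    case (shift a as')
    then show ?thesis by (intro disjI2 exI[of _ "as' @ [a - int n]"]) auto
  next
    case (shift_straighten a as')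
    from shift_straighten(4) have keys: "Poly_Mapping.keys R \<subseteq> symbols_of_sum (length as) (sum_list as - int n)"
      using straightening_keys[OF shift_straighten(5)] shift_straighten(1) by (simp add: algebra_simps)
    from shift_straighten(6) show ?thesis
    proof
      assume "\<exists>bs. partition_symbol bs \<and> (R = frag_of bs \<or> R = - frag_of bs)"
      then obtain bs where bs: "partition_symbol bs" "R = frag_of bs \<or> R = - frag_of bs" by blast
      then have "Poly_Mapping.keys R = {bs}" by auto
      then show ?thesis using keys bs by (intro disjI2 exI[of _ bs]) (auto simp: symbols_of_sum_def)
    qed simp
  qed
qed

text \<open>Reduction terminates because each step replaces a partition symbol by at most one partition symbol of smaller sum.\<close>

definition symbols_weight :: "symbols \<Rightarrow> nat" where
  "symbols_weight X = (\<Sum>as\<in>{as \<in> Poly_Mapping.keys X. partition_symbol as}. nat (sum_list as) + 1)"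

lemma partition_symbol_sum_nonneg: "partition_symbol as \<Longrightarrow> 0 \<le> sum_list as"
  by (simp add: partition_symbol_def sum_list_nonneg)

lemma symbols_weight_decreases:
  assumes "reduction_step n X Y" "n \<ge> 1"
  shows "symbols_weight Y < symbols_weight X"
proof -
  obtain as R where as: "as \<in> Poly_Mapping.keys X" "replacement_rule n as R"
    and Y: "Y = X + frag_cmul (Poly_Mapping.lookup X as) (R - frag_of as)"
    using assms(1) unfolding reduction_step_def rewrite_term_def by auto
  let ?K = "{as \<in> Poly_Mapping.keys X. partition_symbol as}"
  let ?w = "\<lambda>as. nat (sum_list as) + 1"
  have asK: "as \<in> ?K" using as replacement_rule_result(1) by auto
  have "(\<Sum>bs\<in>{bs \<in> Poly_Mapping.keys R. partition_symbol bs}. ?w bs) < ?w as"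
    using replacement_rule_result(2)[OF as(2)]
  proof
    assume "\<exists>bs. partition_symbol bs \<and> length bs = length as \<and>
      sum_list bs = sum_list as - int n \<and> (R = frag_of bs \<or> R = - frag_of bs)"
    then obtain bs where bs: "partition_symbol bs" "sum_list bs = sum_list as - int n"
      "Poly_Mapping.keys R = {bs}" by auto
    then have "{bs \<in> Poly_Mapping.keys R. partition_symbol bs} = {bs}" by auto
    then show ?thesis using bs partition_symbol_sum_nonneg[OF bs(1)] assms(2) by simp
  qed simp
  \<comment> \<open>Only an inequality, since the new symbol may merge with one already present or
    cancel against it.\<close>
  moreover have "symbols_weight Y \<le> (\<Sum>bs\<in>(?K - {as}) \<union> {bs \<in> Poly_Mapping.keys R. partition_symbol bs}. ?w bs)"
    unfolding symbols_weight_def by (rule sum_mono2) (use keys_rewrite_term[OF Y] in auto)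
  moreover have "\<dots> \<le> (\<Sum>bs\<in>?K - {as}. ?w bs) + (\<Sum>bs\<in>{bs \<in> Poly_Mapping.keys R. partition_symbol bs}. ?w bs)"
    by (subst sum_Un_nat) auto
  moreover have "symbols_weight X = ?w as + (\<Sum>bs\<in>?K - {as}. ?w bs)"
    unfolding symbols_weight_def by (rule sum.remove) (use asK in auto)
  ultimately show ?thesis by linarith
qed

theorem reduction_terminates:
  assumes "n \<ge> 1"
  shows "\<not> (\<forall>i::nat. reduction_step n (X i) (X (Suc i)))"
proof
  assume *: "\<forall>i::nat. reduction_step n (X i) (X (Suc i))"
  have "symbols_weight (X i) + i \<le> symbols_weight (X 0)" for i
  proof (induction i)
    case (Suc i)
    then show ?case using symbols_weight_decreases[OF *[rule_format, of i] assms] by simp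
  qed simp
  from this[of "Suc (symbols_weight (X 0))"] show False by simp
qed

section \<open>Progress: a replacement can always be carried out\<close>

definition partition_symbols :: "nat \<Rightarrow> int list set" where
  "partition_symbols k = {as. length as = k \<and> partition_symbol as}"

lemma partition_symbol_symbol_of:
  assumes "is_partition \<alpha>"
  shows "symbol_of k \<alpha> \<in> partition_symbols k"
  using partition_antimono[OF assms]
  by (auto simp: partition_symbols_def partition_symbol_def symbol_of_def sorted_wrt_iff_nth_less)

lemma keys_initial_combination:
  assumes "is_partition \<alpha>" "is_partition \<beta>"
  shows "Poly_Mapping.keys (initial_combination k \<alpha> \<beta>) \<subseteq> partition_symbols k"
proof -
  have "Poly_Mapping.keys (if plength (conjugate \<gamma>) \<le> k then frag_of (symbol_of k (conjugate \<gamma>)) else 0)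
      \<subseteq> partition_symbols k" if "\<gamma> \<in> Poly_Mapping.keys (LR \<alpha> \<beta>)" for \<gamma>
    using partition_symbol_symbol_of[OF is_partition_conjugate, of \<gamma> k] LR_spec(1)[OF assms] that by auto
  then show ?thesis
    unfolding initial_combination_def using keys_frag_extend by (blast dest!: subsetD[OF keys_frag_extend])
qed

lemma keys_reduction:
  assumes "(reduction_step n)\<^sup>*\<^sup>* X Y" "Poly_Mapping.keys X \<subseteq> partition_symbols k"
  shows "Poly_Mapping.keys Y \<subseteq> partition_symbols k"
  using assms
proof (induction rule: rtranclp_induct)
  case (step Y Z)
  show ?case
  proof (rule rewrite_term_keys_subset[OF step.hyps(2)[unfolded reduction_step_def]])
    fix as R assume "as \<in> partition_symbols k" "replacement_rule n as R"
    then show "Poly_Mapping.keys R \<subseteq> partition_symbols k"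
      using replacement_rule_result(2)[of n as R] by (auto simp: partition_symbols_def)
  qed (use step in auto)
qed

text \<open>An insertion sort: \<open>d\<close> moves left through \<open>xs\<close>, losing 1 at
  each swap, while the entry it passes joins \<open>ys\<close> raised by 1. The condition
  \<open>y <= x + 1\<close> keeps \<open>ys\<close> sorted after that raise. The motion ends when
  \<open>d\<close> fits, or meets an entry one smaller and the symbol vanishes;
  \<open>\<epsilon>\<close> records the sign of the swaps.\<close>

lemma straightening_exists:
  assumes "sorted_wrt (\<ge>) xs" "\<forall>x\<in>set xs. 0 \<le> x" "sorted_wrt (\<ge>) ys" "\<forall>y\<in>set ys. 0 \<le> y"
    and "0 \<le> d" "\<forall>y\<in>set ys. y \<le> d" "\<forall>x\<in>set xs. \<forall>y\<in>set ys. y \<le> x + 1"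
    and "\<epsilon> = 1 \<or> \<epsilon> = -1"
  shows "\<exists>R. (rewrite_term straightening_rule)\<^sup>*\<^sup>* (frag_cmul \<epsilon> (frag_of (xs @ [d] @ ys))) R \<and>
    (R = 0 \<or> (\<exists>bs. partition_symbol bs \<and> (R = frag_of bs \<or> R = - frag_of bs)))"
  using assms
proof (induction xs arbitrary: d ys \<epsilon> rule: rev_induct)
  case Nil
  then have "partition_symbol (d # ys)" by (auto simp: partition_symbol_def)
  then show ?case using Nil.prems(8) by (intro exI[of _ "frag_cmul \<epsilon> (frag_of (d # ys))"]) auto
next
  case (snoc b xs)
  have xs: "sorted_wrt (\<ge>) xs" "\<forall>x\<in>set xs. b \<le> x" "0 \<le> b"
    using snoc.prems(1,2) by (auto simp: sorted_wrt_append)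
  let ?S = "(xs @ [b]) @ [d] @ ys"
  consider "b \<ge> d" | "d = b + 1" | "d \<ge> b + 2" by linarith
  then show ?case
  proof cases
    case 1
    have "sorted_wrt (\<ge>) ?S"
      using snoc.prems(3,6) xs 1 by (fastforce simp: sorted_wrt_append)
    then have "partition_symbol ?S"
      using snoc.prems by (auto simp: partition_symbol_def)
    then show ?thesis using snoc.prems(8) by (intro exI[of _ "frag_cmul \<epsilon> (frag_of ?S)"]) auto
  next
    case 2
    have "straightening_rule ?S 0" using straightening_rule.vanish[of xs b ys] by (simp add: 2)
    then have "rewrite_term straightening_rule (frag_cmul \<epsilon> (frag_of ?S)) 0"
      unfolding rewrite_term_def
      by (intro exI[of _ ?S] exI[of _ 0]) (use snoc.prems(8) in \<open>auto simp: frag_cmul_distrib2\<close>)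
    then show ?thesis by blast
  next
    case 3
    let ?T = "xs @ [d - 1] @ (b + 1) # ys"
    have "straightening_rule ?S (- frag_of ?T)" using straightening_rule.swap[of xs b d ys] by simp
    then have step: "rewrite_term straightening_rule (frag_cmul \<epsilon> (frag_of ?S)) (frag_cmul (- \<epsilon>) (frag_of ?T))"
      unfolding rewrite_term_def
      by (intro exI[of _ ?S] exI[of _ "- frag_of ?T"])
        (use snoc.prems(8) in \<open>auto intro!: poly_mapping_eqI simp: lookup_add lookup_minus\<close>)
    have "\<exists>R. (rewrite_term straightening_rule)\<^sup>*\<^sup>* (frag_cmul (- \<epsilon>) (frag_of ?T)) R \<and>
      (R = 0 \<or> (\<exists>bs. partition_symbol bs \<and> (R = frag_of bs \<or> R = - frag_of bs)))"
    proof (rule snoc.IH)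
      show "\<forall>x\<in>set xs. 0 \<le> x" "0 \<le> d - 1" using snoc.prems(2) xs 3 by auto
      show "sorted_wrt (\<ge>) ((b + 1) # ys)" "\<forall>y\<in>set ((b + 1) # ys). 0 \<le> y"
        "\<forall>y\<in>set ((b + 1) # ys). y \<le> d - 1"
        using snoc.prems(3,4,7) xs 3 by auto
      show "\<forall>x\<in>set xs. \<forall>y\<in>set ((b + 1) # ys). y \<le> x + 1" using snoc.prems(7) xs by auto
      show "- \<epsilon> = 1 \<or> - \<epsilon> = - 1" using snoc.prems(8) by auto
    qed (rule xs)
    then show ?thesis using converse_rtranclp_into_rtranclp[of "rewrite_term straightening_rule", OF step] by blast
  qed
qed

lemma replacement_exists:
  assumes "partition_symbol (a # as)" "a \<ge> int n"
  shows "\<exists>R. replacement_rule n (a # as) R"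
proof (cases "partition_symbol (as @ [a - int n])")
  case True
  then show ?thesis using assms by (blast intro: replacement_rule.shift)
next
  case False
  \<comment> \<open>The tail \<open>as\<close> is already sorted, so only the appended entry has to
    move and \<open>ys\<close> starts empty.\<close>
  have "\<exists>R. (rewrite_term straightening_rule)\<^sup>*\<^sup>* (frag_cmul 1 (frag_of (as @ [a - int n] @ []))) R \<and>
    (R = 0 \<or> (\<exists>bs. partition_symbol bs \<and> (R = frag_of bs \<or> R = - frag_of bs)))"
    by (rule straightening_exists) (use assms in \<open>auto simp: partition_symbol_def\<close>)
  then show ?thesis using assms False by (auto intro: replacement_rule.shift_straighten)
qed

lemma box_partitions_conjugate:
  assumes "is_partition \<kappa>" "plength \<kappa> \<le> w" "\<kappa> 0 \<le> h"
  shows "conjugate \<kappa> \<in> box_partitions h w"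
  using assms by (simp add: box_partitions_def is_partition_conjugate plength_conjugate plength_eq_conjugate_0[symmetric])

lemma partition_symbol_eq_symbol_of:
  assumes "as \<in> partition_symbols k" "k \<ge> 1" "as ! 0 \<le> int h"
  shows "\<exists>\<nu>\<in>box_partitions h k. as = symbol_of k (conjugate \<nu>)"
proof -
  define \<kappa> where "\<kappa> = (\<lambda>i. if i < k then nat (as ! i) else 0)"
  have as: "length as = k" "\<And>i j. i < j \<Longrightarrow> j < k \<Longrightarrow> as ! j \<le> as ! i" "\<And>i. i < k \<Longrightarrow> 0 \<le> as ! i"
    using assms(1) by (auto simp: partition_symbols_def partition_symbol_def sorted_wrt_iff_nth_less)
  have fin: "{i. \<kappa> i \<noteq> 0} \<subseteq> {..<k}" by (auto simp: \<kappa>_def)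
  have "antimono \<kappa>"
  proof (rule antimonoI)
    fix i j :: nat assume "i \<le> j"
    then show "\<kappa> j \<le> \<kappa> i" using as(2)[of i j] by (cases "i = j") (auto simp: \<kappa>_def)
  qed
  then have part: "is_partition \<kappa>" using finite_subset[OF fin] by (simp add: is_partition_def)
  have "plength \<kappa> \<le> k" unfolding plength_def using card_mono[OF _ fin] by simp
  then have "conjugate \<kappa> \<in> box_partitions h k"
    by (rule box_partitions_conjugate[OF part]) (use assms in \<open>simp add: \<kappa>_def\<close>)
  moreover have "as = symbol_of k (conjugate (conjugate \<kappa>))"
    unfolding conjugate_conjugate[OF part]
    by (rule nth_equalityI) (use as in \<open>auto simp: symbol_of_def \<kappa>_def\<close>)
  ultimately show ?thesis by blast
qed

text \<open>A partition symbol with first entry below \<open>n\<close> is the symbol of a box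
  partition, so a term that obstructs full reduction has first entry at least \<open>n\<close> and
  admits a replacement.\<close>

theorem reduction_progress:
  assumes "Poly_Mapping.keys X \<subseteq> partition_symbols k" "k \<ge> 1" "n \<ge> 1"
  shows "fully_reduced n k X \<or> (\<exists>Y. reduction_step n X Y)"
proof (cases "fully_reduced n k X")
  case False
  then obtain as where as: "as \<in> Poly_Mapping.keys X"
    "\<not> (\<exists>\<nu>\<in>box_partitions (n - 1) k. as = symbol_of k (conjugate \<nu>))"
    unfolding fully_reduced_def by auto
  have ps: "as \<in> partition_symbols k" using as assms(1) by auto
  then obtain a as' where a: "as = a # as'" using assms(2) by (cases as) (auto simp: partition_symbols_def)
  have "\<not> a \<le> int (n - 1)" using partition_symbol_eq_symbol_of[OF ps assms(2), of "n - 1"] as(2) a by auto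
  then have "a \<ge> int n" using assms(3) by linarith
  then obtain R where "replacement_rule n as R"
    using replacement_exists[of a as' n] ps a by (auto simp: partition_symbols_def)
  then show ?thesis using as(1) unfolding reduction_step_def rewrite_term_def by blast
qed simp

context quasiperiodic begin

section \<open>Invariance of \<open>F\<close> under the rules\<close>

lemma F_swap: "length (xs @ [a, b] @ ys) = k \<Longrightarrow> F (xs @ [b - 1, a + 1] @ ys) = - F (xs @ [a, b] @ ys)"
proof -
  assume len: "length (xs @ [a, b] @ ys) = k"
  let ?c = "\<lambda>i. (xs @ [a, b] @ ys) ! i" and ?p = "length xs"
  have c: "(xs @ [b - 1, a + 1] @ ys) ! i = (?c(?p := ?c (Suc ?p) - 1, Suc ?p := ?c ?p + 1)) i" for i
    by (auto simp: nth_append nth_Cons')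
  show ?thesis
    unfolding F_def c by (rule jt_swap) (use len in auto)
qed

text \<open>The swap maps the pair a, a + 1 to itself, so \<open>F\<close> equals its own
  negative.\<close>

lemma F_vanish: "length (xs @ [a, a + 1] @ ys) = k \<Longrightarrow> F (xs @ [a, a + 1] @ ys) = 0"
  using F_swap[of xs a "a + 1" ys] by simp

lemma F_straightening_rule: "straightening_rule as R \<Longrightarrow> length as = k \<Longrightarrow> lin F R = F as"
proof (induction rule: straightening_rule.induct)
  case (swap xs a b ys)
  then show ?case by (simp only: lin_minus lin_frag_of F_swap minus_minus)
next
  case (vanish xs a ys)
  then show ?case by (simp only: lin_0 F_vanish)
qed

lemma F_straightening:
  assumes "(rewrite_term straightening_rule)\<^sup>*\<^sup>* (frag_of as) R" "length as = k"
  shows "lin F R = F as"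
  using assms(1)
proof (induction rule: rtranclp_induct)
  case (step X Y)
  have "lin F Y = lin F X"
  proof (rule lin_rewrite_term[OF step.hyps(2)])
    fix bs R assume "bs \<in> Poly_Mapping.keys X" "straightening_rule bs R"
    moreover from this have "length bs = k"
      using straightening_keys[OF step.hyps(1)] assms(2) by (auto simp: symbols_of_sum_def)
    ultimately show "lin F R = F bs" by (intro F_straightening_rule)
  qed
  then show ?case using step.IH by simp
qed simp

lemma F_rotate: "length (a # as) = k \<Longrightarrow> F (as @ [a - int n]) = F (a # as)"
  unfolding F_def by (rule jt_rotate) (auto simp: nth_append)

lemma F_replacement_rule: "replacement_rule n as R \<Longrightarrow> length as = k \<Longrightarrow> lin F R = F as"
proof (induction rule: replacement_rule.induct)
  case (shift a as)
  then show ?case by (simp only: lin_frag_of F_rotate)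
next
  case (shift_straighten a as R)
  then have "lin F R = F (as @ [a - int n])" by (intro F_straightening) auto
  then show ?case using F_rotate[OF shift_straighten.prems] by simp
qed

theorem lin_reduction:
  assumes "(reduction_step n)\<^sup>*\<^sup>* X X'" "Poly_Mapping.keys X \<subseteq> partition_symbols k"
  shows "lin F X' = lin F X"
  using assms(1)
proof (induction rule: rtranclp_induct)
  case (step Y Z)
  have "lin F Z = lin F Y"
  proof (rule lin_rewrite_term[OF step.hyps(2)[unfolded reduction_step_def]])
    fix bs R assume "bs \<in> Poly_Mapping.keys Y" "replacement_rule n bs R"
    moreover from this have "length bs = k"
      using keys_reduction[OF step.hyps(1) assms(2)] by (auto simp: partition_symbols_def)
    ultimately show "lin F R = F bs" by (intro F_replacement_rule)
  qed
  then show ?case using step.IH by simp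
qed simp

end

section \<open>The S-matrix\<close>

lemma prod_cis: "(\<Prod>i\<in>A. cis (f i)) = cis (\<Sum>i\<in>A. f i)"
  by (induction A rule: infinite_finite_induct) (simp_all add: cis_mult)

lemma cis_eq_1_imp_int: "cis t = 1 \<Longrightarrow> \<exists>m::int. t = 2 * pi * of_int m"
  by (auto simp: complex_eq_iff cos_one_2pi_int mult_ac)

lemma linear_factors_dvd:
  fixes p :: "complex poly" and n :: nat
  assumes "inj_on x {..<n}" "\<And>i. i < n \<Longrightarrow> x i \<noteq> 0" "\<And>i. i < n \<Longrightarrow> poly p (- inverse (x i)) = 0"
  shows "(\<Prod>i<n. [:1, x i:]) dvd p"
  using assms
proof (induction n)
  case (Suc n)
  then have "(\<Prod>i<n. [:1, x i:]) dvd p" by (simp add: lessThan_Suc)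
  then obtain r where r: "p = (\<Prod>i<n. [:1, x i:]) * r" by (elim dvdE)
  have "poly [:1, x i:] (- inverse (x n)) \<noteq> 0" if "i < n" for i
  proof -
    have "x i \<noteq> x n" using inj_onD[OF Suc.prems(1), of i n] that by auto
    then show ?thesis using Suc.prems(2)[of n] by (simp add: field_simps)
  qed
  moreover have "poly p (- inverse (x n)) = 0" by (rule Suc.prems(3)) simp
  ultimately have "poly r (- inverse (x n)) = 0" unfolding r by (simp add: poly_prod)
  then obtain r' where r': "r = [:inverse (x n), 1:] * r'" by (auto simp: poly_eq_0_iff_dvd elim: dvdE)
  have "[:inverse (x n), 1:] = Polynomial.smult (inverse (x n)) [:1, x n:]" using Suc.prems(2)[of n] by simp
  then have "p = (\<Prod>i<Suc n. [:1, x i:]) * Polynomial.smult (inverse (x n)) r'"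
    unfolding r r' by (simp only: mult_smult_left mult_smult_right prod.lessThan_Suc mult.assoc)
  then show ?case by (rule dvdI)
qed simp

text \<open>The generating function \<open>\<Prod>(1 + x i t) / (1 - u t ^ (n + k))\<close> of \<open>g\<close> is the reciprocal of a
  polynomial of degree \<open>k\<close>, because all the \<open>- 1 / x i\<close> are roots of \<open>1 - u t ^ (n + k)\<close>.\<close>

lemma exists_quasiperiodic:
  fixes x :: "nat \<Rightarrow> complex"
  assumes inj: "inj_on x {..<n}" and nz: "\<And>i. i < n \<Longrightarrow> x i \<noteq> 0"
    and c: "\<And>i. i < n \<Longrightarrow> x i ^ (n + k) = c" and prod1: "(\<Prod>i<n. x i) = 1" and k: "k \<ge> 1" and n: "n \<ge> 1"
  shows "\<exists>g Y u. quasiperiodic g Y k n u \<and>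
    (\<forall>m. m < int (n + k) \<longrightarrow> 0 \<le> m \<longrightarrow> g m = esym n x (nat m))"
proof -
  define N where "N = n + k"
  \<comment> \<open>The sign arises because the roots of the factors 1 + x i t are the negatives of
    the inverses of the \<open>x i\<close>.\<close>
  define u where "u = (-1) ^ N * c"
  define E where "E = (\<Prod>i<n. [:1, x i:])"
  define p where "p = 1 - monom u N"
  have "c \<noteq> 0" using c[of 0] nz[of 0] n by auto
  then have u: "u \<noteq> 0" by (simp add: u_def)
  have N: "N > 0" using k by (simp add: N_def)
  have "E dvd p"
    unfolding E_def
  proof (rule linear_factors_dvd[OF inj nz])
    fix i assume i: "i < n"
    have "(- inverse (x i)) ^ N = (-1) ^ N * inverse c"
      using c[OF i] unfolding N_def[symmetric] by (subst power_minus) (simp add: power_inverse)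
    then have "u * (- inverse (x i)) ^ N = ((-1) ^ N * (-1) ^ N) * (c * inverse c)"
      unfolding u_def by (simp only: mult_ac)
    also have "\<dots> = 1" using \<open>c \<noteq> 0\<close> by (simp flip: power_mult_distrib)
    finally have "u * (- inverse (x i)) ^ N = 1" .
    then show "poly p (- inverse (x i)) = 0" by (simp add: p_def poly_monom)
  qed
  then obtain Q where Q: "p = E * Q" by (elim dvdE)
  have coeffE: "coeff E m = esym n x m" for m unfolding E_def by (rule coeff_prod_linear)
  have coeffp: "coeff p m = (if m = 0 then 1 else 0) - (if m = N then u else 0)" for m
    by (simp add: p_def)
  have "p \<noteq> 0" using coeffp[of 0] N by auto
  then have "E \<noteq> 0" "Q \<noteq> 0" using Q by auto
  have "{S. S \<subseteq> {..<n} \<and> card S = n} = {{..<n}}"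
    using card_subset_eq[of "{..<n}"] by auto
  \<comment> \<open>Here product 1 enters: with leading coefficient 1 of \<open>E\<close>, that of
    \<open>Q\<close> becomes \<open>- u\<close>, as \<open>Y_k\<close> requires.\<close>
  then have coeffEn: "coeff E n = 1"
    unfolding coeffE esym_def using prod1 by simp
  have degE: "degree E = n"
  proof -
    have "degree E \<le> n" by (rule degree_le) (simp add: coeffE esym_eq_0)
    then show ?thesis using coeffEn le_degree[of E n] by simp
  qed
  have "degree p = N"
    by (rule antisym, rule degree_le) (use N u in \<open>auto simp: coeffp intro: le_degree\<close>)
  then have degQ: "degree Q = k"
    using degree_mult_eq[OF \<open>E \<noteq> 0\<close> \<open>Q \<noteq> 0\<close>] degE Q by (simp add: N_def)
  have Q0: "coeff Q 0 = 1"
    using coeffp[of 0] N unfolding Q by (simp add: coeff_mult_0 coeffE)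
  have Qk: "coeff Q k = - u"
  proof -
    have "coeff p N = coeff E n * coeff Q k"
      unfolding Q using coeff_mult_degree_sum[of E Q] by (simp add: degE degQ N_def)
    then show ?thesis using coeffEn coeffp[of N] N by simp
  qed
  define e where "e = esym_int n x"
  have e_neg: "e m = 0" if "m < 0" for m using that by (simp add: e_def esym_int_def)
  have e_big: "e m = 0" if "m > int n" for m using that by (simp add: e_def esym_int_def esym_eq_0)
  have conv: "(\<Sum>j\<le>k. coeff Q j * e (int r - int j)) = coeff p r" for r
  proof -
    have "coeff p r = (\<Sum>j\<le>r. coeff Q j * coeff E (r - j))"
      unfolding Q by (subst mult.commute) (rule coeff_mult)
    also have "\<dots> = (\<Sum>j\<le>r + k. coeff Q j * e (int r - int j))"
      by (rule sum.mono_neutral_cong_left)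
        (auto simp: e_neg e_def esym_int_def coeffE nat_diff_distrib)
    also have "\<dots> = (\<Sum>j\<le>k. coeff Q j * e (int r - int j))"
      by (rule sum.mono_neutral_right) (auto simp: degQ coeff_eq_0)
    finally show ?thesis by simp
  qed
  define g where "g = (\<lambda>m. u powi (m div int N) * e (m mod int N))"
  have quasi: "g (m + int N) = u * g m" for m
    using u N by (simp add: g_def power_int_add)
  have quasi': "g (m + int N * a) = u powi a * g m" for m a
  proof -
    have "(m + int N * a) div int N = m div int N + a" "(m + int N * a) mod int N = m mod int N"
      using N by (simp_all add: div_mult_self2)
    then show ?thesis using u by (simp add: g_def power_int_add)
  qed
  have g_small: "g m = e m" if "0 \<le> m" "m < int N" for m
    using that by (simp add: g_def div_pos_pos_trivial mod_pos_pos_trivial)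
  have g_minus: "u * g m = e (m + int N)" if "- int N \<le> m" "m < 0" for m
    using quasi[of m] g_small[of "m + int N"] that by simp
  have rec0: "(\<Sum>j\<le>k. coeff Q j * g (int r - int j)) = 0" if r: "r < N" for r
  proof -
    \<comment> \<open>One of the two terms on the right is always 0: for \<open>j <= r\<close> the
      second index exceeds \<open>n\<close>, for \<open>j > r\<close> the first is negative. So the
      recurrence for \<open>g\<close> is the sum of two convolutions, which give u times the
      coefficient of \<open>p\<close> in degree r plus that in degree r + N; for r = 0 these cancel,
      otherwise both are 0.\<close>
    have *: "u * g (int r - int j) = u * e (int r - int j) + e (int r - int j + int N)" if j: "j \<le> k" for j
    proof (cases "j \<le> r")
      case True
      then show ?thesis using r j k by (subst g_small) (auto simp: e_big N_def)
    next
      case False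
      then show ?thesis using r j by (subst g_minus) (auto simp: e_neg N_def)
    qed
    have "u * (\<Sum>j\<le>k. coeff Q j * g (int r - int j)) =
        (\<Sum>j\<le>k. u * (coeff Q j * e (int r - int j)) + coeff Q j * e (int (r + N) - int j))"
      unfolding sum_distrib_left
    proof (rule sum.cong[OF refl])
      fix j assume "j \<in> {..k}"
      then have "u * g (int r - int j) = u * e (int r - int j) + e (int (r + N) - int j)"
        using * by (simp add: add.commute add_diff_eq)
      then show "u * (coeff Q j * g (int r - int j)) =
          u * (coeff Q j * e (int r - int j)) + coeff Q j * e (int (r + N) - int j)"
        by (simp only: mult.left_commute[of u] distrib_left)
    qed
    also have "\<dots> = u * coeff p r + coeff p (r + N)"
      unfolding sum.distrib sum_distrib_left[symmetric] conv ..
    also have "\<dots> = 0" using r N by (simp add: coeffp)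
    finally show ?thesis using u by simp
  qed
  have "quasiperiodic g (coeff Q) k n u"
  proof
    fix m
    show "g (m + int (n + k)) = u * g m" using quasi[of m] by (simp add: N_def)
    define r where "r = nat (m mod int N)"
    have r: "r < N" "int r = m mod int N" using N by (auto simp: r_def nat_less_iff)
    have "(\<Sum>j\<le>k. coeff Q j * g (m - int j)) =
        (\<Sum>j\<le>k. u powi (m div int N) * (coeff Q j * g (int r - int j)))"
    proof (rule sum.cong[OF refl])
      fix j
      have "m - int j = (int r - int j) + int N * (m div int N)"
        unfolding r(2) using mult_div_mod_eq[of "int N" m] by linarith
      then show "coeff Q j * g (m - int j) = u powi (m div int N) * (coeff Q j * g (int r - int j))"
        by (simp only: quasi' mult.left_commute)
    qed
    also have "\<dots> = 0" by (simp add: rec0[OF r(1)] flip: sum_distrib_left)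
    finally show "(\<Sum>j\<le>k. coeff Q j * g (m - int j)) = 0" .
    show "g m = 0" if "- int k < m" "m < 0"
    proof -
      have "u * g m = 0" using g_minus[of m] e_big[of "m + int N"] that by (simp add: N_def)
      then show ?thesis using u by simp
    qed
  next
    show "g 0 = 1" using g_small[of 0] N by (simp add: e_def esym_int_def)
  qed (use u Q0 Qk k in auto)
  moreover have "g m = esym n x (nat m)" if "m < int (n + k)" "0 \<le> m" for m
    using g_small[of m] that by (simp add: N_def e_def esym_int_def)
  ultimately show ?thesis by blast
qed

text \<open>The conjugate has parts at most \<open>n - 1\<close>, so every index in the determinant
  is below \<open>n + k\<close>, within the first period, where \<open>g\<close> is given by the
  elementary symmetric functions of \<open>x\<close>.\<close>

lemma (in quasiperiodic) F_box_partition: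
  assumes g: "\<And>m. m < int (n + k) \<Longrightarrow> 0 \<le> m \<Longrightarrow> g m = esym n x (nat m)"
    and \<nu>: "\<nu> \<in> box_partitions (n - 1) k" and n: "n \<ge> 1"
  shows "F (symbol_of k (conjugate \<nu>)) * alt n x (\<lambda>i. n - Suc i) = alt n x (\<lambda>i. \<nu> i + (n - Suc i))"
proof -
  have part: "is_partition \<nu>" and b: "plength \<nu> \<le> n - 1" "\<nu> 0 \<le> k"
    using \<nu> by (auto simp: box_partitions_def)
  have "F (symbol_of k (conjugate \<nu>)) = jt k (esym_int n x) (\<lambda>r. int (conjugate \<nu> r))"
    unfolding F_symbol_of
  proof (rule jt_cong)
    fix i j assume "i < k" "j < k"
    moreover have "conjugate \<nu> i \<le> n - 1"
      using partition_le_0[OF is_partition_conjugate[OF part], of i] b(1)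
      by (simp add: plength_eq_conjugate_0)
    ultimately have "int (conjugate \<nu> i) - int i + int j < int (n + k)" using n by linarith
    then show "gp (int (conjugate \<nu> i) - int i + int j) = esym_int n x (int (conjugate \<nu> i) - int i + int j)"
      using g by (simp add: gp_def esym_int_def)
  qed
  then show ?thesis using dual_jacobi_trudi_partition[OF part, of n k x] b by simp
qed

text \<open>For \<open>s\<close> the shifted parts of \<sigma>, these are the exponentials of the
  components of \<sigma> + \<rho> (\<rho> the Weyl vector) occurring in S. Subtracting the mean puts
  the weight in the sum-zero hyperplane and makes the product 1.\<close>

definition bethe_point :: "nat \<Rightarrow> nat \<Rightarrow> (nat \<Rightarrow> int) \<Rightarrow> nat \<Rightarrow> complex" where
  "bethe_point n N s i = cis (- (2 * pi / real N) * (of_int (s i) - of_int (\<Sum>j<n. s j) / real n))"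

text \<open>The integer \<open>s i\<close> contributes a multiple of 2 pi, so only the common mean
  is left and the power is the same for all \<open>i\<close>.\<close>

lemma bethe_point_power:
  assumes "N > 0"
  shows "bethe_point n N s i ^ N = cis (2 * pi * of_int (\<Sum>j<n. s j) / real n)"
proof -
  have "real N * (- (2 * pi / real N) * (of_int (s i) - of_int (\<Sum>j<n. s j) / real n)) =
      2 * pi * of_int (\<Sum>j<n. s j) / real n + 2 * pi * of_int (- s i)"
    using assms by (simp add: field_simps)
  then have "bethe_point n N s i ^ N = cis (2 * pi * of_int (\<Sum>j<n. s j) / real n + 2 * pi * of_int (- s i))"
    by (simp only: bethe_point_def DeMoivre)
  also have "\<dots> = cis (2 * pi * of_int (\<Sum>j<n. s j) / real n) * cis (2 * pi * of_int (- s i))"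
    by (rule cis_mult[symmetric])
  also have "cis (2 * pi * of_int (- s i)) = 1" by (rule cis_multiple_2pi) simp
  finally show ?thesis by simp
qed

lemma sum_centered:
  assumes "n > 0"
  shows "(\<Sum>i<n. of_int (s i) - of_int (\<Sum>j<n. s j) / real n) = 0"
  using assms by (simp add: sum_subtractf)

lemma prod_bethe_point:
  assumes "n > 0"
  shows "(\<Prod>i<n. bethe_point n N s i) = 1"
  unfolding bethe_point_def prod_cis sum_distrib_left[symmetric] sum_centered[OF assms] by simp

lemma inj_on_bethe_point:
  assumes "inj_on s {..<n}" "\<And>i. i < n \<Longrightarrow> 0 \<le> s i" "\<And>i. i < n \<Longrightarrow> s i < int N"
  shows "inj_on (bethe_point n N s) {..<n}"
proof (rule inj_onI)
  fix i j assume ij: "i \<in> {..<n}" "j \<in> {..<n}" and eq: "bethe_point n N s i = bethe_point n N s j"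
  have N: "N > 0" using assms(2,3)[of i] ij by auto
  have "cis (- (2 * pi / real N) * (of_int (s i) - of_int (s j))) = bethe_point n N s i / bethe_point n N s j"
    unfolding bethe_point_def cis_divide right_diff_distrib[symmetric] by simp
  also have "\<dots> = 1" using eq by (simp add: bethe_point_def)
  finally obtain m :: int where "- (2 * pi / real N) * (of_int (s i) - of_int (s j)) = 2 * pi * of_int m"
    using cis_eq_1_imp_int by blast
  then have "2 * pi * (- ((of_int (s i) - of_int (s j)) / real N)) = 2 * pi * of_int m" by simp
  then have "- ((of_int (s i) - of_int (s j)) / real N) = of_int m"
    by (subst (asm) mult_left_cancel) simp_all
  then have "- (of_int (s i) - of_int (s j)) = real N * of_int m" using N by (simp add: field_simps)
  then have "real_of_int (s j - s i) = real_of_int (int N * m)" by simp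
  then have "s j - s i = int N * m" by (simp only: of_int_eq_iff)
  moreover have "\<bar>s j - s i\<bar> < int N" using assms(2,3)[of i] assms(2,3)[of j] ij by auto
  ultimately have "\<bar>int N * m\<bar> < int N" by simp
  then have "m = 0" using N by (simp add: abs_mult)
  then have "s i = s j" using \<open>s j - s i = int N * m\<close> by simp
  then show "i = j" using assms(1) ij by (auto dest: inj_onD)
qed

section \<open>S-matrix entries as alternants\<close>

definition shifted :: "nat \<Rightarrow> (nat \<Rightarrow> nat) \<Rightarrow> nat \<Rightarrow> nat" where
  "shifted n \<alpha> i = \<alpha> i + (n - Suc i)"

definition S_prefactor :: "nat \<Rightarrow> nat \<Rightarrow> complex" where
  "S_prefactor n k = exp (\<i> * of_real (pi * real n * (real n - 1) / 4)) /
       of_real (sqrt (real n * real (k + n) ^ (n - 1)))"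

lemma alt_eq_sum_transposed:
  "alt q z e = (\<Sum>p | p permutes {..<q}. of_int (sign p) * (\<Prod>i<q. z i ^ e (p i)))"
proof -
  have "alt q z e = (\<Sum>p | p permutes {0..<q}. of_int (sign p) * (\<Prod>j<q. mat q q (\<lambda>(i, j). z j ^ e i) $$ (p j, j)))"
    unfolding alt_eq_det by (rule det_col) simp
  also have "\<dots> = (\<Sum>p | p permutes {..<q}. of_int (sign p) * (\<Prod>i<q. z i ^ e (p i)))"
  proof (rule sum.cong)
    fix p assume "p \<in> {p. p permutes {..<q}}"
    then have "\<And>i. i < q \<Longrightarrow> p i < q" using permutes_in_image[of p "{..<q}"] by simp
    then show "of_int (sign p) * (\<Prod>j<q. mat q q (\<lambda>(i, j). z j ^ e i) $$ (p j, j)) =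
        of_int (sign p) * (\<Prod>i<q. z i ^ e (p i))"
      by (intro arg_cong[of _ _ "\<lambda>x. _ * x"] prod.cong) auto
  qed (simp add: atLeast0LessThan)
  finally show ?thesis .
qed

text \<open>Centering removes additive constants, so the possibly half-integral Weyl vector may be
  traded for the integral staircase n - 1, ..., 0.\<close>

lemma finite_weight_plus_weyl_vector:
  assumes "i < n"
  shows "finite_weight n \<alpha> i + weyl_vector n i =
    of_int (int (shifted n \<alpha> i)) - of_int (\<Sum>j<n. int (shifted n \<alpha> j)) / real n"
proof -
  have "(\<Sum>j<n. real (n - Suc j)) = (\<Sum>j<n. real j)"
    by (rule sum.nat_diff_reindex)
  also have "\<dots> = real n * (real n - 1) / 2"
    by (induction n) (simp_all add: field_simps)
  finally have S: "(\<Sum>j<n. real (shifted n \<alpha> j)) = (\<Sum>j<n. real (\<alpha> j)) + real n * (real n - 1) / 2"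
    by (simp only: shifted_def of_nat_add sum.distrib)
  have "(\<Sum>j<n. real (shifted n \<alpha> j)) / real n = (\<Sum>j<n. real (\<alpha> j)) / real n + (real n - 1) / 2"
    unfolding S using assms by (simp add: add_divide_distrib)
  moreover have "real (shifted n \<alpha> i) = real (\<alpha> i) + (real n - 1 - real i)"
    using assms by (simp add: shifted_def of_nat_diff)
  ultimately show ?thesis
    by (simp add: finite_weight_def weyl_vector_def diff_divide_distrib)
qed

text \<open>The centered coordinates of \<sigma> sum to 0, so the centering of \<alpha> drops out of
  the inner product and integral powers of the points remain.\<close>

lemma S_matrix_eq_alt:
  assumes "n > 0"
  shows "S_matrix n k \<alpha> \<sigma> =
    S_prefactor n k * alt n (bethe_point n (n + k) (\<lambda>i. int (shifted n \<sigma> i))) (shifted n \<alpha>)"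
proof -
  let ?s = "\<lambda>i. int (shifted n \<sigma> i)" and ?l = "shifted n \<alpha>"
  let ?X = "\<lambda>i. of_int (?s i) - of_int (\<Sum>j<n. ?s j) / real n"
  have R: "a * (b - c) = b * a - c * a" for a b c :: real by (simp add: algebra_simps)
  have "exp (- (2 * of_real pi * \<i> / of_nat (k + n)) *
             of_real (\<Sum>i<n. (finite_weight n \<sigma> i + weyl_vector n i) *
                              (finite_weight n \<alpha> (w i) + weyl_vector n (w i)))) =
      (\<Prod>i<n. bethe_point n (n + k) ?s i ^ ?l (w i))" if w: "w permutes {..<n}" for w
  proof -
    have wi: "w i < n" if "i < n" for i using permutes_in_image[OF w, of i] that by simp
    let ?c = "of_int (\<Sum>j<n. int (?l j)) / real n"
    have "(\<Sum>i<n. (finite_weight n \<sigma> i + weyl_vector n i) * (finite_weight n \<alpha> (w i) + weyl_vector n (w i))) =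
        (\<Sum>i<n. real (?l (w i)) * ?X i - ?c * ?X i)"
    proof (rule sum.cong[OF refl])
      fix i assume "i \<in> {..<n}"
      then have i: "i < n" by simp
      show "(finite_weight n \<sigma> i + weyl_vector n i) * (finite_weight n \<alpha> (w i) + weyl_vector n (w i)) =
          real (?l (w i)) * ?X i - ?c * ?X i"
        unfolding finite_weight_plus_weyl_vector[OF i] finite_weight_plus_weyl_vector[OF wi[OF i]]
        by (simp only: of_int_of_nat_eq R)
    qed
    also have "\<dots> = (\<Sum>i<n. real (?l (w i)) * ?X i)"
      unfolding sum_subtractf sum_distrib_left[symmetric] sum_centered[OF assms] by simp
    finally have sum: "(\<Sum>i<n. (finite_weight n \<sigma> i + weyl_vector n i) *
        (finite_weight n \<alpha> (w i) + weyl_vector n (w i))) = (\<Sum>i<n. real (?l (w i)) * ?X i)" .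
    have "(\<Prod>i<n. bethe_point n (n + k) ?s i ^ ?l (w i)) =
        cis (\<Sum>i<n. real (?l (w i)) * (- (2 * pi / real (n + k)) * ?X i))"
      unfolding bethe_point_def DeMoivre prod_cis ..
    also have "(\<Sum>i<n. real (?l (w i)) * (- (2 * pi / real (n + k)) * ?X i)) =
        - (2 * pi / real (n + k)) * (\<Sum>i<n. real (?l (w i)) * ?X i)"
      unfolding sum_distrib_left by (simp only: mult.left_commute)
    also have "cis \<dots> = exp (\<i> * of_real (- (2 * pi / real (n + k)) * (\<Sum>i<n. real (?l (w i)) * ?X i)))"
      by (rule cis_conv_exp)
    also have "\<i> * of_real (- (2 * pi / real (n + k)) * (\<Sum>i<n. real (?l (w i)) * ?X i)) =
        - (2 * of_real pi * \<i> / of_nat (k + n)) * of_real (\<Sum>i<n. real (?l (w i)) * ?X i)"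
      by (simp only: of_real_mult of_real_minus of_real_divide of_real_numeral of_real_of_nat_eq add.commute[of k])
        (simp add: field_simps)
    finally show ?thesis unfolding sum by simp
  qed
  then show ?thesis
    unfolding S_matrix_def S_prefactor_def alt_eq_sum_transposed
    by (intro arg_cong[of _ _ "\<lambda>x. _ * x"] sum.cong) simp_all
qed

subsection \<open>Unitarity\<close>

lemma box_partitions_iff:
  "\<sigma> \<in> box_partitions h w \<longleftrightarrow> antimono \<sigma> \<and> (\<forall>i\<ge>h. \<sigma> i = 0) \<and> \<sigma> 0 \<le> w"
proof
  assume "\<sigma> \<in> box_partitions h w"
  then have *: "is_partition \<sigma>" "plength \<sigma> \<le> h" "\<sigma> 0 \<le> w" by (auto simp: box_partitions_def)
  then have "\<sigma> i = 0" if "i \<ge> h" for i using less_plength_iff[of \<sigma> i] that by auto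
  then show "antimono \<sigma> \<and> (\<forall>i\<ge>h. \<sigma> i = 0) \<and> \<sigma> 0 \<le> w" using * by (simp add: is_partition_def)
next
  assume *: "antimono \<sigma> \<and> (\<forall>i\<ge>h. \<sigma> i = 0) \<and> \<sigma> 0 \<le> w"
  have "{i. \<sigma> i \<noteq> 0} \<subseteq> {..<h}"
  proof
    fix i assume "i \<in> {i. \<sigma> i \<noteq> 0}"
    then show "i \<in> {..<h}" using * by (cases "i < h") auto
  qed
  then have "is_partition \<sigma>" "plength \<sigma> \<le> h"
    using * finite_subset card_mono[of "{..<h}"] by (auto simp: is_partition_def plength_def)
  then show "\<sigma> \<in> box_partitions h w" using * by (simp add: box_partitions_def)
qed

lemma finite_box_partitions: "finite (box_partitions h w)"
proof -
  have "box_partitions h w \<subseteq> {\<sigma>. \<forall>i. (i \<in> {..<h} \<longrightarrow> \<sigma> i \<in> {..w}) \<and> (i \<notin> {..<h} \<longrightarrow> \<sigma> i = 0)}"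
  proof
    fix \<sigma> assume s: "\<sigma> \<in> box_partitions h w"
    then have "is_partition \<sigma>" by (simp add: box_partitions_def)
    then have "\<sigma> i \<le> w" for i using partition_le_0[of \<sigma> i] s by (simp add: box_partitions_def)
    then show "\<sigma> \<in> {\<sigma>. \<forall>i. (i \<in> {..<h} \<longrightarrow> \<sigma> i \<in> {..w}) \<and> (i \<notin> {..<h} \<longrightarrow> \<sigma> i = 0)}"
      using s by (auto simp: box_partitions_iff)
  qed
  moreover have "finite {\<sigma>. \<forall>i. (i \<in> {..<h} \<longrightarrow> \<sigma> i \<in> {..w}) \<and> (i \<notin> {..<h} \<longrightarrow> \<sigma> i = (0::nat))}"
    by (rule finite_set_of_finite_funs) auto
  ultimately show ?thesis by (rule finite_subset)
qed

section \<open>Symmetries of the summand of the unitarity relation\<close>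

lemma alt_cong:
  assumes "\<And>i. i < q \<Longrightarrow> z i = z' i" "\<And>i. i < q \<Longrightarrow> e i = e' i"
  shows "alt q z e = alt q z' e'"
  unfolding alt_eq_det by (rule arg_cong[of _ _ det], rule cong_mat) (use assms in auto)

lemma alt_permute:
  assumes "p permutes {..<q}"
  shows "alt q (\<lambda>i. z (p i)) e = of_int (sign p) * alt q z e"
proof -
  have t: "alt q y e = det (mat q q (\<lambda>(i, j). y i ^ e j))" for y :: "nat \<Rightarrow> 'a"
  proof -
    have "det (mat q q (\<lambda>(i, j). y j ^ e i)) = det (transpose_mat (mat q q (\<lambda>(i, j). y j ^ e i)))"
      by (rule det_transpose[where n = q, symmetric]) simp
    also have "transpose_mat (mat q q (\<lambda>(i, j). y j ^ e i)) = mat q q (\<lambda>(i, j). y i ^ e j)"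
      by (rule eq_matI) auto
    finally show ?thesis unfolding alt_eq_det .
  qed
  have p: "p permutes {0..<q}" using assms by (simp add: atLeast0LessThan)
  have "mat q q (\<lambda>(i, j). z (p i) ^ e j) = mat q q (\<lambda>(i, j). mat q q (\<lambda>(i, j). z i ^ e j) $$ (p i, j))"
    by (rule cong_mat) (use permutes_in_image[OF p] in auto)
  then show ?thesis unfolding t by (simp add: det_permute_rows[OF _ p])
qed

lemma alt_scale: "alt q (\<lambda>i. a * z i) e = a ^ (\<Sum>i<q. e i) * alt q z e"
  unfolding alt_def sum_distrib_left
  by (rule sum.cong[OF refl]) (simp add: power_mult_distrib prod.distrib power_sum mult_ac)

lemma alt_eq_0_variables:
  assumes "i < q" "j < q" "i \<noteq> j" "z i = z j"
  shows "alt q z e = 0"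
  unfolding alt_eq_det
  by (rule det_identical_columns[of _ q i j]) (use assms in \<open>auto intro!: eq_vecI\<close>)

text \<open>Up to the squared prefactor, the summand of the unitarity relation for \<open>S\<close>.\<close>

definition alt_pairing :: "nat \<Rightarrow> nat \<Rightarrow> (nat \<Rightarrow> nat) \<Rightarrow> (nat \<Rightarrow> nat) \<Rightarrow> (nat \<Rightarrow> int) \<Rightarrow> complex" where
  "alt_pairing n N l m s = alt n (bethe_point n N s) l * cnj (alt n (bethe_point n N s) m)"

lemma bethe_point_cong:
  assumes "\<And>i. i < n \<Longrightarrow> s i = s' i" "i < n"
  shows "bethe_point n N s i = bethe_point n N s' i"
  using assms by (simp add: bethe_point_def)

lemma alt_pairing_cong:
  assumes "\<And>i. i < n \<Longrightarrow> s i = s' i"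
  shows "alt_pairing n N l m s = alt_pairing n N l m s'"
proof -
  have "alt n (bethe_point n N s) e = alt n (bethe_point n N s') e" for e
    by (rule alt_cong) (use bethe_point_cong[OF assms] in auto)
  then show ?thesis by (simp add: alt_pairing_def)
qed

lemma alt_pairing_permute:
  assumes p: "p permutes {..<n}"
  shows "alt_pairing n N l m (\<lambda>i. s (p i)) = alt_pairing n N l m s"
proof -
  have "(\<Sum>j<n. s (p j)) = (\<Sum>j<n. s j)" using sum.permute[OF p, of s] by (simp add: comp_def)
  then have "bethe_point n N (\<lambda>i. s (p i)) = (\<lambda>i. bethe_point n N s (p i))"
    by (simp add: bethe_point_def fun_eq_iff)
  then show ?thesis
    unfolding alt_pairing_def by (simp add: alt_permute[OF p] sign_def)
qed

lemma alt_pairing_shift: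
  assumes "n > 0"
  shows "alt_pairing n N l m (\<lambda>i. s i + a) = alt_pairing n N l m s"
proof -
  have "bethe_point n N (\<lambda>i. s i + a) = bethe_point n N s"
    using assms by (simp add: bethe_point_def fun_eq_iff sum.distrib add_divide_distrib)
  then show ?thesis by (simp add: alt_pairing_def)
qed

text \<open>Raising one coordinate by \<open>N\<close> raises the mean by N/n, which multiplies
  every point by the same n-th root of unity; the change of the coordinate itself is a full turn.
  The factor follows because alternants are homogeneous.\<close>

lemma alt_pairing_add_period:
  assumes "i0 < n" "N > 0"
  shows "alt_pairing n N l m (s(i0 := s i0 + int N)) =
    cis (2 * pi * (real (\<Sum>i<n. l i) - real (\<Sum>i<n. m i)) / real n) * alt_pairing n N l m s"
proof -
  let ?s = "s(i0 := s i0 + int N)" and ?c = "cis (2 * pi / real n)"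
  have "(\<Sum>j<n. ?s j) = (\<Sum>j<n. s j + (if j = i0 then int N else 0))"
    by (rule sum.cong) auto
  then have S: "(\<Sum>j<n. ?s j) = (\<Sum>j<n. s j) + int N" using assms by (simp add: sum.distrib)
  have b: "bethe_point n N ?s i = ?c * bethe_point n N s i" for i
  proof -
    let ?e = "if i = i0 then 1 else 0 :: int"
    have "- (2 * pi / real N) * (of_int (?s i) - of_int (\<Sum>j<n. ?s j) / real n) =
        2 * pi / real n + - (2 * pi / real N) * (of_int (s i) - of_int (\<Sum>j<n. s j) / real n) + 2 * pi * of_int (- ?e)"
      unfolding S using assms by (auto simp: field_simps)
    then have "bethe_point n N ?s i = ?c * bethe_point n N s i * cis (2 * pi * of_int (- ?e))"
      unfolding bethe_point_def by (simp only: cis_mult)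
    also have "cis (2 * pi * of_int (- ?e)) = 1" by (rule cis_multiple_2pi) simp
    finally show ?thesis by (simp only: mult_1_right)
  qed
  have alt: "alt n (bethe_point n N ?s) e = ?c ^ (\<Sum>i<n. e i) * alt n (bethe_point n N s) e" for e
    unfolding alt_scale[symmetric] b ..
  have "?c ^ (\<Sum>i<n. l i) * cnj (?c ^ (\<Sum>i<n. m i)) =
      cis (2 * pi * (real (\<Sum>i<n. l i) - real (\<Sum>i<n. m i)) / real n)"
    unfolding DeMoivre cis_cnj cis_mult by (rule arg_cong[of _ _ cis]) (simp add: algebra_simps diff_divide_distrib)
  then show ?thesis
    unfolding alt_pairing_def alt complex_cnj_mult by (simp only: mult_ac)
qed

text \<open>The rotation of the affine Dynkin diagram: it permutes the box and multiplies each summand by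
  the same root of unity, so the sum vanishes unless that root is 1.\<close>

definition rotate_box :: "nat \<Rightarrow> nat \<Rightarrow> (nat \<Rightarrow> nat) \<Rightarrow> nat \<Rightarrow> nat" where
  "rotate_box n k \<sigma> i = (case i of 0 \<Rightarrow> k - \<sigma> (n - 2) | Suc j \<Rightarrow> \<sigma> j - \<sigma> (n - 2))"

lemma rotate_box_in_box:
  assumes "\<sigma> \<in> box_partitions (n - 1) k" "n \<ge> 2"
  shows "rotate_box n k \<sigma> \<in> box_partitions (n - 1) k"
proof -
  have s: "antimono \<sigma>" "\<And>i. i \<ge> n - 1 \<Longrightarrow> \<sigma> i = 0" "\<sigma> 0 \<le> k"
    using assms by (auto simp: box_partitions_iff)
  have le: "\<sigma> j \<le> \<sigma> i" if "i \<le> j" for i j using antimonoD[OF s(1) that] .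
  have "antimono (rotate_box n k \<sigma>)"
  proof (rule decseq_SucI)
    fix i show "rotate_box n k \<sigma> (Suc i) \<le> rotate_box n k \<sigma> i"
      using s(3) le[of "i - 1" i] by (cases i) (auto simp: rotate_box_def intro: diff_le_mono)
  qed
  moreover have "rotate_box n k \<sigma> i = 0" if "i \<ge> n - 1" for i
    using that assms(2) le[of "n - 2" "i - 1"] by (cases i) (auto simp: rotate_box_def)
  ultimately show ?thesis by (auto simp: box_partitions_iff rotate_box_def)
qed

lemma inj_on_rotate_box:
  assumes "n \<ge> 2"
  shows "inj_on (rotate_box n k) (box_partitions (n - 1) k)"
proof (rule inj_onI)
  fix \<sigma> \<tau> assume s: "\<sigma> \<in> box_partitions (n - 1) k" and t: "\<tau> \<in> box_partitions (n - 1) k"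
    and eq: "rotate_box n k \<sigma> = rotate_box n k \<tau>"
  have a: "antimono \<sigma>" "\<And>i. i \<ge> n - 1 \<Longrightarrow> \<sigma> i = 0" "\<sigma> 0 \<le> k"
    and b: "antimono \<tau>" "\<And>i. i \<ge> n - 1 \<Longrightarrow> \<tau> i = 0" "\<tau> 0 \<le> k"
    using s t by (auto simp: box_partitions_iff)
  have "\<sigma> (n - 2) \<le> k" "\<tau> (n - 2) \<le> k"
    using antimonoD[OF a(1), of 0 "n - 2"] antimonoD[OF b(1), of 0 "n - 2"] a(3) b(3) by auto
  then have e0: "\<sigma> (n - 2) = \<tau> (n - 2)" using fun_cong[OF eq, of 0] by (simp add: rotate_box_def)
  show "\<sigma> = \<tau>"
  proof
    fix i show "\<sigma> i = \<tau> i"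
    proof (cases "i \<ge> n - 1")
      case True
      then show ?thesis using a(2) b(2) by simp
    next
      case False
      then have "\<sigma> (n - 2) \<le> \<sigma> i" "\<tau> (n - 2) \<le> \<tau> i"
        using antimonoD[OF a(1), of i "n - 2"] antimonoD[OF b(1), of i "n - 2"] by auto
      then show ?thesis using fun_cong[OF eq, of "Suc i"] e0 by (simp add: rotate_box_def)
    qed
  qed
qed

text \<open>In shifted coordinates the rotation raises the last entry, which is 0, by
  \<open>n + k\<close>, moves it to the front, and translates all entries so that the last is 0
  again. Only the first of these operations affects the pairing.\<close>

lemma alt_pairing_rotate_box:
  assumes "\<sigma> \<in> box_partitions (n - 1) k" "n \<ge> 2"
  shows "alt_pairing n (n + k) l m (\<lambda>i. int (shifted n (rotate_box n k \<sigma>) i)) =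
    cis (2 * pi * (real (\<Sum>i<n. l i) - real (\<Sum>i<n. m i)) / real n) *
    alt_pairing n (n + k) l m (\<lambda>i. int (shifted n \<sigma> i))"
proof -
  let ?s = "\<lambda>i. int (shifted n \<sigma> i)"
  let ?t = "?s(n - 1 := ?s (n - 1) + int (n + k))"
  define p where "p = (\<lambda>i. if i < n then (if i = 0 then n - 1 else i - 1) else i)"
  have "bij_betw p {..<n} {..<n}"
    by (rule bij_betwI[where g = "\<lambda>i. if i = n - 1 then 0 else Suc i"]) (use assms(2) in \<open>auto simp: p_def\<close>)
  then have p: "p permutes {..<n}" by (rule bij_imp_permutes) (auto simp: p_def)
  have s: "antimono \<sigma>" "\<And>i. i \<ge> n - 1 \<Longrightarrow> \<sigma> i = 0" "\<sigma> 0 \<le> k"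
    using assms by (auto simp: box_partitions_iff)
  have le: "\<sigma> (n - 2) \<le> \<sigma> i" if "i \<le> n - 2" for i using antimonoD[OF s(1) that] .
  have "alt_pairing n (n + k) l m (\<lambda>i. int (shifted n (rotate_box n k \<sigma>) i)) =
      alt_pairing n (n + k) l m (\<lambda>i. ?t (p i) + - ?s (n - 2))"
  proof (rule alt_pairing_cong)
    fix i assume i: "i < n"
    show "int (shifted n (rotate_box n k \<sigma>) i) = ?t (p i) + - ?s (n - 2)"
    proof (cases i)
      case 0
      have "\<sigma> (n - 2) \<le> k" using le[of 0] s(3) by simp
      then show ?thesis using 0 i assms(2) s(2)[of "n - 1"]
        by (simp add: p_def shifted_def rotate_box_def of_nat_diff)
    next
      case (Suc j)
      then have "(\<sigma> j - \<sigma> (n - 2) + (n - Suc (Suc j))) + (\<sigma> (n - 2) + 1) = \<sigma> j + (n - Suc j)"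
        using i le[of j] by linarith
      then have "int (\<sigma> j - \<sigma> (n - 2) + (n - Suc (Suc j))) = int (\<sigma> j + (n - Suc j)) - int (\<sigma> (n - 2) + 1)"
        by linarith
      moreover have "shifted n (rotate_box n k \<sigma>) i = \<sigma> j - \<sigma> (n - 2) + (n - Suc (Suc j))"
        by (simp add: shifted_def rotate_box_def Suc)
      moreover have "p i = j" "j \<noteq> n - 1" using Suc i by (auto simp: p_def)
      then have "?t (p i) = int (\<sigma> j + (n - Suc j))" by (simp add: shifted_def)
      moreover have "n - Suc (n - 2) = 1" using assms(2) by linarith
      then have "?s (n - 2) = int (\<sigma> (n - 2) + 1)" by (simp add: shifted_def)
      ultimately show ?thesis by linarith
    qed
  qed
  also have "\<dots> = alt_pairing n (n + k) l m (\<lambda>i. ?t (p i))"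
    using assms(2) by (intro alt_pairing_shift) simp
  also have "\<dots> = alt_pairing n (n + k) l m ?t" by (rule alt_pairing_permute[OF p])
  finally show ?thesis using alt_pairing_add_period[of "n - 1" n "n + k" l m ?s] assms(2) by simp
qed

lemma sum_alt_pairing_eq_0:
  assumes "n \<ge> 2" "\<not> int n dvd int (\<Sum>i<n. l i) - int (\<Sum>i<n. m i)"
  shows "(\<Sum>\<sigma>\<in>box_partitions (n - 1) k. alt_pairing n (n + k) l m (\<lambda>i. int (shifted n \<sigma> i))) = 0"
    (is "?B = 0")
proof -
  let ?c = "cis (2 * pi * (real (\<Sum>i<n. l i) - real (\<Sum>i<n. m i)) / real n)"
  let ?box = "box_partitions (n - 1) k"
  have "rotate_box n k ` ?box = ?box"
    by (rule endo_inj_surj[OF finite_box_partitions _ inj_on_rotate_box[OF assms(1)]])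
      (use rotate_box_in_box assms(1) in auto)
  then have "?B = (\<Sum>\<sigma>\<in>rotate_box n k ` ?box. alt_pairing n (n + k) l m (\<lambda>i. int (shifted n \<sigma> i)))"
    by simp
  also have "\<dots> = (\<Sum>\<sigma>\<in>?box. ?c * alt_pairing n (n + k) l m (\<lambda>i. int (shifted n \<sigma> i)))"
    unfolding sum.reindex[OF inj_on_rotate_box[OF assms(1)]] comp_def
    by (rule sum.cong[OF refl], rule alt_pairing_rotate_box[OF _ assms(1)])
  also have "\<dots> = ?c * ?B" by (rule sum_distrib_left[symmetric])
  finally have "(?c - 1) * ?B = 0" by (simp add: left_diff_distrib)
  moreover have "?c \<noteq> 1"
  proof
    assume "?c = 1"
    then obtain a :: int where "2 * pi * (real (\<Sum>i<n. l i) - real (\<Sum>i<n. m i)) / real n = 2 * pi * of_int a"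
      using cis_eq_1_imp_int by blast
    then have "2 * pi * ((real (\<Sum>i<n. l i) - real (\<Sum>i<n. m i)) / real n) = 2 * pi * of_int a" by simp
    then have "(real (\<Sum>i<n. l i) - real (\<Sum>i<n. m i)) / real n = of_int a"
      by (subst (asm) mult_left_cancel) simp_all
    then have "real (\<Sum>i<n. l i) - real (\<Sum>i<n. m i) = real n * of_int a"
      using assms(1) by (simp add: field_simps)
    then have "real_of_int (int (\<Sum>i<n. l i) - int (\<Sum>i<n. m i)) = real_of_int (int n * a)" by simp
    then have "int (\<Sum>i<n. l i) - int (\<Sum>i<n. m i) = int n * a" by (simp only: of_int_eq_iff)
    then show False using assms(2) by simp
  qed
  ultimately show ?thesis by simp
qed

section \<open>Orthogonality over integer tuples\<close>

lemma sum_roots_of_unity: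
  assumes "N > 0"
  shows "(\<Sum>a<N. cis (- (2 * pi / real N) * (real a * of_int D))) = (if int N dvd D then of_nat N else 0)"
proof -
  define \<omega> where "\<omega> = cis (- (2 * pi / real N) * of_int D)"
  have "cis (- (2 * pi / real N) * (real a * of_int D)) = \<omega> ^ a" for a
    unfolding \<omega>_def DeMoivre by (simp only: mult.left_commute)
  then have sum: "(\<Sum>a<N. cis (- (2 * pi / real N) * (real a * of_int D))) = (\<Sum>a<N. \<omega> ^ a)" by simp
  show ?thesis
  proof (cases "int N dvd D")
    case True
    then obtain b where b: "D = int N * b" by (elim dvdE)
    have "- (2 * pi / real N) * of_int D = 2 * pi * of_int (- b)" using assms by (simp add: b field_simps)
    then have "\<omega> = cis (2 * pi * of_int (- b))" by (simp only: \<omega>_def)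
    also have "\<dots> = 1" by (rule cis_multiple_2pi) simp
    finally show ?thesis using sum True by simp
  next
    case False
    have "\<omega> \<noteq> 1"
    proof
      assume "\<omega> = 1"
      then obtain b :: int where "- (2 * pi / real N) * of_int D = 2 * pi * of_int b"
        unfolding \<omega>_def using cis_eq_1_imp_int by blast
      then have "2 * pi * (- (of_int D / real N)) = 2 * pi * of_int b" by simp
      then have "- (of_int D / real N) = of_int b" by (subst (asm) mult_left_cancel) simp_all
      then have "of_int D = real N * of_int (- b)" using assms by (simp add: field_simps)
      then have "real_of_int D = real_of_int (int N * - b)" by simp
      then have "D = int N * - b" by (simp only: of_int_eq_iff)
      then show False using False by simp
    qed
    moreover have "\<omega> ^ N = 1"
    proof -
      have "\<omega> ^ N = cis (2 * pi * of_int (- D))"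
        unfolding \<omega>_def DeMoivre by (rule arg_cong[of _ _ cis]) (use assms in simp)
      also have "\<dots> = 1" by (rule cis_multiple_2pi) simp
      finally show ?thesis .
    qed
    ultimately show ?thesis using sum False by (simp add: geometric_sum)
  qed
qed

text \<open>The differences \<open>l (w i) - m (w' i) - r\<close> sum to 0, and by the bounds on \<open>l\<close> and \<open>m\<close> a multiple
  of \<open>N\<close> among them can only have the sign opposite to that of \<open>r\<close>; hence all of them vanish.\<close>

lemma matching_permutations:
  assumes dec: "decreasing n l" "decreasing n m" and last: "l (n - 1) = 0" "m (n - 1) = 0"
    and less: "\<And>i. i < n \<Longrightarrow> l i < N" "\<And>i. i < n \<Longrightarrow> m i < N" and n: "n \<ge> 1"
    and sum: "int (\<Sum>i<n. l i) - int (\<Sum>i<n. m i) = int n * r"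
    and w: "w permutes {..<n}" "w' permutes {..<n}"
    and dvd: "\<And>i. i < n - 1 \<Longrightarrow> int N dvd int (l (w i)) - int (m (w' i)) - r"
  shows "w = w' \<and> (\<forall>i<n. l i = m i)"
proof -
  define D where "D = (\<lambda>i. int (l (w i)) - int (m (w' i)) - r)"
  have wn: "w i < n \<longleftrightarrow> i < n" "w' i < n \<longleftrightarrow> i < n" for i
    using permutes_in_image[OF w(1), of i] permutes_in_image[OF w(2), of i] by auto
  have "(\<Sum>i<n. l (w i)) = (\<Sum>i<n. l i)" "(\<Sum>i<n. m (w' i)) = (\<Sum>i<n. m i)"
    using sum.permute[OF w(1), of l] sum.permute[OF w(2), of m] by (simp_all add: comp_def)
  moreover have "(\<Sum>i<n. D i) = int (\<Sum>i<n. l (w i)) - int (\<Sum>i<n. m (w' i)) - int n * r"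
    by (simp add: D_def sum_subtractf)
  ultimately have D0: "(\<Sum>i<n. D i) = 0" using sum by simp
  have dvd': "int N dvd D i" if "i < n" for i
  proof (cases "i < n - 1")
    case True
    then show ?thesis using dvd[of i] by (simp add: D_def)
  next
    case False
    then have i: "i = n - 1" using that by simp
    have "{..<n} = insert (n - 1) {..<n - 1}" using n by auto
    then have "D (n - 1) = - (\<Sum>i<n - 1. D i)" using D0 by simp
    moreover have "int N dvd (\<Sum>i<n - 1. D i)" by (rule dvd_sum) (use dvd in \<open>auto simp: D_def\<close>)
    ultimately show ?thesis using i by simp
  qed
  have D: "D i = 0" if "i < n" for i
  proof (cases "r \<ge> 0")
    case True
    have "0 \<le> - D j" if j: "j < n" for j
    proof (rule ccontr)
      assume "\<not> 0 \<le> - D j"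
      then have "int N \<le> D j" using zdvd_imp_le[OF dvd'[OF j]] by simp
      moreover have "D j < int N" using True less(1)[of "w j"] wn j by (simp add: D_def)
      ultimately show False by simp
    qed
    then have "\<forall>j\<in>{..<n}. - D j = 0"
      using D0 sum_nonneg_eq_0_iff[of "{..<n}" "\<lambda>j. - D j"] by (simp add: sum_negf)
    then show ?thesis using that by simp
  next
    case False
    have "0 \<le> D j" if j: "j < n" for j
    proof (rule ccontr)
      assume "\<not> 0 \<le> D j"
      then have "int N \<le> - D j" using zdvd_imp_le[of "int N" "- D j"] dvd'[OF j] by simp
      moreover have "- D j < int N" using False less(2)[of "w' j"] wn j by (simp add: D_def)
      ultimately show False by simp
    qed
    then have "\<forall>j\<in>{..<n}. D j = 0"
      using D0 sum_nonneg_eq_0_iff[of "{..<n}" D] by simp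
    then show ?thesis using that by simp
  qed
  obtain i where i: "w i = n - 1" using permutes_surj[OF w(1)] by (metis surjD)
  obtain i' where i': "w' i' = n - 1" using permutes_surj[OF w(2)] by (metis surjD)
  have "i < n" "i' < n" using wn(1)[of i] wn(2)[of i'] i i' n by auto
  then have "r = 0" using D[of i] D[of i'] i i' last by (simp add: D_def)
  then have eq: "l (w i) = m (w' i)" if "i < n" for i using D[OF that] by (simp add: D_def)
  define p where "p = w' \<circ> Hilbert_Choice.inv w"
  have p: "p permutes {..<n}"
    unfolding p_def by (rule permutes_compose[OF permutes_inv[OF w(1)] w(2)])
  have "l j = m (p j)" if "j < n" for j
    using eq[of "Hilbert_Choice.inv w j"] permutes_inverses(1)[OF w(1), of j]
      permutes_in_image[OF permutes_inv[OF w(1)], of j] that by (simp add: p_def)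
  moreover from this have "p = id" by (rule decreasing_permute_eq_id[OF p dec])
  moreover have "w' i = w i" for i
    using fun_cong[OF \<open>p = id\<close>, of "w i"] permutes_inverses(2)[OF w(1), of i] by (simp add: p_def)
  ultimately show ?thesis by (auto simp: fun_eq_iff)
qed

text \<open>Subtracting \<open>r\<close> makes the exponent differences sum to 0, so the mean of
  \<open>s\<close> drops out and only characters of the integers modulo \<open>N\<close> remain.
  This is where divisibility of the difference of sizes by \<open>n\<close> is needed.\<close>

lemma alt_pairing_expand:
  assumes n: "n > 0" and r: "int (\<Sum>i<n. l i) - int (\<Sum>i<n. m i) = int n * r"
  shows "alt_pairing n N l m s = (\<Sum>w | w permutes {..<n}. \<Sum>w' | w' permutes {..<n}.
    of_int (sign w * sign w') *
    (\<Prod>i<n. cis (- (2 * pi / real N) * (of_int (s i) * of_int (int (l (w i)) - int (m (w' i)) - r)))))"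
proof -
  have regroup: "(a - b) * (c - d) = a * (c - d - e) + e * (a - b) - b * (c - d - e)" for a b c d e :: real
    by (simp add: algebra_simps)
  have regroup': "a * (h * x) + b * - (h * x) = h * (x * (a - b))" for a b h x :: real
    by (simp add: algebra_simps)
  let ?z = "bethe_point n N s" and ?X = "\<lambda>i. of_int (s i) - of_int (\<Sum>j<n. s j) / real n"
  have "(\<Prod>i<n. ?z i ^ l (w i)) * (\<Prod>i<n. cnj (?z i) ^ m (w' i)) =
      (\<Prod>i<n. cis (- (2 * pi / real N) * (of_int (s i) * of_int (int (l (w i)) - int (m (w' i)) - r))))"
    if w: "w permutes {..<n}" and w': "w' permutes {..<n}" for w w'
  proof -
    let ?E = "\<lambda>i. of_int (int (l (w i)) - int (m (w' i)) - r) :: real"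
    have "(\<Sum>i<n. l (w i)) = (\<Sum>i<n. l i)" "(\<Sum>i<n. m (w' i)) = (\<Sum>i<n. m i)"
      using sum.permute[OF w, of l] sum.permute[OF w', of m] by (simp_all add: comp_def)
    moreover have "(\<Sum>i<n. int (l (w i)) - int (m (w' i)) - r) =
        int (\<Sum>i<n. l (w i)) - int (\<Sum>i<n. m (w' i)) - int n * r" by (simp add: sum_subtractf)
    ultimately have "(\<Sum>i<n. int (l (w i)) - int (m (w' i)) - r) = 0" using r by simp
    then have E0: "(\<Sum>i<n. ?E i) = 0" by (simp only: of_int_sum[symmetric] of_int_0)
    have "(\<Sum>i<n. ?X i * (real (l (w i)) - real (m (w' i)))) =
        (\<Sum>i<n. (of_int (s i) * ?E i + of_int r * ?X i) - of_int (\<Sum>j<n. s j) / real n * ?E i)"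
      by (rule sum.cong[OF refl], simp only: of_int_diff of_int_of_nat_eq) (rule regroup)
    also have "\<dots> = (\<Sum>i<n. of_int (s i) * ?E i)"
      unfolding sum_subtractf sum.distrib sum_distrib_left[symmetric] E0 sum_centered[OF n] by simp
    finally have key: "(\<Sum>i<n. ?X i * (real (l (w i)) - real (m (w' i)))) = (\<Sum>i<n. of_int (s i) * ?E i)" .
    have "(\<Prod>i<n. ?z i ^ l (w i)) * (\<Prod>i<n. cnj (?z i) ^ m (w' i)) =
        (\<Prod>i<n. cis (- (2 * pi / real N) * (?X i * (real (l (w i)) - real (m (w' i))))))"
      unfolding prod.distrib[symmetric] bethe_point_def cis_cnj DeMoivre cis_mult
      by (intro prod.cong refl arg_cong[of _ _ cis]) (rule regroup')
    also have "\<dots> = cis (- (2 * pi / real N) * (\<Sum>i<n. of_int (s i) * ?E i))"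
      unfolding prod_cis sum_distrib_left[symmetric] key ..
    also have "\<dots> = (\<Prod>i<n. cis (- (2 * pi / real N) * (of_int (s i) * ?E i)))"
      unfolding prod_cis sum_distrib_left ..
    finally show ?thesis .
  qed
  then show ?thesis
    unfolding alt_pairing_def alt_eq_sum_transposed cnj_sum sum_product
    by (intro sum.cong refl) (simp add: mult_ac)
qed

text \<open>Freezing the last coordinate at 0 uses up translation invariance; each pair of
  permutations then gives a product of n - 1 geometric sums. By \<open>matching_permutations\<close>
  only the \<open>fact n\<close> diagonal pairs survive, and their signs square to 1.\<close>

lemma sum_tuples_alt_pairing:
  assumes n: "n \<ge> 1" and N: "N > 0"
    and dec: "decreasing n l" "decreasing n m" and last: "l (n - 1) = 0" "m (n - 1) = 0"
    and less: "\<And>i. i < n \<Longrightarrow> l i < N" "\<And>i. i < n \<Longrightarrow> m i < N"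
    and r: "int (\<Sum>i<n. l i) - int (\<Sum>i<n. m i) = int n * r"
  shows "(\<Sum>t\<in>PiE {..<n - 1} (\<lambda>_. {..<N}).
      alt_pairing n N l m (\<lambda>i. if i < n - 1 then int (t i) else 0)) =
    (if \<forall>i<n. l i = m i then of_nat (fact n * N ^ (n - 1)) else 0)"
proof -
  let ?T = "PiE {..<n - 1} (\<lambda>_. {..<N})" and ?W = "{w. w permutes {..<n}}"
  define D where "D = (\<lambda>w w' (i :: nat). int (l (w i)) - int (m (w' i)) - r)"
  let ?c = "\<lambda>a d. cis (- (2 * pi / real N) * (real a * of_int d))"
  have inner: "(\<Sum>t\<in>?T. \<Prod>i<n. cis (- (2 * pi / real N) *
        (of_int (if i < n - 1 then int (t i) else 0) * of_int (D w w' i)))) =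
      (if w = w' \<and> (\<forall>i<n. l i = m i) then of_nat (N ^ (n - 1)) else 0)"
    if w: "w \<in> ?W" and w': "w' \<in> ?W" for w w'
  proof -
    have "(\<Sum>t\<in>?T. \<Prod>i<n. cis (- (2 * pi / real N) *
        (of_int (if i < n - 1 then int (t i) else 0) * of_int (D w w' i)))) =
      (\<Sum>t\<in>?T. \<Prod>i<n - 1. ?c (t i) (D w w' i))"
      by (intro sum.cong refl prod.mono_neutral_cong_right) (use n in auto)
    also have "\<dots> = (\<Prod>i<n - 1. \<Sum>a<N. ?c a (D w w' i))"
      by (rule prod_sum_PiE[symmetric]) auto
    also have "\<dots> = (\<Prod>i<n - 1. if int N dvd D w w' i then of_nat N else 0)"
      by (simp only: sum_roots_of_unity[OF N])
    also have "\<dots> = (if w = w' \<and> (\<forall>i<n. l i = m i) then of_nat (N ^ (n - 1)) else 0)"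
    proof (cases "\<forall>i<n - 1. int N dvd D w w' i")
      case True
      then have "w = w' \<and> (\<forall>i<n. l i = m i)"
        using w w' by (intro matching_permutations[OF dec last less n r]) (auto simp: D_def)
      then show ?thesis using True by simp
    next
      case False
      then obtain i where i: "i < n - 1" "\<not> int N dvd D w w' i" by auto
      have "\<not> (w = w' \<and> (\<forall>i<n. l i = m i))"
      proof
        assume eq: "w = w' \<and> (\<forall>i<n. l i = m i)"
        then have "int n * r = 0" using r by simp
        then have "r = 0" using n by simp
        moreover have "w i < n" using permutes_in_image[of w "{..<n}" i] w i by simp
        ultimately have "D w w' i = 0" using eq by (simp add: D_def)
        then show False using i by simp
      qed
      moreover have "(\<Prod>i<n - 1. if int N dvd D w w' i then of_nat N else 0 :: complex) = 0"
        by (rule prod_zero) (use i in auto)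
      ultimately show ?thesis by (simp only: if_False)
    qed
    finally show ?thesis .
  qed
  have "(\<Sum>t\<in>?T. alt_pairing n N l m (\<lambda>i. if i < n - 1 then int (t i) else 0)) =
      (\<Sum>t\<in>?T. \<Sum>w\<in>?W. \<Sum>w'\<in>?W. of_int (sign w * sign w') * (\<Prod>i<n. cis (- (2 * pi / real N) *
        (of_int (if i < n - 1 then int (t i) else 0) * of_int (D w w' i)))))"
    unfolding D_def using n by (intro sum.cong refl alt_pairing_expand[OF _ r]) simp
  also have "\<dots> = (\<Sum>w\<in>?W. \<Sum>t\<in>?T. \<Sum>w'\<in>?W. of_int (sign w * sign w') * (\<Prod>i<n. cis (- (2 * pi / real N) *
        (of_int (if i < n - 1 then int (t i) else 0) * of_int (D w w' i)))))"
    by (rule sum.swap)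
  also have "\<dots> = (\<Sum>w\<in>?W. \<Sum>w'\<in>?W. \<Sum>t\<in>?T. of_int (sign w * sign w') * (\<Prod>i<n. cis (- (2 * pi / real N) *
        (of_int (if i < n - 1 then int (t i) else 0) * of_int (D w w' i)))))"
    by (intro sum.cong refl sum.swap)
  also have "\<dots> = (\<Sum>w\<in>?W. \<Sum>w'\<in>?W. of_int (sign w * sign w') *
      (if w = w' \<and> (\<forall>i<n. l i = m i) then of_nat (N ^ (n - 1)) else 0))"
    unfolding sum_distrib_left[symmetric] by (intro sum.cong refl) (simp only: inner)
  also have "\<dots> = (\<Sum>w\<in>?W. if \<forall>i<n. l i = m i then of_nat (N ^ (n - 1)) else 0)"
  proof (rule sum.cong[OF refl])
    fix w assume w: "w \<in> ?W"
    have "(\<Sum>w'\<in>?W. of_int (sign w * sign w') *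
        (if w = w' \<and> (\<forall>i<n. l i = m i) then of_nat (N ^ (n - 1)) else 0 :: complex)) =
      (\<Sum>w'\<in>?W. if w' = w then if \<forall>i<n. l i = m i then of_nat (N ^ (n - 1)) else 0 else 0)"
      by (rule sum.cong[OF refl]) (auto simp: sign_def)
    then show "(\<Sum>w'\<in>?W. of_int (sign w * sign w') *
        (if w = w' \<and> (\<forall>i<n. l i = m i) then of_nat (N ^ (n - 1)) else 0 :: complex)) =
      (if \<forall>i<n. l i = m i then of_nat (N ^ (n - 1)) else 0)"
      using w by (simp add: sum.delta' finite_permutations del: of_nat_power)
  qed
  also have "\<dots> = (if \<forall>i<n. l i = m i then of_nat (fact n * N ^ (n - 1)) else 0)"
  proof (cases "\<forall>i<n. l i = m i")
    case True
    have "card ?W = fact n" by (rule card_permutations) auto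
    then show ?thesis by (simp only: if_P[OF True] sum_constant of_nat_mult)
  next
    case False
    show ?thesis by (simp only: if_not_P[OF False] sum.neutral_const)
  qed
  finally show ?thesis .
qed

section \<open>From tuples to box partitions\<close>

lemma decreasing_shifted: "\<sigma> \<in> box_partitions (n - 1) k \<Longrightarrow> decreasing n (shifted n \<sigma>)"
  using decreasing_partition[of \<sigma> n] by (simp add: box_partitions_def shifted_def[abs_def])

lemma shifted_last: "\<sigma> \<in> box_partitions (n - 1) k \<Longrightarrow> n \<ge> 1 \<Longrightarrow> shifted n \<sigma> (n - 1) = 0"
  by (simp add: box_partitions_iff shifted_def)

lemma shifted_less:
  assumes "\<sigma> \<in> box_partitions (n - 1) k" "k \<ge> 1"
  shows "shifted n \<sigma> i < n + k"
proof (cases "n = 0 \<or> i \<ge> n")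
  case True
  then have "i \<ge> n - 1" by auto
  then show ?thesis using assms True by (auto simp: shifted_def box_partitions_iff)
next
  case False
  have "\<sigma> i \<le> k" using partition_le_0[of \<sigma> i] assms by (auto simp: box_partitions_def)
  then show ?thesis using False unfolding shifted_def by linarith
qed

lemma exists_decreasing_permutation:
  fixes t :: "nat \<Rightarrow> nat"
  assumes "inj_on t {..<h}"
  shows "\<exists>d p. p permutes {..<h} \<and> (\<forall>i<h. t i = d (p i)) \<and> decreasing h d \<and> d ` {..<h} = t ` {..<h}"
proof -
  define xs where "xs = rev (sorted_list_of_set (t ` {..<h}))"
  define d where "d = (\<lambda>i. xs ! i)"
  have len: "length xs = h" using card_image[OF assms] by (simp add: xs_def)
  have "sorted_wrt (\<lambda>x y. y < x) xs"
    unfolding xs_def sorted_wrt_rev by (rule strict_sorted_list_of_set)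
  then have dec: "decreasing h d" using len by (simp add: decreasing_def d_def sorted_wrt_iff_nth_less)
  have im: "d ` {..<h} = t ` {..<h}"
    using nth_image[of h xs] len by (simp add: d_def xs_def atLeast0LessThan)
  have inj: "inj_on d {..<h}"
  proof (rule inj_onI)
    fix i j assume "i \<in> {..<h}" "j \<in> {..<h}" "d i = d j"
    then show "i = j" using dec unfolding decreasing_def by (cases i j rule: linorder_cases) force+
  qed
  define p where "p = (\<lambda>i. if i < h then inv_into {..<h} d (t i) else i)"
  have ti: "t i \<in> d ` {..<h}" if "i < h" for i using that im by auto
  have "bij_betw p {..<h} {..<h}"
  proof -
    have "inj_on p {..<h}"
    proof (rule inj_onI)
      fix i j assume ij: "i \<in> {..<h}" "j \<in> {..<h}" "p i = p j"
      then have "t i = t j" using inv_into_injective[OF _ ti[of i] ti[of j]] by (simp add: p_def)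
      then show "i = j" using assms ij by (auto dest: inj_onD)
    qed
    moreover have "p ` {..<h} \<subseteq> {..<h}" using inv_into_into[OF ti] by (auto simp: p_def)
    ultimately show ?thesis by (simp add: bij_betw_def endo_inj_surj)
  qed
  then have "p permutes {..<h}" by (rule bij_imp_permutes) (auto simp: p_def)
  moreover have "t i = d (p i)" if "i < h" for i using f_inv_into_f[OF ti[OF that]] that by (simp add: p_def)
  ultimately show ?thesis using dec im by blast
qed

text \<open>Sorting a tuple of distinct entries gives the permutation and the first n - 1 shifted
  parts. Entries must be nonzero because the last shifted part is 0.\<close>

lemma bij_betw_box_tuples:
  assumes n: "n \<ge> 2" and k: "k \<ge> 1"
  shows "bij_betw (\<lambda>(\<sigma>, p). restrict (\<lambda>i. shifted n \<sigma> (p i)) {..<n - 1})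
    (box_partitions (n - 1) k \<times> {p. p permutes {..<n - 1}})
    {t \<in> PiE {..<n - 1} (\<lambda>_. {..<n + k}). inj_on t {..<n - 1} \<and> (\<forall>i<n - 1. t i \<noteq> 0)}"
    (is "bij_betw ?f (?box \<times> ?P) ?T")
proof -
  define h where "h = n - 1"
  have hn: "n = Suc h" using n by (simp add: h_def)
  have dec: "decreasing h (shifted n \<sigma>)" if "\<sigma> \<in> ?box" for \<sigma>
    using decreasing_shifted[OF that] by (simp add: decreasing_def hn)
  have "inj_on ?f (?box \<times> ?P)"
  proof (rule inj_onI, clarify)
    fix \<sigma> p \<tau> p' assume s: "\<sigma> \<in> ?box" "\<tau> \<in> ?box" and p: "p permutes {..<n - 1}" "p' permutes {..<n - 1}"
      and eq: "restrict (\<lambda>i. shifted n \<sigma> (p i)) {..<n - 1} = restrict (\<lambda>i. shifted n \<tau> (p' i)) {..<n - 1}"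
    have e: "shifted n \<sigma> (p i) = shifted n \<tau> (p' i)" if "i < h" for i
      using fun_cong[OF eq, of i] that by (simp add: h_def)
    have p: "p permutes {..<h}" "p' permutes {..<h}" using p by (simp_all add: h_def)
    define w where "w = p' \<circ> Hilbert_Choice.inv p"
    have w: "w permutes {..<h}" unfolding w_def by (rule permutes_compose[OF permutes_inv[OF p(1)] p(2)])
    have e': "shifted n \<sigma> j = shifted n \<tau> (w j)" if "j < h" for j
      using e[of "Hilbert_Choice.inv p j"] permutes_inverses(1)[OF p(1), of j]
        permutes_in_image[OF permutes_inv[OF p(1)], of j] that by (simp add: w_def)
    have "w = id" by (rule decreasing_permute_eq_id[OF w dec[OF s(1)] dec[OF s(2)] e'])
    then have "w (p i) = p i" for i by simp
    then have "p' i = p i" for i by (simp add: w_def permutes_inverses(2)[OF p(1)])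
    moreover have "\<sigma> i = \<tau> i" for i
      using e'[of i] \<open>w = id\<close> s by (cases "i < h") (auto simp: shifted_def box_partitions_iff h_def)
    ultimately show "\<sigma> = \<tau> \<and> p = p'" by auto
  qed
  moreover have "?f ` (?box \<times> ?P) = ?T"
  proof
    show "?f ` (?box \<times> ?P) \<subseteq> ?T"
    proof (rule image_subsetI)
      fix y assume "y \<in> ?box \<times> ?P"
      then obtain \<sigma> p where y: "y = (\<sigma>, p)" and s: "\<sigma> \<in> ?box" and p: "p permutes {..<n - 1}"
        by auto
      have pi: "p i < n - 1" if "i < n - 1" for i using permutes_in_image[OF p, of i] that by simp
      have "inj_on (\<lambda>i. shifted n \<sigma> (p i)) {..<n - 1}"
      proof (rule inj_onI)
        fix i j assume ij: "i \<in> {..<n - 1}" "j \<in> {..<n - 1}" "shifted n \<sigma> (p i) = shifted n \<sigma> (p j)"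
        then have "p i = p j"
          using dec[OF s] pi[of i] pi[of j] unfolding decreasing_def h_def
          by (metis lessThan_iff less_irrefl linorder_neqE_nat)
        then show "i = j" using permutes_inj[OF p] by (auto dest: injD)
      qed
      moreover have "shifted n \<sigma> (p i) \<noteq> 0" if "i < n - 1" for i using pi[OF that] by (simp add: shifted_def)
      ultimately show "?f y \<in> ?T"
        unfolding y using shifted_less[OF s k] by (auto simp: inj_on_def)
    qed
    show "?T \<subseteq> ?f ` (?box \<times> ?P)"
    proof
      fix t assume t: "t \<in> ?T"
      then have ti: "t i < n + k" "t i \<noteq> 0" if "i < h" for i using that by (auto simp: h_def)
      obtain d p where p: "p permutes {..<h}" and tp: "\<forall>i<h. t i = d (p i)"
        and d: "decreasing h d" and im: "d ` {..<h} = t ` {..<h}"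
        using exists_decreasing_permutation[of t h] t unfolding h_def by blast
      have di: "d i < n + k" "d i \<noteq> 0" if "i < h" for i
      proof -
        have "d i \<in> t ` {..<h}" using im that by auto
        then show "d i < n + k" "d i \<noteq> 0" using ti by auto
      qed
      define \<sigma> where "\<sigma> = (\<lambda>i. if i < h then d i - (h - i) else 0)"
      have step: "d (Suc i) < d i" if "Suc i < h" for i using d that by (simp add: decreasing_def)
      \<comment> \<open>Strict decrease together with a positive last entry; hence the truncated
        subtraction in \<open>\<sigma>\<close> loses nothing.\<close>
      have low: "h - i \<le> d i" if "i < h" for i
        using that
      proof (induction "h - i" arbitrary: i)
        case (Suc a)
        show ?case
        proof (cases "Suc i < h")
          case True
          then have "h - Suc i \<le> d (Suc i)" using Suc.hyps(1)[of "Suc i"] Suc.hyps(2) by simp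
          then show ?thesis using step[OF True] by linarith
        next
          case False
          then show ?thesis using di(2)[OF Suc.prems] Suc.prems by linarith
        qed
      qed simp
      have "antimono \<sigma>"
      proof (rule decseq_SucI)
        fix i show "\<sigma> (Suc i) \<le> \<sigma> i"
          using step[of i] by (cases "Suc i < h") (auto simp: \<sigma>_def)
      qed
      moreover have "\<sigma> 0 \<le> k" using di(1)[of 0] by (cases "0 < h") (auto simp: \<sigma>_def hn)
      ultimately have s: "\<sigma> \<in> ?box" by (simp add: box_partitions_iff h_def \<sigma>_def)
      have "shifted n \<sigma> i = d i" if "i < h" for i
        using low[OF that] that by (simp add: shifted_def \<sigma>_def hn)
      then have sh: "shifted n \<sigma> (p i) = t i" if "i < h" for i
        using tp permutes_in_image[OF p, of i] that by simp
      have "t = ?f (\<sigma>, p)"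
      proof
        fix i show "t i = ?f (\<sigma>, p) i"
          using sh[of i] t by (cases "i < h") (auto simp: h_def PiE_def extensional_def)
      qed
      then show "t \<in> ?f ` (?box \<times> ?P)" using s p by (intro image_eqI[of _ _ "(\<sigma>, p)"]) (auto simp: h_def)
    qed
  qed
  ultimately show ?thesis by (simp add: bij_betw_def)
qed

lemma sum_tuples_eq_sum_box:
  assumes n: "n \<ge> 2" and k: "k \<ge> 1"
  shows "(\<Sum>t\<in>PiE {..<n - 1} (\<lambda>_. {..<n + k}).
      alt_pairing n (n + k) l m (\<lambda>i. if i < n - 1 then int (t i) else 0)) =
    fact (n - 1) * (\<Sum>\<sigma>\<in>box_partitions (n - 1) k. alt_pairing n (n + k) l m (\<lambda>i. int (shifted n \<sigma> i)))"
proof -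
  let ?T = "PiE {..<n - 1} (\<lambda>_. {..<n + k})"
  let ?T' = "{t \<in> ?T. inj_on t {..<n - 1} \<and> (\<forall>i<n - 1. t i \<noteq> 0)}"
  let ?P = "{p. p permutes {..<n - 1}}" and ?box = "box_partitions (n - 1) k"
  let ?e = "\<lambda>t i. if i < n - 1 then int (t i) else 0"
  let ?a = "alt_pairing n (n + k) l m"
  have card_P: "card ?P = fact (n - 1)" by (rule card_permutations) auto
  have zero: "?a s = 0" if "i < n" "j < n" "i \<noteq> j" "s i = s j" for s i j
  proof -
    have "alt n (bethe_point n (n + k) s) l = 0"
      by (rule alt_eq_0_variables[of i _ j]) (use that in \<open>auto simp: bethe_point_def\<close>)
    then show ?thesis by (simp add: alt_pairing_def)
  qed
  have "(\<Sum>t\<in>?T. ?a (?e t)) = (\<Sum>t\<in>?T'. ?a (?e t))"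
  proof (rule sum.mono_neutral_right)
    show "finite ?T" by (rule finite_PiE) auto
    show "\<forall>t\<in>?T - ?T'. ?a (?e t) = 0"
    proof
      fix t assume "t \<in> ?T - ?T'"
      then consider i j where "i < n - 1" "j < n - 1" "i \<noteq> j" "t i = t j" | i where "i < n - 1" "t i = 0"
        by (auto simp: inj_on_def)
      then show "?a (?e t) = 0"
      proof cases
        case 1
        then show ?thesis by (intro zero[of i j]) auto
      next
        case 2
        then show ?thesis by (intro zero[of i "n - 1"]) auto
      qed
    qed
  qed auto
  also have "\<dots> = (\<Sum>x\<in>?box \<times> ?P. ?a (?e ((\<lambda>(\<sigma>, p). restrict (\<lambda>i. shifted n \<sigma> (p i)) {..<n - 1}) x)))"
    by (rule sum.reindex_bij_betw[OF bij_betw_box_tuples[OF n k], symmetric])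
  also have "\<dots> = (\<Sum>(\<sigma>, p)\<in>?box \<times> ?P. ?a (?e (restrict (\<lambda>i. shifted n \<sigma> (p i)) {..<n - 1})))"
    by (simp only: case_prod_unfold)
  also have "\<dots> = (\<Sum>(\<sigma>, p)\<in>?box \<times> ?P. ?a (\<lambda>i. int (shifted n \<sigma> i)))"
  proof (rule sum.cong[OF refl], clarify)
    fix \<sigma> p assume s: "\<sigma> \<in> ?box" and p: "p permutes {..<n - 1}"
    have pn: "p permutes {..<n}" by (rule permutes_subset[OF p]) auto
    have "?a (?e (restrict (\<lambda>i. shifted n \<sigma> (p i)) {..<n - 1})) = ?a (\<lambda>i. int (shifted n \<sigma> (p i)))"
    proof (rule alt_pairing_cong)
      fix i assume "i < n"
      then have "i = n - 1 \<and> p i = n - 1" if "\<not> i < n - 1"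
        using that permutes_not_in[OF p, of i] by auto
      then show "?e (restrict (\<lambda>i. shifted n \<sigma> (p i)) {..<n - 1}) i = int (shifted n \<sigma> (p i))"
        using shifted_last[OF s] n by (cases "i < n - 1") auto
    qed
    also have "\<dots> = ?a (\<lambda>i. int (shifted n \<sigma> i))"
      using alt_pairing_permute[OF pn, of "n + k" l m "\<lambda>i. int (shifted n \<sigma> i)"] by simp
    finally show "?a (?e (restrict (\<lambda>i. shifted n \<sigma> (p i)) {..<n - 1})) = ?a (\<lambda>i. int (shifted n \<sigma> i))" .
  qed
  also have "\<dots> = fact (n - 1) * (\<Sum>\<sigma>\<in>?box. ?a (\<lambda>i. int (shifted n \<sigma> i)))"
    using card_P by (simp add: sum.cartesian_product[symmetric] sum_distrib_left)
  finally show ?thesis .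
qed

text \<open>Passing from tuples to the box divides \<open>fact n\<close> by
  \<open>fact (n - 1)\<close>; the resulting constant is the one under the square root in the
  definition of S.\<close>

lemma sum_alt_pairing:
  assumes n: "n \<ge> 2" and k: "k \<ge> 1" and box: "\<kappa> \<in> box_partitions (n - 1) k" "\<nu> \<in> box_partitions (n - 1) k"
  shows "(\<Sum>\<sigma>\<in>box_partitions (n - 1) k.
      alt_pairing n (n + k) (shifted n \<kappa>) (shifted n \<nu>) (\<lambda>i. int (shifted n \<sigma> i))) =
    (if \<kappa> = \<nu> then of_nat (n * (n + k) ^ (n - 1)) else 0)" (is "?B = _")
proof -
  have eq: "(\<forall>i<n. shifted n \<kappa> i = shifted n \<nu> i) \<longleftrightarrow> \<kappa> = \<nu>"
  proof
    assume *: "\<forall>i<n. shifted n \<kappa> i = shifted n \<nu> i"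
    show "\<kappa> = \<nu>"
    proof
      fix i show "\<kappa> i = \<nu> i"
        using * box by (cases "i < n") (auto simp: shifted_def box_partitions_iff)
    qed
  qed simp
  show ?thesis
  proof (cases "int n dvd int (\<Sum>i<n. shifted n \<kappa> i) - int (\<Sum>i<n. shifted n \<nu> i)")
    case False
    then have "\<kappa> \<noteq> \<nu>" by auto
    then show ?thesis using sum_alt_pairing_eq_0[OF n False] by simp
  next
    case True
    then obtain r where r: "int (\<Sum>i<n. shifted n \<kappa> i) - int (\<Sum>i<n. shifted n \<nu> i) = int n * r" by (elim dvdE)
    have "fact (n - 1) * ?B = (if \<kappa> = \<nu> then of_nat (fact n * (n + k) ^ (n - 1)) else 0)"
      unfolding sum_tuples_eq_sum_box[OF n k, symmetric] eq[symmetric]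
      using n k by (intro sum_tuples_alt_pairing[where r = r] decreasing_shifted[OF box(1)] decreasing_shifted[OF box(2)]
          shifted_last[OF box(1)] shifted_last[OF box(2)] shifted_less[OF box(1)] shifted_less[OF box(2)] r) auto
    moreover have "fact n = n * fact (n - 1)" using n by (simp add: fact_reduce)
    ultimately have "fact (n - 1) * ?B = fact (n - 1) * (if \<kappa> = \<nu> then of_nat (n * (n + k) ^ (n - 1)) else 0)"
      by (simp add: mult_ac)
    then show ?thesis by (subst (asm) mult_left_cancel) simp_all
  qed
qed

lemma S_prefactor_norm:
  assumes "n > 0"
  shows "S_prefactor n k * cnj (S_prefactor n k) = inverse (of_nat (n * (n + k) ^ (n - 1)))"
proof -
  let ?R = "real n * real (k + n) ^ (n - 1)"
  have "S_prefactor n k = cis (pi * real n * (real n - 1) / 4) / of_real (sqrt ?R)"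
    by (simp add: S_prefactor_def cis_conv_exp)
  then have "S_prefactor n k * cnj (S_prefactor n k) =
      (cis (pi * real n * (real n - 1) / 4) * cnj (cis (pi * real n * (real n - 1) / 4))) /
        (of_real (sqrt ?R) * of_real (sqrt ?R))"
    by simp
  also have "cis (pi * real n * (real n - 1) / 4) * cnj (cis (pi * real n * (real n - 1) / 4)) = 1"
    by (simp add: cis_cnj cis_mult)
  also have "of_real (sqrt ?R) * of_real (sqrt ?R) = complex_of_real ?R"
    unfolding of_real_mult[symmetric] by (rule arg_cong[of _ _ of_real]) simp
  also have "complex_of_real ?R = of_nat (n * (n + k) ^ (n - 1))" by (simp add: add.commute)
  finally show ?thesis by (simp add: divide_inverse)
qed

theorem S_matrix_unitary:
  assumes "n \<ge> 2" "k \<ge> 1" "\<kappa> \<in> box_partitions (n - 1) k" "\<nu> \<in> box_partitions (n - 1) k"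
  shows "(\<Sum>\<sigma>\<in>box_partitions (n - 1) k. S_matrix n k \<kappa> \<sigma> * cnj (S_matrix n k \<nu> \<sigma>)) =
    (if \<kappa> = \<nu> then 1 else 0)"
proof -
  have n: "n > 0" using assms(1) by simp
  define M where "M = n * (n + k) ^ (n - 1)"
  have M: "M \<noteq> 0" using n by (simp add: M_def)
  have "(\<Sum>\<sigma>\<in>box_partitions (n - 1) k. S_matrix n k \<kappa> \<sigma> * cnj (S_matrix n k \<nu> \<sigma>)) =
    (\<Sum>\<sigma>\<in>box_partitions (n - 1) k. S_prefactor n k * cnj (S_prefactor n k) *
      alt_pairing n (n + k) (shifted n \<kappa>) (shifted n \<nu>) (\<lambda>i. int (shifted n \<sigma> i)))"
    unfolding S_matrix_eq_alt[OF n] alt_pairing_def by (simp add: mult_ac)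
  also have "\<dots> = inverse (of_nat M) * (if \<kappa> = \<nu> then of_nat M else 0)"
    unfolding sum_distrib_left[symmetric] sum_alt_pairing[OF assms] S_prefactor_norm[OF n] M_def ..
  also have "\<dots> = (if \<kappa> = \<nu> then 1 else 0)" using M by simp
  finally show ?thesis .
qed

section \<open>Fusion coefficients\<close>

lemma symbol_of_conjugate_inject:
  assumes "\<kappa> \<in> box_partitions h k" "\<nu> \<in> box_partitions h k"
    and "symbol_of k (conjugate \<kappa>) = symbol_of k (conjugate \<nu>)"
  shows "\<kappa> = \<nu>"
proof -
  have part: "is_partition \<kappa>" "is_partition \<nu>" "\<kappa> 0 \<le> k" "\<nu> 0 \<le> k"
    using assms(1,2) by (auto simp: box_partitions_def)
  have "conjugate \<kappa> = conjugate \<nu>"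
  proof
    fix i show "conjugate \<kappa> i = conjugate \<nu> i"
    proof (cases "i < k")
      case True
      then show ?thesis using arg_cong[OF assms(3), of "\<lambda>xs. xs ! i"] by (simp add: symbol_of_def)
    next
      case False
      then show ?thesis
        using less_conjugate_iff[OF part(1), of 0 i] less_conjugate_iff[OF part(2), of 0 i] part(3,4) by simp
    qed
  qed
  then have "conjugate (conjugate \<kappa>) = conjugate (conjugate \<nu>)" by (rule arg_cong)
  then show ?thesis by (simp only: conjugate_conjugate part(1,2))
qed

theorem S_matrix_reduction:
  assumes n: "n \<ge> 2" and k: "k \<ge> 1"
    and box: "\<alpha> \<in> box_partitions (n - 1) k" "\<beta> \<in> box_partitions (n - 1) k" "\<sigma> \<in> box_partitions (n - 1) k"
    and red: "(reduction_step n)\<^sup>*\<^sup>* (initial_combination k \<alpha> \<beta>) X" "fully_reduced n k X"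
  shows "S_matrix n k \<alpha> \<sigma> * S_matrix n k \<beta> \<sigma> / S_matrix n k empty_partition \<sigma> =
    (\<Sum>\<kappa>\<in>box_partitions (n - 1) k.
      of_int (Poly_Mapping.lookup X (symbol_of k (conjugate \<kappa>))) * S_matrix n k \<kappa> \<sigma>)"
proof -
  let ?s = "\<lambda>i. int (shifted n \<sigma> i)" and ?N = "n + k" and ?box = "box_partitions (n - 1) k"
  define x where "x = bethe_point n ?N ?s"
  have n0: "n > 0" "n \<ge> 1" using n by auto
  have dec: "decreasing n (shifted n \<sigma>)" by (rule decreasing_shifted[OF box(3)])
  have "inj_on ?s {..<n}"
  proof (rule inj_onI)
    fix i j assume "i \<in> {..<n}" "j \<in> {..<n}" "?s i = ?s j"
    then show "i = j" using dec unfolding decreasing_def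
      by (metis lessThan_iff less_irrefl linorder_neqE_nat of_nat_eq_iff)
  qed
  then have inj: "inj_on x {..<n}"
    unfolding x_def
  proof (rule inj_on_bethe_point)
    show "?s i < int ?N" for i using shifted_less[OF box(3) k, of i] by (simp only: of_nat_less_iff)
  qed simp
  have nz: "x i \<noteq> 0" if "i < n" for i by (simp add: x_def bethe_point_def)
  have power: "x i ^ ?N = cis (2 * pi * of_int (\<Sum>j<n. ?s j) / real n)" if "i < n" for i
    unfolding x_def by (rule bethe_point_power) (use k in simp)
  have prod1: "(\<Prod>i<n. x i) = 1" unfolding x_def by (rule prod_bethe_point[OF n0(1)])
  obtain g Y u where "quasiperiodic g Y k n u"
    and g: "\<forall>m. m < int ?N \<longrightarrow> 0 \<le> m \<longrightarrow> g m = esym n x (nat m)"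
    using exists_quasiperiodic[OF inj nz power prod1 k n0(2)] by blast
  then interpret quasiperiodic g Y k n u by simp
  let ?F = "\<lambda>\<kappa>. F (symbol_of k (conjugate \<kappa>))" and ?S0 = "S_matrix n k empty_partition \<sigma>"
  have S: "S_matrix n k \<kappa> \<sigma> = ?S0 * ?F \<kappa>" if "\<kappa> \<in> ?box" for \<kappa>
    unfolding S_matrix_eq_alt[OF n0(1)] x_def[symmetric]
    using F_box_partition[OF g[rule_format] that n0(2)] by (simp add: shifted_def[abs_def] mult_ac)
  have part: "is_partition \<alpha>" "is_partition \<beta>" "\<alpha> 0 \<le> k" "\<beta> 0 \<le> k"
    using box by (auto simp: box_partitions_def)
  have inj': "inj_on (\<lambda>\<kappa>. symbol_of k (conjugate \<kappa>)) ?box"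
    by (rule inj_onI) (rule symbol_of_conjugate_inject)
  have "?F \<alpha> * ?F \<beta> = lin F (initial_combination k \<alpha> \<beta>)"
    by (rule lin_initial_combination[OF part, symmetric])
  also have "\<dots> = lin F X"
    by (rule lin_reduction[OF red(1) keys_initial_combination[OF part(1,2)], symmetric])
  also have "\<dots> = (\<Sum>as\<in>(\<lambda>\<kappa>. symbol_of k (conjugate \<kappa>)) ` ?box. of_int (Poly_Mapping.lookup X as) * F as)"
    by (rule lin_eq_sum) (use red(2) finite_box_partitions in \<open>auto simp: fully_reduced_def\<close>)
  also have "\<dots> = (\<Sum>\<kappa>\<in>?box. of_int (Poly_Mapping.lookup X (symbol_of k (conjugate \<kappa>))) * ?F \<kappa>)"
    unfolding sum.reindex[OF inj'] comp_def ..
  finally have FF: "?F \<alpha> * ?F \<beta> = (\<Sum>\<kappa>\<in>?box. of_int (Poly_Mapping.lookup X (symbol_of k (conjugate \<kappa>))) * ?F \<kappa>)" .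
  have "S_matrix n k \<alpha> \<sigma> * S_matrix n k \<beta> \<sigma> / ?S0 = ?S0 * (?F \<alpha> * ?F \<beta>)"
    \<comment> \<open>If \<open>?S0 = 0\<close>, both sides are 0, since division by 0 yields
      0.\<close>
    unfolding S[OF box(1)] S[OF box(2)] by (cases "?S0 = 0") (simp_all add: field_simps)
  also have "\<dots> = (\<Sum>\<kappa>\<in>?box. of_int (Poly_Mapping.lookup X (symbol_of k (conjugate \<kappa>))) * S_matrix n k \<kappa> \<sigma>)"
    unfolding FF sum_distrib_left by (rule sum.cong[OF refl]) (simp add: S mult_ac)
  finally show ?thesis .
qed

text \<open>The first two parts say that every sequence of choices ends in a fully reduced
  combination. As the third part holds for each such outcome, the result does not depend on the
  order of replacements or on the straightening routes.\<close>

theorem mainTheorem1: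
  fixes n k :: nat and lam mu :: "nat \<Rightarrow> nat"
  assumes "n \<ge> 2" and "k \<ge> 1"
    and "lam \<in> box_partitions (n - 1) k" and "mu \<in> box_partitions (n - 1) k"
  shows "(\<nexists>X. X 0 = initial_combination k lam mu \<and>
               (\<forall>i::nat. reduction_step n (X i) (X (Suc i)))) \<and>
         (\<forall>X. (reduction_step n)\<^sup>*\<^sup>* (initial_combination k lam mu) X \<longrightarrow>
               fully_reduced n k X \<or> (\<exists>Y. reduction_step n X Y)) \<and>
         (\<forall>X. (reduction_step n)\<^sup>*\<^sup>* (initial_combination k lam mu) X \<longrightarrow>
               fully_reduced n k X \<longrightarrow>
               (\<forall>\<nu>\<in>box_partitions (n - 1) k.
                  of_int (Poly_Mapping.lookup X (symbol_of k (conjugate \<nu>))) =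
                  fusion_coeff n k lam mu \<nu>))"
proof (intro conjI allI impI ballI)
  show "\<nexists>X. X 0 = initial_combination k lam mu \<and> (\<forall>i::nat. reduction_step n (X i) (X (Suc i)))"
    using reduction_terminates[of n] assms(1) by auto
next
  fix X assume "(reduction_step n)\<^sup>*\<^sup>* (initial_combination k lam mu) X"
  moreover have "is_partition lam" "is_partition mu" using assms by (auto simp: box_partitions_def)
  ultimately have "Poly_Mapping.keys X \<subseteq> partition_symbols k"
    using keys_reduction[OF _ keys_initial_combination] by blast
  then show "fully_reduced n k X \<or> (\<exists>Y. reduction_step n X Y)"
    using assms by (intro reduction_progress) auto
next
  fix X \<nu>
  assume red: "(reduction_step n)\<^sup>*\<^sup>* (initial_combination k lam mu) X" "fully_reduced n k X"
    and \<nu>: "\<nu> \<in> box_partitions (n - 1) k"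
  let ?box = "box_partitions (n - 1) k"
  let ?c = "\<lambda>\<kappa>. of_int (Poly_Mapping.lookup X (symbol_of k (conjugate \<kappa>))) :: complex"
  have "fusion_coeff n k lam mu \<nu> = (\<Sum>\<sigma>\<in>?box.
      (S_matrix n k lam \<sigma> * S_matrix n k mu \<sigma> / S_matrix n k empty_partition \<sigma>) * cnj (S_matrix n k \<nu> \<sigma>))"
    unfolding fusion_coeff_def by (rule sum.cong[OF refl]) simp
  also have "\<dots> = (\<Sum>\<sigma>\<in>?box. (\<Sum>\<kappa>\<in>?box. ?c \<kappa> * S_matrix n k \<kappa> \<sigma>) * cnj (S_matrix n k \<nu> \<sigma>))"
    by (intro sum.cong refl arg_cong[of _ _ "\<lambda>y. y * _"] S_matrix_reduction[OF assms _ red])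
  also have "\<dots> = (\<Sum>\<sigma>\<in>?box. \<Sum>\<kappa>\<in>?box. ?c \<kappa> * (S_matrix n k \<kappa> \<sigma> * cnj (S_matrix n k \<nu> \<sigma>)))"
    by (simp only: sum_distrib_right mult.assoc)
  also have "\<dots> = (\<Sum>\<kappa>\<in>?box. ?c \<kappa> * (\<Sum>\<sigma>\<in>?box. S_matrix n k \<kappa> \<sigma> * cnj (S_matrix n k \<nu> \<sigma>)))"
    unfolding sum_distrib_left by (rule sum.swap)
  also have "\<dots> = (\<Sum>\<kappa>\<in>?box. if \<kappa> = \<nu> then ?c \<nu> else 0)"
    by (rule sum.cong[OF refl]) (subst S_matrix_unitary[OF assms(1,2) _ \<nu>], simp_all)
  also have "\<dots> = ?c \<nu>" using \<nu> finite_box_partitions by simp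
  finally show "?c \<nu> = fusion_coeff n k lam mu \<nu>" ..
qed

end
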